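(* Let $f$ be a periodic trajectory on an $n$-gon $P$, and let $g$ be a saddle connection on an $n$-gon $Q$ obtained from $f$ by transferring $f$ to $Q$. Let $\mathring g$ be the closed path obtained from $g$ by going around the vertices with semicircles according to $f$. Then $f$ is stable if and only if the image $p(\mathring g)$ of $\mathring g$ in the double $\mathcal{D}Q$ is null-homologous.
   Context: Edges of an $n$-gon are labeled $1,\dots,n$; closeness of $n$-gons is measured by the positions of their labeled vertices. A trajectory on $P$ is a function $f:\mathbb{R}\to P$ with constant derivative except when $f(t)$ lies on an edge, where the direction is changed by elastic reflection; $f(t)$ is never a vertex. It is periodic if $f(0)=f(a)$, $f'(0)=f'(a)$ for some $a\ne0$, normalized to $a=1$; the period is taken so that the first and last copies of $P$ in the unfolding along one period differ by a translation. The unfolding of $P$ along $f$: each time $f$ strikes an edge, reflect $P$ across that edge and let $f$ continue in a straight line; the unfolding is the union of the resulting polygons. A saddle connection is a straight line in an unfolding which traverses successive polygons and is periodic but includes one or more vertices. Transfer of $f$ to $Q$: let $U\subset\mathbb{C}$ be the unfolding of $P$ along $f$ with $f(0)=0$, and let $U'$ be obtained by replacing each copy of $P$ by a copy of $Q$ (reflecting successively in the same sequence of edges). If $f(1)=e(t)$ for an edge $e$ of $U$ parametrized by $[0,1]$, let $e'$ be the corresponding edge of $U'$; rotate and rescale $f$ so that it ends at $e'(t)$. When the copies of $Q$ at the two ends differ by a translation and some translate $g$ of the result is contained in $U'$, $g$ is the path on $Q$ obtained from $f$. It is a periodic trajectory if it avoids the vertices (this is the case for $Q$ sufficiently close to $P$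 whenever the translation condition holds), and it is a saddle connection on $Q$ if it includes vertices. $f$ is stable if for all $n$-gons $Q$ sufficiently near $P$ the transfer gives a periodic trajectory on $Q$. Definition of $\mathring g$: let $t_1,\dots,t_k$ be the times (over the period of $f$) at which $g$ strikes a vertex. For small $\epsilon>0$ and each $i$, if the corresponding vertex in the unfolding of $P$ lies to the left of $f$, then $\mathring g$ on $[t_i-\epsilon,t_i+\epsilon]$ is a counter-clockwise semicircle (centered at the vertex) from $g(t_i-\epsilon)$ to $g(t_i+\epsilon)$; if it lies to the right, a clockwise semicircle is used. Elsewhere $\mathring g=g$. Thus $\mathring g$ traverses the same sequence of polygons as $f$. $\mathcal{D}Q$ is the surface obtained by identifying two copies of $Q$ along corresponding edges, with punctures at the vertices; $p$ denotes the natural projection from the unfolding to $\mathcal{D}Q$ (folding copies obtained by an even number of reflections onto one copy of $Q$, and those obtained by an odd number onto the other). Null-homologous means zero in $H_1(\mathcal{D}Q,\mathbb{Z})$. *)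

theory Defs
  imports "HOL-Homology.Homology"
begin

section \<open>Polygons\<close>

text \<open>
  A labelled n-gon is given by its vertices \<open>v 0, \<dots>, v (n - 1)\<close> in cyclic order (other values
  of \<open>v\<close> are irrelevant); edge \<open>i\<close> joins \<open>v i\<close> to \<open>v (i + 1)\<close>, indices modulo \<open>n\<close>. Both
  orientations are allowed, and so are vertices with interior angle \<open>\<pi>\<close>.
\<close>

definition edge_path :: "nat \<Rightarrow> (nat \<Rightarrow> complex) \<Rightarrow> nat \<Rightarrow> real \<Rightarrow> complex" where
  "edge_path n v i = linepath (v i) (v (Suc i mod n))"

definition edge :: "nat \<Rightarrow> (nat \<Rightarrow> complex) \<Rightarrow> nat \<Rightarrow> complex set" where
  "edge n v i = path_image (edge_path n v i)"

definition vertices :: "nat \<Rightarrow> (nat \<Rightarrow> complex) \<Rightarrow> complex set" where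
  "vertices n v = v ` {..<n}"

definition boundary :: "nat \<Rightarrow> (nat \<Rightarrow> complex) \<Rightarrow> complex set" where
  "boundary n v = (\<Union>i<n. edge n v i)"

definition region :: "nat \<Rightarrow> (nat \<Rightarrow> complex) \<Rightarrow> complex set" where
  "region n v = boundary n v \<union> inside (boundary n v)"

text \<open>Simplicity of the boundary: distinct edges meet at most in common endpoints.\<close>

definition ngon :: "nat \<Rightarrow> (nat \<Rightarrow> complex) \<Rightarrow> bool" where
  "ngon n v \<longleftrightarrow> 3 \<le> n \<and> inj_on v {..<n} \<and>
     (\<forall>i<n. \<forall>j<n. i \<noteq> j \<longrightarrow>
        edge n v i \<inter> edge n v j \<subseteq> {v i, v (Suc i mod n)} \<inter> {v j, v (Suc j mod n)})"

definition mirror :: "nat \<Rightarrow> (nat \<Rightarrow> complex) \<Rightarrow> nat \<Rightarrow> complex \<Rightarrow> complex" where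
  "mirror n v i z = (let a = v i; d = v (Suc i mod n) - v i in a + d * cnj ((z - a) / d))"

section \<open>Trajectories\<close>

text \<open>
  Constancy of the derivative is written out as local affinity. At a point of an edge the motion
  after the impact is the mirror image of the continued incoming motion.
\<close>

definition trajectory :: "nat \<Rightarrow> (nat \<Rightarrow> complex) \<Rightarrow> (real \<Rightarrow> complex) \<Rightarrow> bool" where
  "trajectory n v f \<longleftrightarrow>
     (\<forall>t. f t \<in> region n v - vertices n v) \<and>
     (\<forall>t. f t \<notin> boundary n v \<longrightarrow>
        (\<exists>u. u \<noteq> 0 \<and> (\<forall>\<^sub>F h in nhds 0. f (t + h) = f t + of_real h * u))) \<and>
     (\<forall>t. \<forall>i<n. f t \<in> edge n v i \<longrightarrow>
        (\<exists>u. u \<noteq> 0 \<and> (\<forall>\<^sub>F h in at_left 0. f (t + h) = f t + of_real h * u) \<and>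
           (\<forall>\<^sub>F h in at_right 0. f (t + h) = mirror n v i (f t + of_real h * u))))"

text \<open>
  \<open>hit_time n v f j\<close> is the \<open>j\<close>-th time at which \<open>f\<close> strikes an edge (with \<open>f 0\<close> on an edge,
  which counts as number 0), \<open>hit_edge n v f j\<close> the label of that edge, and \<open>num_hits n v f\<close>
  the number of strikes during one period, taken to be the interval \<open>(0, 1]\<close>.
\<close>

primrec hit_time :: "nat \<Rightarrow> (nat \<Rightarrow> complex) \<Rightarrow> (real \<Rightarrow> complex) \<Rightarrow> nat \<Rightarrow> real" where
  "hit_time n v f 0 = 0"
| "hit_time n v f (Suc j) = Inf {t. hit_time n v f j < t \<and> f t \<in> boundary n v}"

definition hit_edge :: "nat \<Rightarrow> (nat \<Rightarrow> complex) \<Rightarrow> (real \<Rightarrow> complex) \<Rightarrow> nat \<Rightarrow> nat" where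
  "hit_edge n v f j = (THE i. i < n \<and> f (hit_time n v f j) \<in> edge n v i)"

definition num_hits :: "nat \<Rightarrow> (nat \<Rightarrow> complex) \<Rightarrow> (real \<Rightarrow> complex) \<Rightarrow> nat" where
  "num_hits n v f = card {t. 0 < t \<and> t \<le> 1 \<and> f t \<in> boundary n v}"

text \<open>Position of \<open>f\<close> on the edge it strikes at its \<open>j\<close>-th hit, the edge parametrized by \<open>[0,1]\<close>.\<close>

definition hit_param :: "nat \<Rightarrow> (nat \<Rightarrow> complex) \<Rightarrow> (real \<Rightarrow> complex) \<Rightarrow> nat \<Rightarrow> real" where
  "hit_param n v f j = (THE t. 0 \<le> t \<and> t \<le> 1 \<and>
     f (hit_time n v f j) = edge_path n v (hit_edge n v f j) t)"

section \<open>Unfolding and transfer\<close>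

text \<open>
  \<open>unfold_map n P f Q j\<close> is the isometry of the plane that places the \<open>j\<close>-th copy of \<open>Q\<close> in the
  unfolding along the sequence of edges struck by the trajectory \<open>f\<close> on \<open>P\<close>. Copy \<open>j + 1\<close> is the
  reflection of copy \<open>j\<close> in (the image of) the edge number \<open>j + 1\<close>; since copy \<open>j\<close> is the image of
  \<open>Q\<close> under \<open>unfold_map n P f Q j\<close>, this amounts to composing with a reflection of \<open>Q\<close> on the
  right. The first copy is translated so that the point of \<open>Q\<close> corresponding to \<open>f 0\<close> lies at 0.
  With \<open>Q = P\<close> this is the unfolding of \<open>P\<close> along \<open>f\<close>, normalized so that the unfolded \<open>f\<close> starts
  at 0.
\<close>

primrec unfold_map ::
  "nat \<Rightarrow> (nat \<Rightarrow> complex) \<Rightarrow> (real \<Rightarrow> complex) \<Rightarrow> (nat \<Rightarrow> complex) \<Rightarrow> nat \<Rightarrow> complex \<Rightarrow> complex"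
where
  "unfold_map n P f Q 0 =
     (\<lambda>z. z - edge_path n Q (hit_edge n P f 0) (hit_param n P f 0))"
| "unfold_map n P f Q (Suc j) =
     unfold_map n P f Q j \<circ> mirror n Q (hit_edge n P f (Suc j))"

definition ends_translate ::
  "nat \<Rightarrow> (nat \<Rightarrow> complex) \<Rightarrow> (real \<Rightarrow> complex) \<Rightarrow> (nat \<Rightarrow> complex) \<Rightarrow> bool" where
  "ends_translate n P f Q \<longleftrightarrow>
     (\<exists>c. \<forall>z. unfold_map n P f Q (num_hits n P f) z = unfold_map n P f Q 0 z + c)"

text \<open>
  Periodic trajectories of period 1. The base point \<open>f 0 = f 1\<close> lies on an edge, as the transfer
  requires, so velocities are compared through one-sided derivatives.
\<close>

definition periodic_trajectory ::
  "nat \<Rightarrow> (nat \<Rightarrow> complex) \<Rightarrow> (real \<Rightarrow> complex) \<Rightarrow> bool" where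
  "periodic_trajectory n P f \<longleftrightarrow>
     trajectory n P f \<and> f 0 \<in> boundary n P \<and> f 1 = f 0 \<and>
     (\<exists>u. (f has_vector_derivative u) (at_right 0) \<and>
          (f has_vector_derivative u) (at_right 1)) \<and>
     ends_translate n P f P"

text \<open>
  The endpoint \<open>e'(t)\<close> of the transferred path, where \<open>f 1 = e(t)\<close>. In the unfolding of \<open>P\<close> the
  trajectory is the straight path \<open>x \<mapsto> x * e(t)\<close> starting at 0, so rotating and rescaling it to
  end at \<open>e'(t)\<close> gives \<open>x \<mapsto> x * e'(t)\<close>.
\<close>

definition transfer_end ::
  "nat \<Rightarrow> (nat \<Rightarrow> complex) \<Rightarrow> (real \<Rightarrow> complex) \<Rightarrow> (nat \<Rightarrow> complex) \<Rightarrow> complex" where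
  "transfer_end n P f Q = (let m = num_hits n P f in
     unfold_map n P f Q m (edge_path n Q (hit_edge n P f m) (hit_param n P f m)))"

text \<open>
  The plane curve \<open>\<gamma>\<close>, over one period, passes through the successive polygons of the unfolding of
  \<open>Q\<close>: it is in copy \<open>j\<close> between the times \<open>s j\<close> and \<open>s (j + 1)\<close> and enters that copy through
  edge number \<open>j\<close>. As the unfolding may overlap itself in the plane, being contained in it has to
  be understood copy by copy. A period need not start at time 0. Copies are closed polygons, so
  vertices are not excluded.
\<close>

definition traverses ::
  "nat \<Rightarrow> (nat \<Rightarrow> complex) \<Rightarrow> (real \<Rightarrow> complex) \<Rightarrow> (nat \<Rightarrow> complex) \<Rightarrow>
   (real \<Rightarrow> complex) \<Rightarrow> (nat \<Rightarrow> real) \<Rightarrow> bool" where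
  "traverses n P f Q \<gamma> s \<longleftrightarrow> (let m = num_hits n P f in
     s m = s 0 + 1 \<and>
     (\<forall>j\<le>m. \<gamma> (s j) \<in> unfold_map n P f Q j ` edge n Q (hit_edge n P f j)) \<and>
     (\<forall>j<m. s j \<le> s (Suc j) \<and>
        \<gamma> ` {s j..s (Suc j)} \<subseteq> unfold_map n P f Q j ` region n Q))"

text \<open>\<open>\<gamma>\<close> is at time \<open>t\<close> at the vertex \<open>k\<close> of copy \<open>j\<close> while traversing this copy.\<close>

definition strikes ::
  "nat \<Rightarrow> (nat \<Rightarrow> complex) \<Rightarrow> (real \<Rightarrow> complex) \<Rightarrow> (nat \<Rightarrow> complex) \<Rightarrow>
   (real \<Rightarrow> complex) \<Rightarrow> (nat \<Rightarrow> real) \<Rightarrow> real \<Rightarrow> nat \<Rightarrow> nat \<Rightarrow> bool" where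
  "strikes n P f Q \<gamma> s t j k \<longleftrightarrow>
     j < num_hits n P f \<and> k < n \<and> s j \<le> t \<and> t \<le> s (Suc j) \<and> \<gamma> t = unfold_map n P f Q j (Q k)"

text \<open>The straight path \<open>g\<close> on \<open>Q\<close> obtained from \<open>f\<close>, extended to a full line.\<close>

definition transferred_path ::
  "nat \<Rightarrow> (nat \<Rightarrow> complex) \<Rightarrow> (real \<Rightarrow> complex) \<Rightarrow> (nat \<Rightarrow> complex) \<Rightarrow>
   (real \<Rightarrow> complex) \<Rightarrow> (nat \<Rightarrow> real) \<Rightarrow> bool" where
  "transferred_path n P f Q g s \<longleftrightarrow>
     ends_translate n P f Q \<and> transfer_end n P f Q \<noteq> 0 \<and>
     (\<exists>c. \<forall>t. g t = c + of_real t * transfer_end n P f Q) \<and>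
     traverses n P f Q g s"

definition transferred_trajectory ::
  "nat \<Rightarrow> (nat \<Rightarrow> complex) \<Rightarrow> (real \<Rightarrow> complex) \<Rightarrow> (nat \<Rightarrow> complex) \<Rightarrow>
   (real \<Rightarrow> complex) \<Rightarrow> (nat \<Rightarrow> real) \<Rightarrow> bool" where
  "transferred_trajectory n P f Q g s \<longleftrightarrow>
     transferred_path n P f Q g s \<and> (\<nexists>t j k. strikes n P f Q g s t j k)"

definition transferred_saddle_connection ::
  "nat \<Rightarrow> (nat \<Rightarrow> complex) \<Rightarrow> (real \<Rightarrow> complex) \<Rightarrow> (nat \<Rightarrow> complex) \<Rightarrow>
   (real \<Rightarrow> complex) \<Rightarrow> (nat \<Rightarrow> real) \<Rightarrow> bool" where
  "transferred_saddle_connection n P f Q g s \<longleftrightarrow>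
     transferred_path n P f Q g s \<and> (\<exists>t j k. strikes n P f Q g s t j k)"

definition stable :: "nat \<Rightarrow> (nat \<Rightarrow> complex) \<Rightarrow> (real \<Rightarrow> complex) \<Rightarrow> bool" where
  "stable n P f \<longleftrightarrow>
     (\<exists>\<delta>>0. \<forall>Q. ngon n Q \<and> (\<forall>i<n. dist (Q i) (P i) < \<delta>) \<longrightarrow>
        (\<exists>g s. transferred_trajectory n P f Q g s))"

section \<open>Going around the vertices\<close>

text \<open>
  The vertex \<open>k\<close> of copy \<open>j\<close> of \<open>P\<close> lies to the left of the unfolded trajectory: \<open>f\<close> cuts the copy
  into two pieces, and the vertex is in the piece adjacent to the left side of \<open>f\<close>. The half-plane
  to the left of the whole straight line would be the wrong notion for non-convex \<open>P\<close>, whose copies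
  may cross the line outside the segment traversed by \<open>f\<close>. The unfolded \<open>f\<close> runs in the direction
  \<open>transfer_end n P f P\<close>.
\<close>

definition left_of_trajectory ::
  "nat \<Rightarrow> (nat \<Rightarrow> complex) \<Rightarrow> (real \<Rightarrow> complex) \<Rightarrow> nat \<Rightarrow> nat \<Rightarrow> bool" where
  "left_of_trajectory n P f j k \<longleftrightarrow>
     (let R = unfold_map n P f P j; a = hit_time n P f j; b = hit_time n P f (Suc j)
      in \<exists>t. a < t \<and> t < b \<and>
           (\<forall>\<^sub>F \<delta> in at_right 0.
              connected_component (R ` region n P - R ` f ` {a..b})
                (R (f t) + of_real \<delta> * \<i> * transfer_end n P f P) (R (P k))))"

text \<open>
  \<open>\<gamma>\<close> is the path \<open>g\<close> with detours, as an equivariant curve over all of the real line: around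
  each time \<open>t\<close> at which \<open>g\<close> strikes a vertex (and its translates by whole periods) it runs
  through a semicircle about the vertex \<open>g t\<close> from \<open>g (t - \<epsilon>)\<close> to \<open>g (t + \<epsilon>)\<close>, counter-clockwise
  if the corresponding vertex in the unfolding of \<open>P\<close> is to the left of \<open>f\<close> and clockwise otherwise.
\<close>

definition detour ::
  "nat \<Rightarrow> (nat \<Rightarrow> complex) \<Rightarrow> (real \<Rightarrow> complex) \<Rightarrow> (nat \<Rightarrow> complex) \<Rightarrow>
   (real \<Rightarrow> complex) \<Rightarrow> (nat \<Rightarrow> real) \<Rightarrow> real \<Rightarrow> (real \<Rightarrow> complex) \<Rightarrow> bool" where
  "detour n P f Q g s \<epsilon> \<gamma> \<longleftrightarrow> 0 < \<epsilon> \<and>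
     (\<forall>t j k. \<forall>l::int. strikes n P f Q g s t j k \<longrightarrow>
        (let c = t + of_int l; \<sigma> = (if left_of_trajectory n P f j k then 1 else - 1) in
         \<forall>x\<in>{c - \<epsilon>..c + \<epsilon>}.
           \<gamma> x = g c + (g (c - \<epsilon>) - g c) * cis (\<sigma> * pi * (x - (c - \<epsilon>)) / (2 * \<epsilon>)))) \<and>
     (\<forall>x. (\<forall>t j k. \<forall>l::int. strikes n P f Q g s t j k \<longrightarrow> \<epsilon> < \<bar>x - (t + of_int l)\<bar>) \<longrightarrow>
        \<gamma> x = g x)"

section \<open>The double of a polygon\<close>

text \<open>
  The two copies of \<open>Q\<close>, punctured at the vertices, are indexed by \<open>bool\<close>; points of the double are
  the classes of the relation identifying the two copies of each boundary point.
\<close>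

definition double_point ::
  "nat \<Rightarrow> (nat \<Rightarrow> complex) \<Rightarrow> complex \<times> bool \<Rightarrow> (complex \<times> bool) set" where
  "double_point n v p = {q. fst q = fst p \<and> (snd q = snd p \<or> fst p \<in> boundary n v)}"

definition two_copies :: "nat \<Rightarrow> (nat \<Rightarrow> complex) \<Rightarrow> (complex \<times> bool) topology" where
  "two_copies n v =
     prod_topology (top_of_set (region n v - vertices n v)) (discrete_topology UNIV)"

text \<open>The quotient topology.\<close>

definition double :: "nat \<Rightarrow> (nat \<Rightarrow> complex) \<Rightarrow> (complex \<times> bool) set topology" where
  "double n v = topology (\<lambda>U. U \<subseteq> double_point n v ` topspace (two_copies n v) \<and>
     openin (two_copies n v) {p \<in> topspace (two_copies n v). double_point n v p \<in> U})"

lemma openin_double: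
  "openin (double n v) U \<longleftrightarrow> U \<subseteq> double_point n v ` topspace (two_copies n v) \<and>
     openin (two_copies n v) {p \<in> topspace (two_copies n v). double_point n v p \<in> U}"
proof -
  let ?X = "two_copies n v" and ?q = "double_point n v"
  have "istopology (\<lambda>U. U \<subseteq> ?q ` topspace ?X \<and> openin ?X {p \<in> topspace ?X. ?q p \<in> U})"
    unfolding istopology_def
  proof (intro conjI allI impI; (elim conjE)?)
    fix S T
    assume "openin ?X {p \<in> topspace ?X. ?q p \<in> S}" "openin ?X {p \<in> topspace ?X. ?q p \<in> T}"
    then have "openin ?X ({p \<in> topspace ?X. ?q p \<in> S} \<inter> {p \<in> topspace ?X. ?q p \<in> T})"
      by (rule openin_Int)
    then show "openin ?X {p \<in> topspace ?X. ?q p \<in> S \<inter> T}"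
      by (rule back_subst[of "openin ?X"]) auto
  next
    fix \<K> assume *: "\<forall>K\<in>\<K>. K \<subseteq> ?q ` topspace ?X \<and> openin ?X {p \<in> topspace ?X. ?q p \<in> K}"
    then have "openin ?X (\<Union>K\<in>\<K>. {p \<in> topspace ?X. ?q p \<in> K})"
      by blast
    then show "openin ?X {p \<in> topspace ?X. ?q p \<in> \<Union>\<K>}"
      by (rule back_subst[of "openin ?X"]) auto
    show "\<Union>\<K> \<subseteq> ?q ` topspace ?X"
      using * by blast
  qed auto
  then show ?thesis
    by (simp add: double_def)
qed

text \<open>
  The curve \<open>\<gamma>\<close> traverses the unfolding of \<open>Q\<close> without meeting a vertex of the copy it is in, so
  that it can be projected to the double.
\<close>

definition traverses_off_vertices ::
  "nat \<Rightarrow> (nat \<Rightarrow> complex) \<Rightarrow> (real \<Rightarrow> complex) \<Rightarrow> (nat \<Rightarrow> complex) \<Rightarrow>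
   (real \<Rightarrow> complex) \<Rightarrow> (nat \<Rightarrow> real) \<Rightarrow> bool" where
  "traverses_off_vertices n P f Q \<gamma> s \<longleftrightarrow>
     traverses n P f Q \<gamma> s \<and> (\<nexists>t j k. strikes n P f Q \<gamma> s t j k)"

text \<open>
  The image under the folding projection \<open>p\<close>, as a closed path parametrized by \<open>[0,1]\<close>. At a
  crossing time \<open>s j\<close> the two adjacent copies give the same point of the double.
\<close>

definition projected_path ::
  "nat \<Rightarrow> (nat \<Rightarrow> complex) \<Rightarrow> (real \<Rightarrow> complex) \<Rightarrow> (nat \<Rightarrow> complex) \<Rightarrow>
   (real \<Rightarrow> complex) \<Rightarrow> (nat \<Rightarrow> real) \<Rightarrow> real \<Rightarrow> (complex \<times> bool) set" where
  "projected_path n P f Q \<gamma> s x =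
     (let t = s 0 + x; j = (LEAST j. t \<le> s (Suc j))
      in double_point n Q (inv_into UNIV (unfold_map n P f Q j) (\<gamma> t), even j))"

text \<open>
  The class in \<open>H\<^sub>1(X, \<int>)\<close> of a closed path is that of the singular 1-simplex which in barycentric
  coordinates \<open>(b 0, b 1)\<close> is the path evaluated at \<open>b 1\<close>.
\<close>

definition null_homologous :: "'a topology \<Rightarrow> (real \<Rightarrow> 'a) \<Rightarrow> bool" where
  "null_homologous X h \<longleftrightarrow>
     homologous_rel_set 1 X {} (frag_of (restrict (\<lambda>b. h (b 1)) (standard_simplex 1)))
       = \<one>\<^bsub>homology_group 1 X\<^esub>"

end

theory Submission
  imports Defs "HOL-Complex_Analysis.Complex_Analysis"
begin

text \<open>
  For a label \<open>i\<close> let \<open>n\<^sub>i\<close> be the number of even-numbered minus the number of odd-numbered strikes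
  of edge \<open>i\<close> during a period of \<open>f\<close>. Both properties are equivalent to the vanishing of all \<open>n\<^sub>i\<close>.

  Homology: in the contractible punctured polygon an arc from edge \<open>i\<close> to edge \<open>k\<close> is determined up
  to homology by its end points, so the projected curve is homologous to \<open>- \<Sum> n\<^sub>i \<theta>\<^sub>i\<close>, where \<open>\<theta>\<^sub>i\<close>
  runs from a base point to edge \<open>i\<close> on the front and its mirror image returns on the back.
  Conversely, \<open>n\<^sub>i\<close> is, up to sign, the degree of the curve under a map from the double to the circle.
  The semicircles enter only through the sequence of polygons that the curve traverses.

  Stability: the linear part of the isometry relating the two ends of the unfolding of \<open>Q\<close> is
  \<open>\<Prod> (d\<^sub>i / cnj d\<^sub>i) powi (- n\<^sub>i)\<close>, where \<open>d\<^sub>i\<close> is the direction of edge \<open>i\<close>. If all \<open>n\<^sub>i\<close> vanish, it is the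
  identity for every \<open>Q\<close>, and the straight line survives small perturbations because it crosses the
  edges transversally. If it is the identity for all \<open>Q\<close> near \<open>P\<close>, then \<open>\<Prod> d\<^sub>i powi n\<^sub>i\<close> is a real-valued
  holomorphic function of each vertex, so its logarithmic derivatives vanish; this makes \<open>n\<^sub>i / d\<^sub>i\<close>
  independent of \<open>i\<close>, and then either all \<open>n\<^sub>i\<close> vanish or all edges are parallel.
\<close>

section \<open>Singular 1-chains of paths\<close>

text \<open>In the double it records the sheet on which the curve runs. In the plane a reflection
  has linear part \<open>w\<close> to \<open>d / cnj d * cnj w\<close>, and moving a conjugation
  past a unit factor inverts that factor, so consecutive reflections contribute opposite exponents.
  These integers are the only link between the two sides: homology and perturbation are never
  compared directly. Two obstacles shape the work. The polygon need not be convex and is given only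
  as the inside of a closed curve, so its shape near an edge and its contractibility come from the
  Jordan curve theorem, by way of half discs centred on the edges. And among the conditions that
  make the transferred line a trajectory on \<open>Q\<close>, all are open except that the ends
  differ by a translation; this one condition is what the integers control. The circle-valued map
  must turn oppositely on the two sheets and still be well defined where they are glued, which is
  why the value 1/2 appears on an edge.

  The IDEA block above contains a malformed symbol. It is withdrawn and replaced by the complete
  list below.\<close>

definition path_chain :: "(real \<Rightarrow> 'a) \<Rightarrow> 'a chain" where
  "path_chain p = frag_of (restrict (\<lambda>b. p (b 1)) (standard_simplex 1))"

definition point_chain :: "'a \<Rightarrow> 'a chain" where
  "point_chain x = frag_of (restrict (\<lambda>b. x) (standard_simplex 0))"

lemma null_homologous_iff_relboundary:
  "null_homologous X h \<longleftrightarrow> singular_relboundary 1 X {} (path_chain h)"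
  using one_relative_homology_group[of 1 X "{}"]
  by (simp add: null_homologous_def path_chain_def homologous_rel_set_eq_relboundary)

lemma singular_chain_path_chain:
  assumes "pathin X p"
  shows "singular_chain 1 X (path_chain p)"
proof -
  have "continuous_map (subtopology (powertop_real UNIV) (standard_simplex 1)) euclideanreal (\<lambda>b. b 1)"
    by (intro continuous_map_from_subtopology continuous_map_product_projection) auto
  moreover have "b 1 \<in> {0..1}" if "b \<in> standard_simplex 1" for b
    using that by (auto simp: standard_simplex_def)
  ultimately have "continuous_map (subtopology (powertop_real UNIV) (standard_simplex 1))
      (top_of_set {0..1}) (\<lambda>b. b 1)"
    by (simp add: continuous_map_in_subtopology image_subset_iff)
  with assms have "continuous_map (subtopology (powertop_real UNIV) (standard_simplex 1)) X (p \<circ> (\<lambda>b. b 1))"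
    unfolding pathin_def by (rule continuous_map_compose[rotated])
  then have "continuous_map (subtopology (powertop_real UNIV) (standard_simplex 1)) X
      (restrict (\<lambda>b. p (b 1)) (standard_simplex 1))"
    by (rule continuous_map_eq) auto
  then show ?thesis
    by (simp add: path_chain_def singular_chain_of singular_simplex_def)
qed

lemma chain_boundary_path_chain:
  "chain_boundary 1 (path_chain p) = point_chain (p 1) - point_chain (p 0)"
proof -
  \<comment> \<open>Face \<open>k\<close> omits barycentric coordinate \<open>k\<close>: face 0 is
    the point with \<open>b 1 = 1\<close>, the end of the path.\<close>
  have 0: "singular_face 1 0 (restrict (\<lambda>b. p (b 1)) (standard_simplex 1))
        = restrict (\<lambda>b. p 1) (standard_simplex 0)"
    and 1: "singular_face 1 1 (restrict (\<lambda>b. p (b 1)) (standard_simplex 1))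
        = restrict (\<lambda>b. p 0) (standard_simplex 0)"
    by (auto simp: singular_face_def fun_eq_iff restrict_def simplical_face_def
        standard_simplex_def standard_simplex_0 numeral_eq_Suc split: if_splits)
  have "chain_boundary 1 (path_chain p)
      = (\<Sum>k\<le>1. frag_cmul ((-1)^k) (frag_of (singular_face 1 k (restrict (\<lambda>b. p (b 1)) (standard_simplex 1)))))"
    by (simp add: path_chain_def chain_boundary_of)
  also have "\<dots> = point_chain (p 1) - point_chain (p 0)"
    using 0 1 by (simp add: point_chain_def)
  finally show ?thesis .
qed

lemma chain_map_path_chain: "chain_map 1 f (path_chain p) = path_chain (\<lambda>x. f (p x))"
  by (auto simp: path_chain_def simplex_map_def intro!: arg_cong[of _ _ frag_of])

lemma path_chain_cong:
  assumes "\<And>x. 0 \<le> x \<Longrightarrow> x \<le> 1 \<Longrightarrow> p x = q x"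
  shows "path_chain p = path_chain q"
proof -
  have "restrict (\<lambda>b. p (b 1)) (standard_simplex 1) = restrict (\<lambda>b. q (b 1)) (standard_simplex 1)"
    by (rule restrict_ext) (use assms in \<open>auto simp: standard_simplex_def\<close>)
  then show ?thesis
    by (simp add: path_chain_def)
qed

text \<open>
  Subdivisions of a path and changes of path are handled uniformly by writing the relation as a
  1-cycle in a contractible parameter space and mapping it forward.
\<close>

lemma contractible_space_cycle_bounds:
  assumes "contractible_space X" "singular_chain 1 X c" "chain_boundary 1 c = 0"
  shows "singular_relboundary 1 X {} c"
proof -
  have "trivial_group (homology_group 1 X)"
    using trivial_reduced_homology_group_contractible_space[OF assms(1), of 1]
      un_reduced_homology_group[of 1 X] by simp
  moreover have "homologous_rel_set 1 X {} c \<in> carrier (homology_group 1 X)"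
    using carrier_relative_homology_group[of 1 X "{}"] assms by (simp add: singular_cycle)
  ultimately have "homologous_rel_set 1 X {} c = \<one>\<^bsub>homology_group 1 X\<^esub>"
    by (auto simp: trivial_group_def)
  then show ?thesis
    using one_relative_homology_group[of 1 X "{}"]
    by (simp add: homologous_rel_set_eq_relboundary)
qed

lemma contractible_space_homologous:
  assumes "contractible_space X" "singular_chain 1 X c" "singular_chain 1 X d"
    "chain_boundary 1 c = chain_boundary 1 d"
  shows "homologous_rel 1 X {} c d"
  unfolding homologous_rel_def
  by (rule contractible_space_cycle_bounds)
    (use assms in \<open>auto simp: singular_chain_diff chain_boundary_diff\<close>)

lemma homologous_rel_chain_map:
  assumes "homologous_rel p X {} c d" "continuous_map X Y f"
  shows "homologous_rel p Y {} (chain_map p f c) (chain_map p f d)"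
  using singular_relboundary_chain_map[of p X "{}" "c - d" Y f "{}"] assms
  by (simp add: homologous_rel_def chain_map_diff)

lemma pathin_segment:
  fixes q :: "real \<Rightarrow> 'a"
  assumes "continuous_map (top_of_set {a..b}) X q" "a \<le> b"
  shows "pathin X (\<lambda>x. q (a + (b - a) * x))"
proof -
  have "a + (b - a) * x \<le> b" if "0 \<le> x" "x \<le> 1" for x
    using mult_left_mono[of x 1 "b - a"] that assms(2) by simp
  then have "continuous_map (top_of_set {0..1}) (top_of_set {a..b}) (\<lambda>x. a + (b - a) * x)"
    using assms(2) by (auto simp: continuous_map_in_subtopology image_subset_iff intro!: continuous_intros)
  from continuous_map_compose[OF this assms(1)] show ?thesis
    by (simp add: pathin_def o_def)
qed

lemma path_chain_subdivide:
  fixes s :: "nat \<Rightarrow> real"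
  assumes mono: "\<And>j. j < m \<Longrightarrow> s j \<le> s (Suc j)"
    and cont: "continuous_map (top_of_set {s 0..s m}) X p"
  shows "homologous_rel 1 X {} (path_chain (\<lambda>x. p (s 0 + (s m - s 0) * x)))
    (\<Sum>j<m. path_chain (\<lambda>x. p (s j + (s (Suc j) - s j) * x)))"
proof -
  let ?Z = "top_of_set {s 0..s m}"
  let ?l = "\<lambda>a b x. a + (b - a) * x :: real"
  have le: "s i \<le> s j" if "i \<le> j" "j \<le> m" for i j
    using that
  proof (induction rule: dec_induct)
    case (step k)
    then show ?case using mono[of k] by simp
  qed simp
  have l: "singular_chain 1 ?Z (path_chain (?l a b))" if "s 0 \<le> a" "a \<le> b" "b \<le> s m" for a b
  proof -
    have "pathin ?Z (\<lambda>x. id (?l a b x))"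
      by (rule pathin_segment) (use that in \<open>auto simp: continuous_map_in_subtopology\<close>)
    from singular_chain_path_chain[OF this] show ?thesis
      by simp
  qed
  have "homologous_rel 1 ?Z {} (path_chain (?l (s 0) (s m))) (\<Sum>j<m. path_chain (?l (s j) (s (Suc j))))"
  proof (rule contractible_space_homologous)
    show "contractible_space ?Z"
      by (simp add: contractible_space_top_of_set convex_imp_contractible)
    show "singular_chain 1 ?Z (path_chain (?l (s 0) (s m)))"
      by (rule l) (use le in auto)
    show "singular_chain 1 ?Z (\<Sum>j<m. path_chain (?l (s j) (s (Suc j))))"
      by (intro singular_chain_sum l) (use le in auto)
    have "chain_boundary 1 (\<Sum>j<m. path_chain (?l (s j) (s (Suc j))))
        = (\<Sum>j<m. point_chain (s (Suc j)) - point_chain (s j))"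
      by (simp add: chain_boundary_sum chain_boundary_path_chain[unfolded One_nat_def])
    also have "\<dots> = point_chain (s m) - point_chain (s 0)"
      by (rule sum_lessThan_telescope)
    finally show "chain_boundary 1 (path_chain (?l (s 0) (s m)))
        = chain_boundary 1 (\<Sum>j<m. path_chain (?l (s j) (s (Suc j))))"
      by (simp add: chain_boundary_path_chain[unfolded One_nat_def])
  qed
  from homologous_rel_chain_map[OF this cont] show ?thesis
    by (simp add: chain_map_path_chain[unfolded One_nat_def] chain_map_sum)
qed

section \<open>Change of the logarithm along paths and chains\<close>

definition log_change :: "(real \<Rightarrow> complex) \<Rightarrow> complex" where
  "log_change p = (SOME d. \<exists>L. continuous_on {0..1} L \<and> (\<forall>x\<in>{0..1}. exp (L x) = p x) \<and> d = L 1 - L 0)"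

text \<open>Two continuous logarithms of the same path differ by a continuous function with values
  in the multiples of \<open>2 * pi * \<i>\<close>. That set is discrete, so the difference is
  constant and the choice in \<open>log_change\<close> is immaterial.\<close>

lemma log_change_eq:
  assumes "continuous_on {0..1} L" "\<And>x. x \<in> {0..1} \<Longrightarrow> exp (L x) = p x"
  shows "log_change p = L 1 - L 0"
  unfolding log_change_def
proof (rule some_equality)
  show "\<exists>L'. continuous_on {0..1} L' \<and> (\<forall>x\<in>{0..1}. exp (L' x) = p x) \<and> L 1 - L 0 = L' 1 - L' 0"
    using assms by blast
next
  fix d assume "\<exists>L'. continuous_on {0..1} L' \<and> (\<forall>x\<in>{0..1}. exp (L' x) = p x) \<and> d = L' 1 - L' 0"
  then obtain L' where L': "continuous_on {0..1} L'" "\<And>x. x \<in> {0..1} \<Longrightarrow> exp (L' x) = p x"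
    and d: "d = L' 1 - L' 0" by blast
  have ex: "\<exists>k::int. L' x - L x = 2 * of_int k * pi * \<i>" if "x \<in> {0..1}" for x
  proof -
    have "exp (L' x) = exp (L x)"
      using that L' assms by simp
    then show ?thesis
      by (auto simp: exp_eq algebra_simps)
  qed
  have "(\<lambda>x. L' x - L x) constant_on {0..1::real}"
  proof (rule continuous_discrete_range_constant)
    show "connected {0..1::real}" by simp
    show "continuous_on {0..1} (\<lambda>x. L' x - L x)"
      using L' assms by (intro continuous_intros)
    show "\<exists>e>0. \<forall>y. y \<in> {0..1} \<and> L' y - L y \<noteq> L' x - L x \<longrightarrow> e \<le> cmod (L' y - L y - (L' x - L x))"
      if x: "x \<in> {0..1}" for x
    proof (intro exI conjI allI impI)
      \<comment> \<open>The distance between neighbouring multiples of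
        \<open>2 * pi * \<i>\<close>.\<close>
      show "0 < 2 * pi" by simp
      fix y assume y: "y \<in> {0..1} \<and> L' y - L y \<noteq> L' x - L x"
      obtain k l :: int where kl: "L' y - L y = 2 * of_int k * pi * \<i>" "L' x - L x = 2 * of_int l * pi * \<i>"
        using ex x y by meson
      then have eq: "L' y - L y - (L' x - L x) = of_int (k - l) * (2 * pi * \<i>)"
        by (simp add: algebra_simps)
      have "k \<noteq> l" using kl y by auto
      then have "1 \<le> \<bar>k - l\<bar>" by simp
      then have "1 \<le> \<bar>real_of_int (k - l)\<bar>"
        by (metis of_int_1_le_iff of_int_abs)
      then have "2 * pi * 1 \<le> 2 * pi * \<bar>real_of_int (k - l)\<bar>"
        by (intro mult_left_mono) auto
      then show "2 * pi \<le> cmod (L' y - L y - (L' x - L x))"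
        unfolding eq norm_mult norm_of_int by (simp add: norm_mult mult.commute)
    qed
  qed
  then have "L' 0 - L 0 = L' 1 - L 1"
    unfolding constant_on_def by fastforce
  then show "d = L 1 - L 0"
    by (simp add: d algebra_simps)
qed

text \<open>
  For a map \<open>\<psi>\<close> into the punctured plane this is the cocycle that integrates \<open>d (log \<psi>)\<close>; on chains
  whose images under \<open>\<psi>\<close> are not continuous and nonzero it is meaningless.
\<close>

definition chain_change :: "('a \<Rightarrow> complex) \<Rightarrow> 'a chain \<Rightarrow> complex" where
  "chain_change \<psi> c = (\<Sum>\<sigma>\<in>Poly_Mapping.keys c. of_int (Poly_Mapping.lookup c \<sigma>) *
     log_change (\<lambda>x. \<psi> (\<sigma> (\<lambda>i. if i = 0 then 1 - x else if i = 1 then x else 0))))"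

text \<open>Lets several chains be summed over one common set of simplices, so that additivity
  becomes a termwise identity even when terms cancel.\<close>

lemma chain_change_superset:
  assumes "finite S" "Poly_Mapping.keys c \<subseteq> S"
  shows "chain_change \<psi> c = (\<Sum>\<sigma>\<in>S. of_int (Poly_Mapping.lookup c \<sigma>) *
     log_change (\<lambda>x. \<psi> (\<sigma> (\<lambda>i. if i = 0 then 1 - x else if i = 1 then x else 0))))"
  unfolding chain_change_def using assms
  by (intro sum.mono_neutral_left) (auto simp: in_keys_iff)

lemma chain_change_diff: "chain_change \<psi> (c - d) = chain_change \<psi> c - chain_change \<psi> d"
proof -
  let ?S = "Poly_Mapping.keys c \<union> Poly_Mapping.keys d"
  have fin: "finite ?S" by simp
  have sub: "Poly_Mapping.keys (c - d) \<subseteq> ?S" by (rule keys_diff)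
  show ?thesis
    using chain_change_superset[OF fin sub] chain_change_superset[OF fin, of c]
      chain_change_superset[OF fin, of d]
    by (simp add: lookup_minus left_diff_distrib sum_subtractf)
qed

lemma chain_change_0 [simp]: "chain_change \<psi> 0 = 0"
  by (simp add: chain_change_def)

lemma chain_change_minus: "chain_change \<psi> (- c) = - chain_change \<psi> c"
  using chain_change_diff[of \<psi> 0 c] by simp

lemma chain_change_add: "chain_change \<psi> (c + d) = chain_change \<psi> c + chain_change \<psi> d"
  using chain_change_diff[of \<psi> c "- d"] by (simp add: chain_change_minus)

lemma chain_change_sum: "chain_change \<psi> (\<Sum>i\<in>I. c i) = (\<Sum>i\<in>I. chain_change \<psi> (c i))"
  by (induction I rule: infinite_finite_induct) (auto simp: chain_change_add)

lemma chain_change_of: "chain_change \<psi> (frag_of \<sigma>)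
    = log_change (\<lambda>x. \<psi> (\<sigma> (\<lambda>i. if i = 0 then 1 - x else if i = 1 then x else 0)))"
  by (simp add: chain_change_def)

lemma chain_change_path_chain:
  assumes "continuous_on {0..1} L" "\<And>x. x \<in> {0..1} \<Longrightarrow> exp (L x) = \<psi> (p x)"
  shows "chain_change \<psi> (path_chain p) = L 1 - L 0"
proof -
  have "(\<lambda>i. if i = 0 then 1 - x else if i = 1 then x else 0) \<in> standard_simplex 1"
    if "x \<in> {0..1}" for x :: real
    using that by (auto simp: standard_simplex_def)
  then show ?thesis
    unfolding path_chain_def chain_change_of
    by (intro log_change_eq assms(1)) (auto simp: assms(2))
qed

text \<open>A triangle is convex, so \<open>\<psi>\<close> composed with the simplex has a
  continuous logarithm \<open>L\<close> on it. The three sides contribute differences of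
  \<open>L\<close> at the corners, and these cancel.\<close>

lemma chain_change_boundary_simplex:
  assumes \<psi>: "continuous_map X euclidean \<psi>" "\<And>x. x \<in> topspace X \<Longrightarrow> \<psi> x \<noteq> 0"
    and \<tau>: "singular_simplex 2 X \<tau>"
  shows "chain_change \<psi> (chain_boundary 2 (frag_of \<tau>)) = 0"
proof -
  \<comment> \<open>\<open>T\<close> is the plane triangle with corners 0, 1 and \<i>, and
    \<open>r\<close> gives the barycentric coordinates with respect to them, in this order.\<close>
  define T where "T = {z::complex. 0 \<le> Re z \<and> 0 \<le> Im z \<and> Re z + Im z \<le> 1}"
  define r where "r z = (\<lambda>i::nat. if i = 0 then 1 - Re z - Im z else if i = 1 then Re z else if i = 2 then Im z else 0)"
    for z
  have r: "r z \<in> standard_simplex 2" if "z \<in> T" for z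
    using that by (auto simp: standard_simplex_def r_def T_def numeral_2_eq_2)
  have "continuous_map (top_of_set T) (powertop_real UNIV) r"
  proof -
    have "continuous_map (top_of_set T) euclideanreal (\<lambda>z. r z k)" for k
    proof -
      consider "k = 0" | "k = 1" | "k = 2" | "2 < k" by linarith
      then show ?thesis
        by cases (auto simp: r_def intro!: continuous_intros)
    qed
    then show ?thesis
      by (simp add: continuous_map_componentwise)
  qed
  then have "continuous_map (top_of_set T) (subtopology (powertop_real UNIV) (standard_simplex 2)) r"
    using r by (auto simp: continuous_map_in_subtopology)
  from continuous_map_compose[OF continuous_map_compose[OF this] \<psi>(1)] \<tau>
  have cont: "continuous_on T (\<lambda>z. \<psi> (\<tau> (r z)))"
    by (auto simp: singular_simplex_def o_def)
  have nz: "\<psi> (\<tau> (r z)) \<noteq> 0" if "z \<in> T" for z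
  proof -
    have "\<tau> ` standard_simplex 2 \<subseteq> topspace X"
      using \<tau> by (auto simp: singular_simplex_def dest!: continuous_map_image_subset_topspace)
    then show ?thesis
      using r[OF that] \<psi>(2) by blast
  qed
  have "convex T"
  proof -
    have "T = {z. 0 \<le> Re z} \<inter> {z. 0 \<le> Im z} \<inter> {z. inner (Complex 1 1) z \<le> 1}"
      by (auto simp: T_def inner_complex_def)
    then show ?thesis
      by (simp add: convex_Int convex_halfspace_Re_ge convex_halfspace_Im_ge convex_halfspace_le)
  qed
  then obtain L where L: "continuous_on T L" "\<And>z. z \<in> T \<Longrightarrow> \<psi> (\<tau> (r z)) = exp (L z)"
    using continuous_logarithm_on_contractible[OF cont convex_imp_contractible] nz by metis
  let ?e = "\<lambda>x::real. (\<lambda>i::nat. if i = 0 then 1 - x else if i = 1 then x else 0)"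
  have e: "?e x \<in> standard_simplex 1" if "x \<in> {0..1}" for x
    using that by (auto simp: standard_simplex_def)
  have face: "log_change (\<lambda>x. \<psi> (singular_face 2 k \<tau> (?e x))) = L (l 1) - L (l 0)"
    if k: "\<And>x. x \<in> {0..1} \<Longrightarrow> l x \<in> T \<and> simplical_face k (?e x) = r (l x)"
      and l: "continuous_on {0..1} l" for k and l :: "real \<Rightarrow> complex"
  proof (rule log_change_eq)
    show "continuous_on {0..1} (\<lambda>x. L (l x))"
      by (rule continuous_on_compose2[OF L(1) l]) (use k in auto)
    show "exp (L (l x)) = \<psi> (singular_face 2 k \<tau> (?e x))" if "x \<in> {0..1}" for x
      using k[OF that] L(2)[of "l x"] e[OF that] by (simp add: singular_face_def)
  qed
  \<comment> \<open>Face \<open>k\<close> is the side opposite to corner \<open>k\<close>.\<close>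
  have 0: "log_change (\<lambda>x. \<psi> (singular_face 2 0 \<tau> (?e x))) = L (Complex 0 1) - L (Complex 1 0)"
    by (subst face[of "\<lambda>x. Complex (1 - x) x"])
      (auto simp: T_def r_def simplical_face_def fun_eq_iff Complex_eq intro!: continuous_intros)
  have 1: "log_change (\<lambda>x. \<psi> (singular_face 2 1 \<tau> (?e x))) = L (Complex 0 1) - L (Complex 0 0)"
    by (subst face[of "\<lambda>x. Complex 0 x"])
      (auto simp: T_def r_def simplical_face_def fun_eq_iff Complex_eq intro!: continuous_intros)
  have 2: "log_change (\<lambda>x. \<psi> (singular_face 2 2 \<tau> (?e x))) = L (Complex 1 0) - L (Complex 0 0)"
    by (subst face[of "\<lambda>x. Complex x 0"])
      (auto simp: T_def r_def simplical_face_def fun_eq_iff Complex_eq intro!: continuous_intros)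
  have "chain_boundary 2 (frag_of \<tau>) = frag_of (singular_face 2 0 \<tau>) - frag_of (singular_face 2 1 \<tau>)
      + frag_of (singular_face 2 2 \<tau>)"
    by (simp add: chain_boundary_of numeral_2_eq_2)
  then show ?thesis
    using 0 1 2 by (simp add: chain_change_add chain_change_diff chain_change_of)
qed

lemma chain_change_relboundary:
  assumes \<psi>: "continuous_map X euclidean \<psi>" "\<And>x. x \<in> topspace X \<Longrightarrow> \<psi> x \<noteq> 0"
    and c: "singular_relboundary 1 X {} c"
  shows "chain_change \<psi> c = 0"
proof -
  obtain d where d: "singular_chain 2 X d" "chain_boundary 2 d = c"
    using c by (auto simp: singular_boundary numeral_2_eq_2)
  have "chain_change \<psi> (chain_boundary 2 d) = 0"
  proof (rule frag_induction[of d "Collect (singular_simplex 2 X)"])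
    show "Poly_Mapping.keys d \<subseteq> Collect (singular_simplex 2 X)"
      using d(1) by (simp add: singular_chain_def)
  qed (auto simp: chain_change_boundary_simplex[OF \<psi>] chain_boundary_diff chain_change_diff)
  with d show ?thesis by simp
qed

lemma chain_change_homologous:
  assumes \<psi>: "continuous_map X euclidean \<psi>" "\<And>x. x \<in> topspace X \<Longrightarrow> \<psi> x \<noteq> 0"
    and c: "homologous_rel 1 X {} c d"
  shows "chain_change \<psi> c = chain_change \<psi> d"
  using chain_change_relboundary[OF \<psi>, of "c - d"] c
  by (simp add: homologous_rel_def chain_change_diff)

section \<open>Polygons as Jordan curves\<close>

text \<open>The distance to this set is the radius within which edge \<open>i\<close> is the only
  part of the boundary.\<close>

definition others :: "nat \<Rightarrow> (nat \<Rightarrow> complex) \<Rightarrow> nat \<Rightarrow> complex set" where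
  "others n v i = (\<Union>j\<in>{..<n} - {i}. edge n v j)"

lemma edge_eq: "edge n v i = closed_segment (v i) (v (Suc i mod n))"
  by (simp add: edge_def edge_path_def)

lemma ngon_ge3: "ngon n v \<Longrightarrow> 3 \<le> n"
  by (simp add: ngon_def)

lemma ngon_vertex_eq: "ngon n v \<Longrightarrow> i < n \<Longrightarrow> j < n \<Longrightarrow> v i = v j \<longleftrightarrow> i = j"
  by (auto simp: ngon_def inj_on_def)

lemma Suc_mod_neq: "2 \<le> n \<Longrightarrow> i < n \<Longrightarrow> Suc i mod n \<noteq> i"
  by (cases "Suc i = n") auto

lemma ngon_edge_nonzero:
  assumes "ngon n v" "i < n"
  shows "v (Suc i mod n) - v i \<noteq> 0"
proof -
  have "Suc i mod n < n" "Suc i mod n \<noteq> i"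
    using assms ngon_ge3[OF assms(1)] Suc_mod_neq[of n i] by auto
  then show ?thesis
    using ngon_vertex_eq[OF assms(1)] assms(2) by auto
qed

lemma ngon_edge_Int:
  assumes "ngon n v" "i < n" "j < n" "i \<noteq> j" "z \<in> edge n v i" "z \<in> edge n v j"
  shows "z \<in> {v i, v (Suc i mod n)}" "z \<in> {v j, v (Suc j mod n)}"
  using assms unfolding ngon_def by blast+

lemma vertex_in_edge: "v i \<in> edge n v i" "v (Suc i mod n) \<in> edge n v i"
  by (auto simp: edge_eq)

lemma edge_ends_in_vertices: "i < n \<Longrightarrow> {v i, v (Suc i mod n)} \<subseteq> vertices n v"
  by (auto simp: vertices_def)

lemma edge_minus_vertices:
  assumes "ngon n v" "i < n"
  shows "edge n v i - vertices n v = open_segment (v i) (v (Suc i mod n))"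
proof -
  have "z \<in> {v i, v (Suc i mod n)}" if z: "z \<in> edge n v i" "z \<in> vertices n v" for z
  proof -
    obtain k where k: "k < n" "z = v k"
      using z(2) by (auto simp: vertices_def)
    then show ?thesis
      using ngon_edge_Int(1)[OF assms(1,2) k(1) _ z(1)] vertex_in_edge(1)[of v k n] by blast
  qed
  then show ?thesis
    using edge_ends_in_vertices[OF assms(2), of v] by (auto simp: open_segment_def edge_eq)
qed

lemma edge_unique:
  assumes "ngon n v" "i < n" "j < n" "z \<in> edge n v i" "z \<in> edge n v j" "z \<notin> vertices n v"
  shows "i = j"
  using ngon_edge_Int(1)[OF assms(1-3)] assms(4-6) edge_ends_in_vertices[OF assms(2), of v] by blast

lemma edge_subset_boundary: "i < n \<Longrightarrow> edge n v i \<subseteq> boundary n v"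
  by (auto simp: boundary_def)

lemma vertices_subset_boundary: "vertices n v \<subseteq> boundary n v"
  using vertex_in_edge by (fastforce simp: vertices_def boundary_def)

lemma compact_edge: "compact (edge n v i)"
  by (simp add: edge_eq)

lemma compact_boundary: "compact (boundary n v)"
  by (auto simp: boundary_def compact_edge intro: compact_UN)

lemma compact_others: "compact (others n v i)"
  by (auto simp: others_def compact_edge intro: compact_UN)

lemma others_nonempty:
  assumes "2 \<le> n"
  shows "others n v i \<noteq> {}"
proof -
  have "(if i = 0 then 1 else 0) \<in> {..<n} - {i}"
    using assms by auto
  moreover have "edge n v j \<noteq> {}" for j
    using vertex_in_edge by blast
  ultimately show ?thesis
    unfolding others_def by blast
qed

lemma edge_subset_others: "j < n \<Longrightarrow> j \<noteq> i \<Longrightarrow> edge n v j \<subseteq> others n v i"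
  by (auto simp: others_def)

text \<open>Both ends of an edge also belong to its neighbours, and nothing else of it lies on
  another edge.\<close>

lemma edge_minus_others:
  assumes "ngon n v" "i < n"
  shows "edge n v i - others n v i = edge n v i - vertices n v"
proof -
  have "vertices n v \<inter> edge n v i \<subseteq> others n v i"
  proof
    fix z assume z: "z \<in> vertices n v \<inter> edge n v i"
    then have "z \<in> {v i, v (Suc i mod n)}"
      using edge_minus_vertices[OF assms] by (auto simp: open_segment_def edge_eq)
    moreover have "v (Suc i mod n) \<in> others n v i"
      using edge_subset_others[of "Suc i mod n" n i v] vertex_in_edge(1)[of v "Suc i mod n" n]
        Suc_mod_neq[of n i] ngon_ge3[OF assms(1)] assms(2) by auto
    moreover have "v i \<in> others n v i"
    proof -
      \<comment> \<open>The edge preceding \<open>i\<close> in cyclic order.\<close>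
      let ?j = "if i = 0 then n - 1 else i - 1"
      have "?j < n" "?j \<noteq> i" "Suc ?j mod n = i"
        using assms(2) ngon_ge3[OF assms(1)] by auto
      then show ?thesis
        using edge_subset_others[of ?j n i v] vertex_in_edge(2)[of v ?j n] by auto
    qed
    ultimately show "z \<in> others n v i" by auto
  qed
  moreover have "edge n v i \<inter> others n v i \<subseteq> vertices n v"
    using ngon_edge_Int(1)[OF assms(1,2)] edge_ends_in_vertices[OF assms(2), of v]
    unfolding others_def by blast
  ultimately show ?thesis by blast
qed

section \<open>The boundary as a simple closed path\<close>

primrec polygon_arc :: "(nat \<Rightarrow> complex) \<Rightarrow> nat \<Rightarrow> real \<Rightarrow> complex" where
  "polygon_arc v 0 = linepath (v 0) (v 1)"
| "polygon_arc v (Suc k) = polygon_arc v k +++ linepath (v (Suc k)) (v (Suc (Suc k)))"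

text \<open>Edges 0 to \<open>n - 2\<close> form an arc and edge \<open>n - 1\<close> closes it: two
  arcs that meet only in their ends make a simple closed path.\<close>

definition polygon_loop :: "nat \<Rightarrow> (nat \<Rightarrow> complex) \<Rightarrow> real \<Rightarrow> complex" where
  "polygon_loop n v = polygon_arc v (n - 2) +++ linepath (v (n - 1)) (v 0)"

lemma pathstart_polygon_arc [simp]: "pathstart (polygon_arc v k) = v 0"
  by (induction k) auto

lemma pathfinish_polygon_arc [simp]: "pathfinish (polygon_arc v k) = v (Suc k)"
  by (induction k) auto

lemma path_polygon_arc: "path (polygon_arc v k)"
  by (induction k) auto

lemma path_image_polygon_arc:
  "Suc k < n \<Longrightarrow> path_image (polygon_arc v k) = (\<Union>i\<le>k. edge n v i)"
proof (induction k)
  case (Suc k)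
  then show ?case
    by (simp add: path_image_join edge_eq atMost_Suc Un_commute)
qed (simp add: edge_eq)

lemma arc_polygon_arc:
  assumes "ngon n v" "Suc k < n"
  shows "arc (polygon_arc v k)"
  using assms(2)
proof (induction k)
  case 0
  then show ?case
    using ngon_edge_nonzero[OF assms(1), of 0] by (simp add: arc_linepath)
next
  case (Suc k)
  have "z = v (Suc k)" if z: "z \<in> path_image (polygon_arc v k)"
    "z \<in> path_image (linepath (v (Suc k)) (v (Suc (Suc k))))" for z
  proof -
    obtain i where i: "i \<le> k" "z \<in> edge n v i"
      using z path_image_polygon_arc[of k n v] Suc.prems by auto
    have "z \<in> edge n v (Suc k)"
      using z Suc.prems by (simp add: edge_eq)
    from ngon_edge_Int[OF assms(1) _ _ _ i(2) this] Suc.prems i(1)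
    have "z \<in> {v i, v (Suc i)}" "z \<in> {v (Suc k), v (Suc (Suc k))}"
      by auto
    then show ?thesis
      using ngon_vertex_eq[OF assms(1)] Suc.prems i(1) by auto
  qed
  moreover have "arc (linepath (v (Suc k)) (v (Suc (Suc k))))"
    using ngon_edge_nonzero[OF assms(1), of "Suc k"] Suc.prems by (simp add: arc_linepath)
  ultimately show ?case
    using Suc by (auto intro!: arc_join)
qed

lemma pathfinish_polygon_loop [simp]: "pathfinish (polygon_loop n v) = v 0"
  and pathstart_polygon_loop [simp]: "pathstart (polygon_loop n v) = v 0"
  by (simp_all add: polygon_loop_def)

lemma path_polygon_loop: "3 \<le> n \<Longrightarrow> path (polygon_loop n v)"
proof -
  assume "3 \<le> n"
  then have "Suc (n - 2) = n - 1" by simp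
  then show ?thesis
    by (simp add: polygon_loop_def path_polygon_arc)
qed

lemma path_image_polygon_loop:
  assumes "3 \<le> n"
  shows "path_image (polygon_loop n v) = boundary n v"
proof -
  obtain k where n: "n = Suc (Suc k)"
    using that[of "n - 2"] assms by simp
  have "{..<n} = insert (Suc k) {..k}"
    by (auto simp: n)
  then show ?thesis
    using path_image_polygon_arc[of k n v]
    by (simp add: polygon_loop_def path_image_join boundary_def edge_eq n Un_commute)
qed

lemma simple_path_polygon_loop:
  assumes "ngon n v"
  shows "simple_path (polygon_loop n v)"
proof -
  obtain k where n: "n = Suc (Suc k)"
    using that[of "n - 2"] ngon_ge3[OF assms] by simp
  have "path_image (polygon_arc v k) \<inter> edge n v (Suc k) \<subseteq> {v 0, v (Suc k)}"
  proof
    fix z assume z: "z \<in> path_image (polygon_arc v k) \<inter> edge n v (Suc k)"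
    then obtain i where i: "i \<le> k" "z \<in> edge n v i"
      using path_image_polygon_arc[of k n v] n by auto
    from ngon_edge_Int(2)[OF assms _ _ _ i(2)] z i(1) n show "z \<in> {v 0, v (Suc k)}"
      by fastforce
  qed
  moreover have "arc (linepath (v (Suc k)) (v 0))"
    using ngon_edge_nonzero[OF assms, of "Suc k"] n by (simp add: arc_linepath)
  ultimately show ?thesis
    using arc_polygon_arc[OF assms, of k]
    by (auto simp: polygon_loop_def n edge_eq intro!: simple_path_join_loop)
qed

lemma
  assumes "ngon n v"
  shows open_inside_ngon: "open (inside (boundary n v))"
    and open_outside_ngon: "open (outside (boundary n v))"
    and frontier_inside_ngon: "frontier (inside (boundary n v)) = boundary n v"
    and frontier_outside_ngon: "frontier (outside (boundary n v)) = boundary n v"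
  using Jordan_inside_outside[OF simple_path_polygon_loop[OF assms]]
    path_image_polygon_loop[OF ngon_ge3[OF assms]] by auto

lemma contractible_inside_ngon:
  assumes "ngon n v"
  shows "contractible (inside (boundary n v))"
  using simply_connected_inside_simple_path[OF simple_path_polygon_loop[OF assms]]
    open_inside_ngon[OF assms] path_image_polygon_loop[OF ngon_ge3[OF assms]]
  by (simp add: contractible_eq_simply_connected_2d)

section \<open>The two sides of an edge\<close>

lemma connected_inside_or_outside:
  assumes "connected S" "S \<inter> B = {}" "closed B"
  shows "S \<subseteq> inside B \<or> S \<subseteq> outside (B :: complex set)"
proof (rule ccontr)
  assume "\<not> ?thesis"
  moreover have "S \<subseteq> inside B \<union> outside B"
    using assms(2) inside_Un_outside by blast
  ultimately have "S \<inter> inside B \<noteq> {}" "S \<inter> outside B \<noteq> {}"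
    by blast+
  then show False
    using connectedD[OF assms(1) open_inside[OF assms(3)] open_outside[OF assms(3)]]
      \<open>S \<subseteq> inside B \<union> outside B\<close> inside_Int_outside[of B] by blast
qed

text \<open>The imaginary part in the coordinate that turns the edge into the unit interval. It
  vanishes on the line of the edge, and its sign tells the side.\<close>

definition edge_side :: "nat \<Rightarrow> (nat \<Rightarrow> complex) \<Rightarrow> nat \<Rightarrow> complex \<Rightarrow> real" where
  "edge_side n v i z = Im ((z - v i) / (v (Suc i mod n) - v i))"

lemma edge_side_edge: "z \<in> edge n v i \<Longrightarrow> edge_side n v i z = 0"
proof -
  assume "z \<in> edge n v i"
  then obtain u where "z = (1 - u) *\<^sub>R v i + u *\<^sub>R v (Suc i mod n)"
    by (auto simp: edge_eq in_segment)
  then have "z - v i = of_real u * (v (Suc i mod n) - v i)"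
    by (simp add: scaleR_conv_of_real algebra_simps)
  then show ?thesis
    by (cases "v (Suc i mod n) - v i = 0") (auto simp: edge_side_def)
qed

definition edge_normal :: "nat \<Rightarrow> (nat \<Rightarrow> complex) \<Rightarrow> nat \<Rightarrow> complex" where
  "edge_normal n v i = \<i> * sgn (v (Suc i mod n) - v i)"

lemma edge_side_normal:
  assumes "v (Suc i mod n) - v i \<noteq> 0"
  shows "edge_side n v i (z + of_real t * edge_normal n v i)
    = edge_side n v i z + t / cmod (v (Suc i mod n) - v i)"
proof -
  let ?d = "v (Suc i mod n) - v i"
  have "sgn ?d / ?d = 1 / of_real (cmod ?d)"
    using assms by (simp add: sgn_div_norm scaleR_conv_of_real field_simps)
  then have "(z + of_real t * edge_normal n v i - v i) / ?d
      = (z - v i) / ?d + of_real t * \<i> * (1 / of_real (cmod ?d))"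
    by (simp add: edge_normal_def add_divide_distrib diff_divide_distrib flip: times_divide_eq_right)
  then show ?thesis
    by (simp add: edge_side_def)
qed

lemma norm_edge_normal: "v (Suc i mod n) - v i \<noteq> 0 \<Longrightarrow> cmod (edge_normal n v i) = 1"
  by (simp add: edge_normal_def norm_mult norm_sgn)

text \<open>The radius keeps the other edges out and the strict inequality keeps edge
  \<open>i\<close> out, so a half disc is a connected set off the boundary.\<close>

definition half_disc :: "nat \<Rightarrow> (nat \<Rightarrow> complex) \<Rightarrow> nat \<Rightarrow> real \<Rightarrow> complex \<Rightarrow> complex set" where
  "half_disc n v i \<sigma> x = {z \<in> ball x (infdist x (others n v i)). 0 < \<sigma> * edge_side n v i z}"

lemma convex_half_disc: "convex (half_disc n v i \<sigma> x)"
proof -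
  have "convex {z. 0 < \<sigma> * edge_side n v i z}"
  proof (rule convexI)
    fix x y :: complex and a b :: real
    assume *: "x \<in> {z. 0 < \<sigma> * edge_side n v i z}" "y \<in> {z. 0 < \<sigma> * edge_side n v i z}"
      "0 \<le> a" "0 \<le> b" "a + b = 1"
    let ?d = "v (Suc i mod n) - v i"
    have b: "b = 1 - a" using * by simp
    have "(a *\<^sub>R x + b *\<^sub>R y - v i) / ?d = of_real a * ((x - v i) / ?d) + of_real b * ((y - v i) / ?d)"
      unfolding b by (simp add: scaleR_conv_of_real diff_divide_distrib add_divide_distrib algebra_simps)
    then have "edge_side n v i (a *\<^sub>R x + b *\<^sub>R y) = a * edge_side n v i x + b * edge_side n v i y"
      unfolding edge_side_def by (simp del: times_divide_eq_right)
    then have "\<sigma> * edge_side n v i (a *\<^sub>R x + b *\<^sub>R y)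
        = a * (\<sigma> * edge_side n v i x) + b * (\<sigma> * edge_side n v i y)"
      by (simp add: distrib_left mult.left_commute)
    moreover have "0 < \<dots>"
    proof (cases "a = 0")
      case False
      with * have "0 < a * (\<sigma> * edge_side n v i x)" "0 \<le> b * (\<sigma> * edge_side n v i y)"
        using mult_pos_pos[of a "\<sigma> * edge_side n v i x"] mult_nonneg_nonneg[of b "\<sigma> * edge_side n v i y"]
        by auto
      then show ?thesis by linarith
    qed (use * in auto)
    ultimately show "a *\<^sub>R x + b *\<^sub>R y \<in> {z. 0 < \<sigma> * edge_side n v i z}"
      by simp
  qed
  moreover have "half_disc n v i \<sigma> x = ball x (infdist x (others n v i)) \<inter> {z. 0 < \<sigma> * edge_side n v i z}"
    by (auto simp: half_disc_def)
  ultimately show ?thesis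
    by (simp add: convex_Int)
qed

lemma half_disc_Int_boundary: "half_disc n v i \<sigma> x \<inter> boundary n v = {}"
proof -
  have False if z: "z \<in> half_disc n v i \<sigma> x" "z \<in> edge n v j" "j < n" for z j
  proof (cases "j = i")
    case True
    then show ?thesis using z edge_side_edge[of z n v i] by (simp add: half_disc_def)
  next
    case False
    then have "infdist x (others n v i) \<le> dist x z"
      using z by (intro infdist_le) (auto simp: others_def)
    then show ?thesis using z by (simp add: half_disc_def)
  qed
  then show ?thesis by (auto simp: boundary_def)
qed

lemma half_disc_in_or_out:
  "half_disc n v i \<sigma> x \<subseteq> inside (boundary n v) \<or> half_disc n v i \<sigma> x \<subseteq> outside (boundary n v)"
  using connected_inside_or_outside[OF convex_connected[OF convex_half_disc] half_disc_Int_boundary]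
    compact_imp_closed[OF compact_boundary] by blast

lemma infdist_others_pos:
  assumes "ngon n v" "i < n" "x \<in> edge n v i - vertices n v"
  shows "0 < infdist x (others n v i)"
proof -
  have "x \<notin> others n v i"
    using edge_minus_others[OF assms(1,2)] assms(3) by blast
  moreover have "others n v i \<noteq> {}"
    using others_nonempty[of n v i] ngon_ge3[OF assms(1)] by simp
  ultimately have "infdist x (others n v i) \<noteq> 0"
    using in_closed_iff_infdist_zero[OF compact_imp_closed[OF compact_others]] by metis
  then show ?thesis
    using infdist_nonneg[of x "others n v i"] by linarith
qed

text \<open>\<open>U\<close> has points in the disc around \<open>x\<close>. If such a point lies on
  the line of the edge, it can be moved off the line along the normal without leaving the open set
  \<open>U\<close>.\<close>

lemma half_disc_witness:
  assumes "ngon n v" "i < n" "x \<in> edge n v i - vertices n v"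
    "open U" "x \<in> frontier U"
  shows "\<exists>\<sigma>\<in>{1, -1}. half_disc n v i \<sigma> x \<inter> U \<noteq> {}"
proof -
  let ?r = "infdist x (others n v i)"
  have "x \<in> closure U"
    using assms(5) by (simp add: frontier_def)
  then obtain z where z: "z \<in> U" "dist z x < ?r"
    using infdist_others_pos[OF assms(1-3)] closure_approachable by blast
  then have "z \<in> U \<inter> ball x ?r"
    by (simp add: dist_commute)
  moreover have "open (U \<inter> ball x ?r)"
    using assms(4) by auto
  ultimately obtain e where e: "e > 0" "cball z e \<subseteq> U \<inter> ball x ?r"
    using open_contains_cball by blast
  let ?w = "z + of_real e * edge_normal n v i"
  have d: "v (Suc i mod n) - v i \<noteq> 0"
    by (rule ngon_edge_nonzero[OF assms(1,2)])
  have w: "?w \<in> U \<inter> ball x ?r" "z \<in> U \<inter> ball x ?r"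
    using e norm_edge_normal[of v i n] d by (auto simp: dist_norm norm_mult subset_iff)
  show ?thesis
  proof (cases "edge_side n v i z = 0")
    case True
    then have "edge_side n v i ?w > 0"
      using d e by (simp add: edge_side_normal)
    then have "?w \<in> half_disc n v i 1 x \<inter> U"
      using w by (auto simp: half_disc_def)
    then show ?thesis by blast
  next
    case False
    then have "z \<in> half_disc n v i (if edge_side n v i z > 0 then 1 else -1) x \<inter> U"
      using w by (auto simp: half_disc_def)
    then show ?thesis by (metis empty_iff insertI1 insertI2)
  qed
qed

text \<open>By the Jordan curve theorem \<open>x\<close> is a frontier point of both the inside and
  the outside. Each of them meets a half disc and then contains it, so they occupy opposite
  ones.\<close>

lemma half_disc_sides:
  assumes "ngon n v" "i < n" "x \<in> edge n v i - vertices n v"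
  shows "\<exists>\<sigma>\<in>{1, -1}. half_disc n v i \<sigma> x \<subseteq> inside (boundary n v) \<and>
    half_disc n v i (-\<sigma>) x \<subseteq> outside (boundary n v)"
proof -
  have x: "x \<in> boundary n v"
    using assms by (auto simp: boundary_def)
  obtain \<sigma> where \<sigma>: "\<sigma> \<in> {1, -1::real}" "half_disc n v i \<sigma> x \<inter> inside (boundary n v) \<noteq> {}"
    using half_disc_witness[OF assms open_inside_ngon[OF assms(1)]] x frontier_inside_ngon[OF assms(1)]
    by blast
  obtain \<tau> where \<tau>: "\<tau> \<in> {1, -1::real}" "half_disc n v i \<tau> x \<inter> outside (boundary n v) \<noteq> {}"
    using half_disc_witness[OF assms open_outside_ngon[OF assms(1)]] x frontier_outside_ngon[OF assms(1)]
    by blast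
  have "half_disc n v i \<sigma> x \<subseteq> inside (boundary n v)"
    using half_disc_in_or_out[of n v i \<sigma> x] \<sigma> inside_Int_outside[of "boundary n v"] by blast
  moreover have o: "half_disc n v i \<tau> x \<subseteq> outside (boundary n v)"
    using half_disc_in_or_out[of n v i \<tau> x] \<tau> inside_Int_outside[of "boundary n v"] by blast
  moreover have "\<tau> = - \<sigma>"
    using \<sigma> \<tau> o inside_Int_outside[of "boundary n v"] by fastforce
  ultimately show ?thesis
    using \<sigma>(1) by blast
qed

text \<open>The segment from \<open>x\<close> to \<open>y\<close>, shifted slightly along the
  normal, is connected and misses the boundary, so it cannot change from inside to outside.\<close>

lemma half_disc_inside_transfer:
  assumes "ngon n v" "i < n" "\<sigma> \<in> {1, -1}"
    "x \<in> edge n v i - vertices n v" "y \<in> edge n v i - vertices n v"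
    "half_disc n v i \<sigma> x \<subseteq> inside (boundary n v)"
  shows "half_disc n v i \<sigma> y \<subseteq> inside (boundary n v)"
proof -
  let ?d = "v (Suc i mod n) - v i"
  have d: "?d \<noteq> 0"
    by (rule ngon_edge_nonzero[OF assms(1,2)])
  have seg: "closed_segment x y \<subseteq> edge n v i - vertices n v"
    using assms(4,5) edge_minus_vertices[OF assms(1,2)]
    by (metis closed_segment_subset convex_open_segment)
  have "continuous_on (closed_segment x y) (\<lambda>z. infdist z (others n v i))"
    by (intro continuous_intros)
  then obtain w where w: "w \<in> closed_segment x y"
    "\<And>z. z \<in> closed_segment x y \<Longrightarrow> infdist w (others n v i) \<le> infdist z (others n v i)"
    using continuous_attains_inf[of "closed_segment x y" "\<lambda>z. infdist z (others n v i)"] by auto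
  \<comment> \<open>Half of the least distance to the other edges along the segment, so that one
    shift serves all its points.\<close>
  define e where "e = infdist w (others n v i) / 2"
  have e: "0 < e"
    using infdist_others_pos[OF assms(1,2)] w(1) seg by (auto simp: e_def)
  define S where "S = (\<lambda>z. z + of_real (\<sigma> * e) * edge_normal n v i) ` closed_segment x y"
  have pt: "z + of_real (\<sigma> * e) * edge_normal n v i \<in> half_disc n v i \<sigma> z"
    if z: "z \<in> closed_segment x y" for z
  proof -
    have "edge_side n v i z = 0"
      using z seg by (auto intro: edge_side_edge)
    then have "\<sigma> * edge_side n v i (z + of_real (\<sigma> * e) * edge_normal n v i) = \<sigma> * \<sigma> * e / cmod ?d"
      by (simp add: edge_side_normal[OF d] del: of_real_mult)
    moreover have "\<dots> > 0"
      using assms(3) d e by auto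
    moreover have "dist z (z + of_real (\<sigma> * e) * edge_normal n v i) = e"
      using assms(3) e norm_edge_normal[of v i n] d by (auto simp: dist_norm norm_mult)
    ultimately show ?thesis
      using w(2)[OF z] e by (simp add: half_disc_def e_def)
  qed
  have "connected S"
    unfolding S_def by (intro connected_continuous_image continuous_intros) auto
  moreover have "S \<inter> boundary n v = {}"
    using pt half_disc_Int_boundary unfolding S_def by fastforce
  ultimately have "S \<subseteq> inside (boundary n v) \<or> S \<subseteq> outside (boundary n v)"
    by (intro connected_inside_or_outside) (auto simp: compact_imp_closed compact_boundary)
  moreover have "S \<inter> inside (boundary n v) \<noteq> {}"
    using pt[of x] assms(6) unfolding S_def by auto
  ultimately have S: "S \<subseteq> inside (boundary n v)"
    using inside_Int_outside[of "boundary n v"] by blast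
  have "y + of_real (\<sigma> * e) * edge_normal n v i \<in> half_disc n v i \<sigma> y \<inter> inside (boundary n v)"
    using pt[of y] S unfolding S_def by auto
  then show ?thesis
    using half_disc_in_or_out[of n v i \<sigma> y] inside_Int_outside[of "boundary n v"] by blast
qed

lemma edge_inner_side:
  assumes "ngon n v" "i < n"
  obtains \<sigma> where "\<sigma> \<in> {1, -1}"
    "\<And>x. x \<in> edge n v i - vertices n v \<Longrightarrow> half_disc n v i \<sigma> x \<subseteq> inside (boundary n v)"
    "\<And>x. x \<in> edge n v i - vertices n v \<Longrightarrow> half_disc n v i (-\<sigma>) x \<subseteq> outside (boundary n v)"
proof -
  let ?E = "edge n v i - vertices n v"
  have "?E \<noteq> {}"
    using edge_minus_vertices[OF assms] ngon_edge_nonzero[OF assms] by auto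
  then obtain x where x: "x \<in> ?E" by blast
  obtain \<sigma> where \<sigma>: "\<sigma> \<in> {1, -1::real}" "half_disc n v i \<sigma> x \<subseteq> inside (boundary n v)"
    using half_disc_sides[OF assms x] by blast
  show ?thesis
  proof
    show \<sigma>': "\<sigma> \<in> {1, -1}" by fact
    show "half_disc n v i \<sigma> y \<subseteq> inside (boundary n v)" if "y \<in> ?E" for y
      by (rule half_disc_inside_transfer[OF assms \<sigma>(1) x that \<sigma>(2)])
    show "half_disc n v i (-\<sigma>) y \<subseteq> outside (boundary n v)" if y: "y \<in> ?E" for y
    proof (rule ccontr)
      assume no: "\<not> ?thesis"
      obtain \<tau> where \<tau>: "\<tau> \<in> {1, -1::real}" "half_disc n v i \<tau> y \<subseteq> inside (boundary n v)"
          "half_disc n v i (-\<tau>) y \<subseteq> outside (boundary n v)"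
        using half_disc_sides[OF assms y] by blast
      then have "\<tau> = -\<sigma>"
        using no \<sigma>(1) by auto
      then have "half_disc n v i (-\<tau>) y \<subseteq> inside (boundary n v)"
        using half_disc_inside_transfer[OF assms \<sigma>(1) x y \<sigma>(2)] by simp
      \<comment> \<open>Because \<open>-\<tau> = \<sigma>\<close>, this half disc is inside and
        outside at once; yet it contains a point shifted along the normal.\<close>
      then have "half_disc n v i (-\<tau>) y = {}"
        using \<tau>(3) inside_Int_outside[of "boundary n v"] by blast
      moreover have "half_disc n v i (-\<tau>) y \<noteq> {}"
      proof -
        let ?e = "infdist y (others n v i) / 2"
        have e: "0 < ?e"
          using infdist_others_pos[OF assms y] by simp
        have d: "v (Suc i mod n) - v i \<noteq> 0"
          by (rule ngon_edge_nonzero[OF assms])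
        have "y + of_real (-\<tau> * ?e) * edge_normal n v i \<in> half_disc n v i (-\<tau>) y"
          unfolding half_disc_def mem_Collect_eq
        proof
          show "y + of_real (-\<tau> * ?e) * edge_normal n v i \<in> ball y (infdist y (others n v i))"
            using \<tau>(1) e norm_edge_normal[of v i n] d by (auto simp: dist_norm norm_mult)
          have "edge_side n v i y = 0"
            using y by (auto intro: edge_side_edge)
          then show "0 < - \<tau> * edge_side n v i (y + of_real (-\<tau> * ?e) * edge_normal n v i)"
            unfolding edge_side_normal[OF d] using \<tau>(1) d e by auto
        qed
        then show ?thesis by blast
      qed
      ultimately show False by blast
    qed
  qed
qed

section \<open>The double of a polygon\<close>

abbreviation punctured_region :: "nat \<Rightarrow> (nat \<Rightarrow> complex) \<Rightarrow> complex set" where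
  "punctured_region n v \<equiv> region n v - vertices n v"

text \<open>
  Pushing \<open>z\<close> by this amount along the inner normal of edge \<open>i\<close> deforms the punctured region into
  its interior: the push is positive on the open edge, at most one edge pushes a given point,
  and near an edge the region is one side of it.
\<close>

definition push_size :: "nat \<Rightarrow> (nat \<Rightarrow> complex) \<Rightarrow> nat \<Rightarrow> complex \<Rightarrow> real" where
  "push_size n v i z = max 0 (infdist z (others n v i) / 4 - infdist z (edge n v i))"

lemma push_size_nonneg: "0 \<le> push_size n v i z"
  by (simp add: push_size_def)

lemma push_size_posD: "0 < push_size n v i z \<Longrightarrow> infdist z (edge n v i) < infdist z (others n v i) / 4"
  by (simp add: push_size_def max_def split: if_splits)

lemma infdist_others_le: "j < n \<Longrightarrow> j \<noteq> i \<Longrightarrow> infdist z (others n v i) \<le> infdist z (edge n v j)"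
  by (rule infdist_mono[OF edge_subset_others]) (use vertex_in_edge in blast)+

text \<open>Two positive pushes would make each of two edges more than four times closer to
  \<open>z\<close> than the other. The factor 1/4, smaller than needed here, leaves the room used in
  \<open>push_inside\<close>.\<close>

lemma push_size_unique:
  assumes "i < n" "j < n" "i \<noteq> j" "0 < push_size n v i z"
  shows "push_size n v j z = 0"
proof (rule ccontr)
  assume "push_size n v j z \<noteq> 0"
  then have "0 < push_size n v j z"
    using push_size_nonneg[of n v j z] by linarith
  then show False
    using push_size_posD[OF assms(4)] push_size_posD[of n v j z] assms
      infdist_others_le[of i n j z v] infdist_others_le[of j n i z v]
      infdist_nonneg[of z "edge n v i"] by linarith
qed

text \<open>Let \<open>x\<close> be the point of the edge nearest to \<open>z\<close>. The push
  keeps \<open>z\<close> within half of \<open>?r\<close> of \<open>x\<close>, while the half discs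
  at \<open>x\<close> have radius above three quarters of \<open>?r\<close>. As \<open>z\<close> is
  not outside, it is not in the outer half disc, so the push makes its side coordinate strictly
  positive.\<close>

lemma push_inside:
  assumes "ngon n v" "i < n" "\<sigma> \<in> {1, -1}"
    and inner: "\<And>x. x \<in> edge n v i - vertices n v \<Longrightarrow> half_disc n v i \<sigma> x \<subseteq> inside (boundary n v)"
    and outer: "\<And>x. x \<in> edge n v i - vertices n v \<Longrightarrow> half_disc n v i (-\<sigma>) x \<subseteq> outside (boundary n v)"
    and z: "z \<notin> outside (boundary n v)" "0 < push_size n v i z" and t: "0 < t" "t \<le> 1"
  shows "z + of_real (t * push_size n v i z * \<sigma>) * edge_normal n v i \<in> inside (boundary n v)"
proof -
  let ?d = "v (Suc i mod n) - v i"
  let ?\<phi> = "push_size n v i z"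
  let ?w = "z + of_real (t * ?\<phi> * \<sigma>) * edge_normal n v i"
  let ?r = "infdist z (others n v i)"
  have d: "?d \<noteq> 0"
    by (rule ngon_edge_nonzero[OF assms(1,2)])
  have r: "infdist z (edge n v i) < ?r / 4" "?\<phi> \<le> ?r / 4"
    using push_size_posD[OF z(2)] infdist_nonneg[of z "edge n v i"]
      infdist_nonneg[of z "others n v i"] by (auto simp: push_size_def)
  obtain x where x: "x \<in> edge n v i" "infdist z (edge n v i) = dist z x"
    using infdist_attains_inf[of "edge n v i" z] compact_imp_closed[OF compact_edge] vertex_in_edge
    by blast
  have tri: "?r \<le> infdist x (others n v i) + dist z x"
    by (rule infdist_triangle)
  \<comment> \<open>Otherwise \<open>?r\<close> would be at most the distance from \<open>z\<close>
    to \<open>x\<close>, which is below \<open>?r / 4\<close>.\<close>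
  have "x \<notin> others n v i"
    using infdist_le[of x "others n v i" z] r x(2) zero_le_dist[of z x] by auto
  then have x': "x \<in> edge n v i - vertices n v"
    using edge_minus_others[OF assms(1,2)] x(1) by blast
  have "dist z ?w = t * ?\<phi>"
    using assms(3) t z(2) norm_edge_normal[of v i n] d by (auto simp: dist_norm norm_mult)
  moreover have "t * ?\<phi> \<le> ?\<phi>"
    using t z(2) by simp
  ultimately have w: "?w \<in> ball x (infdist x (others n v i))"
    using dist_triangle[of x ?w z] tri r x(2) zero_le_dist[of x z] dist_commute[of x z]
    unfolding mem_ball by linarith
  have xz: "dist x z < infdist x (others n v i)"
    using tri r x(2) zero_le_dist[of x z] dist_commute[of x z] by linarith
  have "0 \<le> \<sigma> * edge_side n v i z"
  proof (rule ccontr)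
    assume "\<not> ?thesis"
    then have "z \<in> half_disc n v i (-\<sigma>) x"
      using xz by (simp add: half_disc_def)
    then show False
      using outer[OF x'] z(1) by blast
  qed
  moreover have "\<sigma> * edge_side n v i ?w = \<sigma> * edge_side n v i z + \<sigma> * \<sigma> * (t * ?\<phi> / cmod ?d)"
    unfolding edge_side_normal[OF d] by (simp add: algebra_simps)
  moreover have "0 < \<sigma> * \<sigma> * (t * ?\<phi> / cmod ?d)"
    using assms(3) t z(2) d by auto
  ultimately have "?w \<in> half_disc n v i \<sigma> x"
    using w by (simp add: half_disc_def)
  then show ?thesis
    using inner[OF x'] by blast
qed

text \<open>The interior is contractible by the Jordan curve theorem, and the punctured region can
  be pushed into it without leaving the region.\<close>

lemma contractible_punctured_region:
  assumes "ngon n v"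
  shows "contractible (punctured_region n v)"
proof -
  let ?A = "punctured_region n v"
  let ?I = "inside (boundary n v)"
  have "\<forall>i\<in>{..<n}. \<exists>\<sigma>. \<sigma> \<in> {1, -1::real} \<and>
    (\<forall>x\<in>edge n v i - vertices n v. half_disc n v i \<sigma> x \<subseteq> ?I) \<and>
    (\<forall>x\<in>edge n v i - vertices n v. half_disc n v i (-\<sigma>) x \<subseteq> outside (boundary n v))"
  proof
    fix i assume "i \<in> {..<n}"
    then have "i < n" by simp
    from edge_inner_side[OF assms this] show "\<exists>\<sigma>. \<sigma> \<in> {1, -1::real} \<and>
        (\<forall>x\<in>edge n v i - vertices n v. half_disc n v i \<sigma> x \<subseteq> ?I) \<and>
        (\<forall>x\<in>edge n v i - vertices n v. half_disc n v i (-\<sigma>) x \<subseteq> outside (boundary n v))"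
      by metis
  qed
  from bchoice[OF this] obtain \<sigma> where
    *: "\<forall>i\<in>{..<n}. \<sigma> i \<in> {1, -1::real} \<and>
        (\<forall>x\<in>edge n v i - vertices n v. half_disc n v i (\<sigma> i) x \<subseteq> ?I) \<and>
        (\<forall>x\<in>edge n v i - vertices n v. half_disc n v i (- \<sigma> i) x \<subseteq> outside (boundary n v))" ..
  have \<sigma>: "\<sigma> i \<in> {1, -1::real}"
    "x \<in> edge n v i - vertices n v \<Longrightarrow> half_disc n v i (\<sigma> i) x \<subseteq> ?I"
    "x \<in> edge n v i - vertices n v \<Longrightarrow> half_disc n v i (- \<sigma> i) x \<subseteq> outside (boundary n v)"
    if "i < n" for i x
    using bspec[OF *, of i] that by auto
  \<comment> \<open>At most one term of the sum is nonzero; summing over all edges makes continuity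
    evident.\<close>
  define H where "H = (\<lambda>(t, z). z + (\<Sum>i<n. of_real (t * push_size n v i z * \<sigma> i) * edge_normal n v i))"
  have I_sub: "?I \<subseteq> ?A"
    using vertices_subset_boundary[of n v] inside_no_overlap[of "boundary n v"]
    unfolding region_def by blast
  have single: "H (t, z) = z + of_real (t * push_size n v i z * \<sigma> i) * edge_normal n v i"
    if "i < n" "0 < push_size n v i z" for i t z
  proof -
    have "(\<Sum>j<n. of_real (t * push_size n v j z * \<sigma> j) * edge_normal n v j)
        = (\<Sum>j\<in>{i}. of_real (t * push_size n v j z * \<sigma> j) * edge_normal n v j)"
      using that push_size_unique[OF that(1) _ _ that(2)]
      by (intro sum.mono_neutral_right) auto
    then show ?thesis
      by (simp add: H_def)
  qed
  have H_in: "H (t, z) \<in> ?I" if z: "z \<in> ?A" and t: "0 < t" "t \<le> 1" for t z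
  proof (cases "\<exists>i<n. 0 < push_size n v i z")
    case True
    then obtain i where i: "i < n" "0 < push_size n v i z" by blast
    have "z \<notin> outside (boundary n v)"
      using z inside_Int_outside[of "boundary n v"] outside_no_overlap[of "boundary n v"]
      unfolding region_def by blast
    with push_inside[OF assms i(1) \<sigma>(1)[OF i(1)] \<sigma>(2,3)[OF i(1)] _ i(2) t] show ?thesis
      by (simp add: single[OF i])
  next
    case False
    then have 0: "push_size n v i z = 0" if "i < n" for i
      using that push_size_nonneg[of n v i z] by force
    \<comment> \<open>On an open edge the distance to that edge is 0 and the distance to the others
      is positive, so its push would be positive.\<close>
    have "z \<notin> boundary n v"
    proof
      assume "z \<in> boundary n v"
      then obtain i where i: "i < n" "z \<in> edge n v i"
        by (auto simp: boundary_def)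
      then have "0 < infdist z (others n v i)"
        using infdist_others_pos[OF assms i(1)] z by blast
      then show False
        using 0[OF i(1)] i(2) by (simp add: push_size_def)
    qed
    then show ?thesis
      using z 0 by (simp add: H_def region_def)
  qed
  have cont: "continuous_on X H" for X
    unfolding H_def case_prod_unfold push_size_def by (intro continuous_intros) auto
  have "homotopic_with_canon (\<lambda>x. True) ?A ?A id (\<lambda>z. H (1, z))"
  proof -
    have "H (t, z) \<in> ?A" if tz: "t \<in> {0..1}" "z \<in> ?A" for t z
      using H_in[OF tz(2), of t] tz I_sub by (cases "t = 0") (auto simp: H_def)
    then have "H ` ({0..1} \<times> ?A) \<subseteq> ?A"
      by auto
    then have "homotopic_with_canon (\<lambda>x. True) ?A ?A (\<lambda>z. H (0, z)) (\<lambda>z. H (1, z))"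
      unfolding homotopic_with_def using cont[of "{0..1} \<times> ?A"]
      by (intro exI[of _ H]) (auto simp: continuous_map_in_subtopology prod_topology_subtopology_eu)
    then show ?thesis
      by (rule homotopic_with_eq) (auto simp: H_def)
  qed
  \<comment> \<open>The final map of the deformation factors through the contractible
    interior.\<close>
  moreover obtain c where "homotopic_with_canon (\<lambda>x. True) ?A ?A (id \<circ> (\<lambda>z. H (1, z))) (\<lambda>z. c)"
  proof (rule nullhomotopic_through_contractible[of ?A "\<lambda>z. H (1, z)" ?I id ?A])
    show "continuous_on ?A (\<lambda>z. H (1, z))"
      by (rule continuous_on_compose2[OF cont[of UNIV]]) (auto intro!: continuous_intros)
    show "(\<lambda>z. H (1, z)) \<in> ?A \<rightarrow> ?I"
      using H_in by auto
    show "contractible ?I"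
      by (rule contractible_inside_ngon[OF assms])
  qed (use I_sub in auto)
  ultimately show ?thesis
    unfolding contractible_def by (auto intro: homotopic_with_trans)
qed

section \<open>The double as a quotient space\<close>

lemma double_point_eq_iff:
  "double_point n v (z, b) = double_point n v (z', b') \<longleftrightarrow> z = z' \<and> (b = b' \<or> z \<in> boundary n v)"
proof
  assume eq: "double_point n v (z, b) = double_point n v (z', b')"
  have "(z, b) \<in> double_point n v (z, b)" "(z', b') \<in> double_point n v (z', b')"
    by (auto simp: double_point_def)
  with eq show "z = z' \<and> (b = b' \<or> z \<in> boundary n v)"
    by (auto simp: double_point_def)
qed (auto simp: double_point_def)

lemma topspace_two_copies: "topspace (two_copies n v) = punctured_region n v \<times> UNIV"
  by (simp add: two_copies_def)

lemma topspace_double: "topspace (double n v) = double_point n v ` topspace (two_copies n v)"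
proof (rule subset_antisym)
  show "topspace (double n v) \<subseteq> double_point n v ` topspace (two_copies n v)"
    using openin_topspace[of "double n v"] unfolding openin_double by (rule conjunct1)
  have "{p \<in> topspace (two_copies n v). double_point n v p \<in> double_point n v ` topspace (two_copies n v)}
     = topspace (two_copies n v)" by blast
  then have "openin (double n v) (double_point n v ` topspace (two_copies n v))"
    by (simp only: openin_double openin_topspace order_refl simp_thms)
  then show "double_point n v ` topspace (two_copies n v) \<subseteq> topspace (double n v)"
    by (rule openin_subset)
qed

lemma quotient_map_double: "quotient_map (two_copies n v) (double n v) (double_point n v)"
  unfolding quotient_map_def topspace_double by (simp add: openin_double)

lemma continuous_map_sheet:
  "continuous_map (top_of_set (punctured_region n v)) (double n v) (\<lambda>z. double_point n v (z, b))"
proof -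
  have "continuous_map (top_of_set (punctured_region n v)) (two_copies n v) (\<lambda>z. (z, b))"
    unfolding two_copies_def by (intro continuous_map_pairedI) auto
  from continuous_map_compose[OF this quotient_imp_continuous_map[OF quotient_map_double]]
  show ?thesis by (simp add: o_def)
qed

text \<open>
  Taking \<open>u\<close> on the front and \<open>- u\<close> on the back is well defined modulo 1 where \<open>2 * u\<close> is an integer.
\<close>

lemma double_function:
  assumes u: "continuous_on (punctured_region n v) u"
    and half: "\<And>z. z \<in> boundary n v - vertices n v \<Longrightarrow> u z \<in> {0, 1 / 2 :: real}"
  obtains \<psi> where "continuous_map (double n v) euclidean \<psi>"
    "\<And>x. x \<in> topspace (double n v) \<Longrightarrow> \<psi> x \<noteq> 0"
    "\<And>z b. z \<in> punctured_region n v \<Longrightarrow>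
       \<psi> (double_point n v (z, b)) = exp (2 * pi * \<i> * of_real ((if b then 1 else -1) * u z))"
proof -
  define \<phi> where "\<phi> = (\<lambda>p. exp (2 * pi * \<i> * complex_of_real ((if snd p then 1 else -1) * u (fst p))))"
  have u': "continuous_map (two_copies n v) euclideanreal (u \<circ> fst)"
    unfolding two_copies_def
    by (rule continuous_map_compose[OF continuous_map_fst]) (use u in auto)
  have b': "continuous_map (two_copies n v) euclideanreal ((\<lambda>b. if b then 1 else -1) \<circ> snd)"
    unfolding two_copies_def
    by (rule continuous_map_compose[OF continuous_map_snd]) auto
  have e: "continuous_map euclideanreal euclidean (\<lambda>x. exp (2 * pi * \<i> * complex_of_real x))"
    by (auto intro!: continuous_intros)
  have cont: "continuous_map (two_copies n v) euclidean \<phi>"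
    using continuous_map_compose[OF continuous_map_real_mult[OF b' u'] e]
    by (simp add: \<phi>_def o_def)
  have compat: "\<phi> p = \<phi> q"
    if pq: "p \<in> topspace (two_copies n v)" "q \<in> topspace (two_copies n v)"
      "double_point n v p = double_point n v q" for p q
  proof -
    obtain z b z' b' where eq: "p = (z, b)" "q = (z', b')" by (meson surj_pair)
    have zz: "z' = z" "b = b' \<or> z \<in> boundary n v"
      using pq(3) by (auto simp: eq double_point_eq_iff)
    show ?thesis
    proof (cases "b = b'")
      case False
      then have "u z \<in> {0, 1/2}"
        using zz pq(1) by (intro half) (auto simp: eq topspace_two_copies)
      then consider "u z = 0" | "u z = 1 / 2" by blast
      then show ?thesis
      proof cases
        \<comment> \<open>The two sheets give \<open>exp (pi * \<i>)\<close> and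
          \<open>exp (- pi * \<i>)\<close>, which are both -1.\<close>
        case 2
        show ?thesis
          unfolding \<phi>_def eq zz 2 fst_conv snd_conv by (cases b; cases b'; simp add: exp_minus)
      qed (simp add: \<phi>_def eq zz)
    qed (simp add: eq zz)
  qed
  obtain \<psi> where \<psi>: "continuous_map (double n v) euclidean \<psi>"
    "\<psi> ` topspace (double n v) = \<phi> ` topspace (two_copies n v)"
    "\<And>p. p \<in> topspace (two_copies n v) \<Longrightarrow> \<psi> (double_point n v p) = \<phi> p"
    by (rule quotient_map_lift_exists[OF quotient_map_double cont]) (rule compat | assumption | rule that)+
  show ?thesis
  proof
    show "\<psi> x \<noteq> 0" if "x \<in> topspace (double n v)" for x
      using that \<psi>(3) by (auto simp: topspace_double \<phi>_def)
    show "\<psi> (double_point n v (z, b)) = exp (2 * pi * \<i> * of_real ((if b then 1 else -1) * u z))"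
      if "z \<in> punctured_region n v" for z b
      using that by (subst \<psi>(3)) (simp_all add: topspace_two_copies \<phi>_def)
  qed (rule \<psi>(1))
qed

text \<open>A quotient of distances, halved because \<open>double_function\<close> admits only 0 and
  1/2 on the edges. Its denominator vanishes only where edge \<open>i\<close> meets another edge,
  hence only at vertices.\<close>

lemma edge_indicator:
  assumes "ngon n v" "i < n"
  obtains u where "continuous_on (punctured_region n v) u"
    "\<And>j z. j < n \<Longrightarrow> z \<in> edge n v j - vertices n v \<Longrightarrow> u z = (if j = i then 1 / 2 else 0 :: real)"
proof
  let ?O = "others n v i" and ?E = "edge n v i"
  let ?u = "\<lambda>z. infdist z ?O / (2 * (infdist z ?O + infdist z ?E))"
  have ne: "?O \<noteq> {}" "?E \<noteq> {}"
    using others_nonempty[of n v i] ngon_ge3[OF assms(1)] vertex_in_edge by (auto, blast)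
  have pos: "0 < infdist z ?O + infdist z ?E" if "z \<notin> vertices n v" for z
  proof (rule ccontr)
    assume "\<not> ?thesis"
    then have "infdist z ?O = 0" "infdist z ?E = 0"
      using infdist_nonneg[of z ?O] infdist_nonneg[of z ?E] by linarith+
    then have "z \<in> ?O" "z \<in> ?E"
      using in_closed_iff_infdist_zero[OF compact_imp_closed[OF compact_others] ne(1)]
        in_closed_iff_infdist_zero[OF compact_imp_closed[OF compact_edge] ne(2)] by auto
    then show False
      using edge_minus_others[OF assms] that by blast
  qed
  show "continuous_on (punctured_region n v) ?u"
    using pos by (force intro!: continuous_intros)
  show "?u z = (if j = i then 1 / 2 else 0)" if j: "j < n" and z: "z \<in> edge n v j - vertices n v" for j z
  proof (cases "j = i")
    case True
    then have "infdist z ?E = 0"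
      using z by simp
    then show ?thesis
      using True pos[of z] z by simp
  next
    case False
    then have "z \<in> ?O"
      using z j by (auto simp: others_def)
    then show ?thesis
      using False by simp
  qed
qed

section \<open>Homology classes of curves in the double\<close>

text \<open>The sum starts at 1 because strike 0 and strike \<open>m\<close> are the same strike,
  one period apart.\<close>

definition crossing_number :: "(nat \<Rightarrow> nat) \<Rightarrow> nat \<Rightarrow> nat \<Rightarrow> int" where
  "crossing_number e m i = (\<Sum>j = 1..m. if e j = i then (-1) ^ j else 0)"

lemma frag_cmul_diff_right: "frag_cmul c (a - b) = frag_cmul c a - frag_cmul c b"
  using frag_cmul_distrib2[of c "a - b" b] by (simp add: algebra_simps)

lemma frag_cmul_sum_left: "frag_cmul (\<Sum>j\<in>J. c j) x = (\<Sum>j\<in>J. frag_cmul (c j) x)"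
  by (induction J rule: infinite_finite_induct) (auto simp: frag_cmul_distrib)

lemma sum_by_crossing_number:
  assumes "\<And>j. j \<in> {1..m} \<Longrightarrow> e j < n" "\<And>i. i < n \<Longrightarrow> crossing_number e m i = 0"
  shows "(\<Sum>j = 1..m. frag_cmul ((-1) ^ j) (T (e j))) = 0"
proof -
  have "(\<Sum>j = 1..m. frag_cmul ((-1) ^ j) (T (e j)))
      = (\<Sum>j = 1..m. \<Sum>i<n. frag_cmul (if e j = i then (-1) ^ j else 0) (T i))"
  proof (rule sum.cong)
    fix j assume "j \<in> {1..m}"
    then have "e j < n" by (rule assms(1))
    then show "frag_cmul ((-1) ^ j) (T (e j))
        = (\<Sum>i<n. frag_cmul (if e j = i then (-1) ^ j else 0) (T i))"
      by (subst sum.mono_neutral_right[of "{..<n}" "{e j}"]) auto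
  qed simp
  also have "\<dots> = (\<Sum>i<n. \<Sum>j = 1..m. frag_cmul (if e j = i then (-1) ^ j else 0) (T i))"
    by (rule sum.swap)
  also have "\<dots> = (\<Sum>i<n. frag_cmul (crossing_number e m i) (T i))"
    by (simp add: crossing_number_def frag_cmul_sum_left)
  also have "\<dots> = 0"
    by (simp add: assms(2))
  finally show ?thesis .
qed

lemma frag_cmul_minus_one_power_even: "even j \<Longrightarrow> frag_cmul ((-1) ^ j) x = x"
  and frag_cmul_minus_one_power_odd: "odd j \<Longrightarrow> frag_cmul ((-1) ^ j) x = - x"
  by simp_all

text \<open>\<open>q j\<close> is the curve read in \<open>Q\<close> through copy \<open>j\<close>,
  and \<open>p j\<close> is its point on edge \<open>e j\<close> at crossing \<open>j\<close>. Both
  copies adjacent to a crossing read off the same point, since a mirror fixes its edge. With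
  \<open>m\<close> even, the curve returns to the sheet on which it started.\<close>

locale double_curve =
  fixes n m :: nat and Q p :: "nat \<Rightarrow> complex" and s :: "nat \<Rightarrow> real"
    and q :: "nat \<Rightarrow> real \<Rightarrow> complex" and e :: "nat \<Rightarrow> nat" and h :: "real \<Rightarrow> (complex \<times> bool) set"
  assumes ngon: "ngon n Q" and m: "even m"
    and mono: "\<And>j. j < m \<Longrightarrow> s j \<le> s (Suc j)" and period: "s m = s 0 + 1"
    and cont: "\<And>j. j < m \<Longrightarrow> continuous_on {s j..s (Suc j)} (q j)"
    and in_region: "\<And>j t. j < m \<Longrightarrow> t \<in> {s j..s (Suc j)} \<Longrightarrow> q j t \<in> punctured_region n Q"
    and start: "\<And>j. j < m \<Longrightarrow> q j (s j) = p j"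
    and finish: "\<And>j. j < m \<Longrightarrow> q j (s (Suc j)) = p (Suc j)"
    and closed: "p m = p 0"
    and labels: "\<And>j. j \<le> m \<Longrightarrow> e j < n" "\<And>j. j \<le> m \<Longrightarrow> p j \<in> edge n Q (e j)"
    and h: "\<And>j t. j < m \<Longrightarrow> t \<in> {s j..s (Suc j)} \<Longrightarrow> h (t - s 0) = double_point n Q (q j t, even j)"
begin

abbreviation segment_chain :: "nat \<Rightarrow> complex chain" where
  "segment_chain j \<equiv> path_chain (\<lambda>x. q j (s j + (s (Suc j) - s j) * x))"

lemma m_pos: "0 < m"
  using period by (cases m) auto

lemma s_le: "i \<le> j \<Longrightarrow> j \<le> m \<Longrightarrow> s i \<le> s j"
proof (induction rule: dec_induct)
  case (step k)
  then show ?case using mono[of k] by simp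
qed simp

lemma p_in_region: "j \<le> m \<Longrightarrow> p j \<in> punctured_region n Q"
proof -
  have *: "p j \<in> punctured_region n Q" if "j < m" for j
    using in_region[of j "s j"] start mono that by simp
  show "j \<le> m \<Longrightarrow> p j \<in> punctured_region n Q"
    using *[of j] *[of 0] closed m_pos by (cases "j = m") auto
qed

lemma covering_segment:
  assumes "t \<in> {s 0..s k}" "k \<le> m" "0 < k"
  shows "\<exists>j<k. t \<in> {s j..s (Suc j)}"
  using assms
proof (induction k)
  case (Suc k)
  show ?case
  proof (cases "t \<le> s k \<and> 0 < k")
    case True
    then show ?thesis using Suc less_Suc_eq by auto
  next
    case False
    then have "t \<in> {s k..s (Suc k)}"
      using Suc.prems by (cases "k = 0") auto
    then show ?thesis by blast
  qed
qed simp

lemma segment_continuous_map: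
  "j < m \<Longrightarrow> continuous_map (top_of_set {s j..s (Suc j)}) (top_of_set (punctured_region n Q)) (q j)"
  using cont in_region by (auto simp: continuous_map_in_subtopology image_subset_iff)

text \<open>The pieces are restrictions of one function, so they agree at the crossing times; on
  each piece \<open>h\<close> is an arc in the polygon followed by the inclusion of a sheet.\<close>

lemma h_continuous_map: "continuous_map (top_of_set {s 0..s m}) (double n Q) (\<lambda>t. h (t - s 0))"
proof (rule pasting_lemma_closed[of "{..<m}" _ "\<lambda>j. {s j..s (Suc j)}" _ "\<lambda>j t. h (t - s 0)"])
  show "closedin (top_of_set {s 0..s m}) {s j..s (Suc j)}" if "j \<in> {..<m}" for j
    using s_le[of 0 j] s_le[of "Suc j" m] that by (intro closed_subset) auto
  show "continuous_map (subtopology (top_of_set {s 0..s m}) {s j..s (Suc j)}) (double n Q)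
      (\<lambda>t. h (t - s 0))" if "j \<in> {..<m}" for j
  proof -
    have "{s 0..s m} \<inter> {s j..s (Suc j)} = {s j..s (Suc j)}"
      using s_le[of 0 j] s_le[of "Suc j" m] that by auto
    moreover have "continuous_map (top_of_set {s j..s (Suc j)}) (double n Q)
        ((\<lambda>z. double_point n Q (z, even j)) \<circ> q j)"
      using that by (intro continuous_map_compose[OF segment_continuous_map continuous_map_sheet]) auto
    ultimately show ?thesis
      using h[of j] that by (auto simp: subtopology_subtopology elim!: continuous_map_eq)
  qed
  show "\<exists>j. j \<in> {..<m} \<and> t \<in> {s j..s (Suc j)} \<and> h (t - s 0) = h (t - s 0)"
    if "t \<in> topspace (top_of_set {s 0..s m})" for t
    using covering_segment[of t m] that m_pos by auto
qed auto

lemma path_chain_homologous_segments: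
  "homologous_rel 1 (double n Q) {} (path_chain h)
     (\<Sum>j<m. chain_map 1 (\<lambda>z. double_point n Q (z, even j)) (segment_chain j))"
proof -
  have "path_chain (\<lambda>x. h (s j + (s (Suc j) - s j) * x - s 0))
      = chain_map 1 (\<lambda>z. double_point n Q (z, even j)) (segment_chain j)" if "j < m" for j
    unfolding chain_map_path_chain
  proof (rule path_chain_cong)
    fix x :: real assume x: "0 \<le> x" "x \<le> 1"
    have "(s (Suc j) - s j) * x \<le> s (Suc j) - s j"
      using mono[OF that] x by (intro mult_left_le) auto
    then show "h (s j + (s (Suc j) - s j) * x - s 0)
        = double_point n Q (q j (s j + (s (Suc j) - s j) * x), even j)"
      using mono[OF that] x that by (intro h) auto
  qed
  moreover have "path_chain (\<lambda>x. h (s 0 + (s m - s 0) * x - s 0)) = path_chain h"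
    using period by simp
  ultimately show ?thesis
    using path_chain_subdivide[OF mono h_continuous_map] by simp
qed

text \<open>Summation by parts: an intermediate value is met once as an end and once as a start,
  with the same sign, which gives the factor 2.\<close>

lemma alternating_telescope:
  fixes a :: "nat \<Rightarrow> real"
  shows "(\<Sum>j<k. (-1) ^ j * (a (Suc j) - a j))
    = - 2 * (\<Sum>j = 1..k. (-1) ^ j * a j) + (-1) ^ k * a k - a 0"
  by (induction k) (auto simp: algebra_simps)

text \<open>Along arc \<open>j\<close> the circle map turns by \<open>(-1) ^ j\<close> times the
  increment of \<open>u\<close>. Since \<open>u\<close> is 1/2 on edge \<open>i\<close> and 0 on the
  other edges, the total number of turns is \<open>- crossing_number e m i\<close>; it vanishes on a
  boundary.\<close>

lemma null_homologous_imp_crossing_number: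
  assumes "null_homologous (double n Q) h" "i < n"
  shows "crossing_number e m i = 0"
proof -
  obtain u where u: "continuous_on (punctured_region n Q) u"
    "\<And>j z. j < n \<Longrightarrow> z \<in> edge n Q j - vertices n Q \<Longrightarrow> u z = (if j = i then 1 / 2 else 0 :: real)"
    using edge_indicator[OF ngon assms(2)] by blast
  have "u z \<in> {0, 1 / 2}" if "z \<in> boundary n Q - vertices n Q" for z
    using that u(2) by (auto simp: boundary_def)
  from double_function[OF u(1) this] obtain \<psi> where
    \<psi>: "continuous_map (double n Q) euclidean \<psi>" "\<And>x. x \<in> topspace (double n Q) \<Longrightarrow> \<psi> x \<noteq> 0"
    "\<And>z b. z \<in> punctured_region n Q \<Longrightarrow>
       \<psi> (double_point n Q (z, b)) = exp (2 * pi * \<i> * of_real ((if b then 1 else -1) * u z))"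
    by blast
  have seg: "chain_change \<psi> (chain_map 1 (\<lambda>z. double_point n Q (z, even j)) (segment_chain j))
      = 2 * pi * \<i> * of_real ((-1) ^ j * (u (p (Suc j)) - u (p j)))" if j: "j < m" for j
  proof -
    let ?l = "\<lambda>x. s j + (s (Suc j) - s j) * x"
    \<comment> \<open>As \<open>\<psi>\<close> is an exponential on each sheet, its logarithm along
      the arc is explicit.\<close>
    let ?L = "\<lambda>x. 2 * pi * \<i> * of_real ((if even j then 1 else -1) * u (q j (?l x)))"
    have l: "?l x \<in> {s j..s (Suc j)}" if "x \<in> {0..1}" for x
      using mult_left_le[of x "s (Suc j) - s j"] mono[OF j] that by auto
    have "continuous_on {0..1} (\<lambda>x. q j (?l x))"
      by (rule continuous_on_compose2[OF cont[OF j]]) (use l in \<open>auto intro!: continuous_intros\<close>)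
    then have "continuous_on {0..1} (\<lambda>x. u (q j (?l x)))"
      by (rule continuous_on_compose2[OF u(1)]) (use l in_region[OF j] in blast)
    then have "continuous_on {0..1} ?L"
      by (intro continuous_intros)
    then have "chain_change \<psi> (path_chain (\<lambda>x. double_point n Q (q j (?l x), even j))) = ?L 1 - ?L 0"
      by (rule chain_change_path_chain) (use l in_region[OF j] in \<open>simp add: \<psi>(3)\<close>)
    then show ?thesis
      using start[OF j] finish[OF j] by (simp add: chain_map_path_chain[unfolded One_nat_def] algebra_simps minus_one_power_iff)
  qed
  have "0 = chain_change \<psi> (path_chain h)"
    using chain_change_relboundary[OF \<psi>(1,2)] assms(1) by (simp add: null_homologous_iff_relboundary)
  also have "\<dots> = (\<Sum>j<m. chain_change \<psi> (chain_map 1 (\<lambda>z. double_point n Q (z, even j)) (segment_chain j)))"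
    using chain_change_homologous[OF \<psi>(1,2) path_chain_homologous_segments]
    by (simp add: chain_change_sum)
  also have "\<dots> = (\<Sum>j<m. 2 * pi * \<i> * of_real ((-1) ^ j * (u (p (Suc j)) - u (p j))))"
    by (intro sum.cong refl seg) auto
  also have "\<dots> = 2 * pi * \<i> * of_real (\<Sum>j<m. (-1) ^ j * (u (p (Suc j)) - u (p j)))"
    by (simp only: of_real_sum sum_distrib_left)
  finally have "complex_of_real (2 * pi) * \<i> * of_real (\<Sum>j<m. (-1) ^ j * (u (p (Suc j)) - u (p j))) = 0"
    by (rule sym)
  then have "(\<Sum>j<m. (-1) ^ j * (u (p (Suc j)) - u (p j))) = 0"
    unfolding mult_eq_0_iff of_real_eq_0_iff by simp
  then have "(\<Sum>j = 1..m. (-1) ^ j * u (p j)) = 0"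
    unfolding alternating_telescope[of "\<lambda>j. u (p j)"] using m closed by simp
  moreover have "(\<Sum>j = 1..m. (-1) ^ j * u (p j)) = (\<Sum>j = 1..m. of_int (if e j = i then (-1) ^ j else 0) / 2)"
  proof (intro sum.cong refl)
    fix j assume "j \<in> {1..m}"
    then have "u (p j) = (if e j = i then 1 / 2 else 0)"
      using labels[of j] p_in_region[of j] by (intro u(2)) auto
    then show "(-1) ^ j * u (p j) = of_int (if e j = i then (-1) ^ j else 0) / 2"
      by simp
  qed
  ultimately have "of_int (crossing_number e m i) / 2 = (0 :: real)"
    by (simp add: crossing_number_def sum_divide_distrib)
  then show ?thesis by simp
qed

text \<open>Contractibility of the sheet lets each arc be rerouted through the base point
  \<open>p 0\<close>. The two routes that meet at a crossing lie on different sheets and combine to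
  a loop that depends only on the edge.\<close>

lemma crossing_number_imp_null_homologous:
  assumes zero: "\<And>i. i < n \<Longrightarrow> crossing_number e m i = 0"
  shows "null_homologous (double n Q) h"
proof -
  let ?A = "top_of_set (punctured_region n Q)" and ?D = "double n Q"
  let ?F = "\<lambda>b. chain_map 1 (\<lambda>z. double_point n Q (z, b))"
  have contr: "contractible_space ?A"
    using contractible_punctured_region[OF ngon] by (simp add: contractible_space_top_of_set)
  then have pc: "path_connected_space ?A"
    by (rule contractible_imp_path_connected_space)
  have "\<forall>z\<in>punctured_region n Q. \<exists>c. singular_chain 1 ?A c \<and> chain_boundary 1 c = point_chain z - point_chain (p 0)"
  proof
    fix z assume "z \<in> punctured_region n Q"
    then obtain g where "pathin ?A g" "g 0 = p 0" "g 1 = z"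
      using pc p_in_region[of 0] by (auto simp: path_connected_space_def)
    then show "\<exists>c. singular_chain 1 ?A c \<and> chain_boundary 1 c = point_chain z - point_chain (p 0)"
      by (intro exI[of _ "path_chain g"]) (simp add: singular_chain_path_chain[unfolded One_nat_def] chain_boundary_path_chain[unfolded One_nat_def])
  qed
  from bchoice[OF this] obtain \<beta> where \<beta>: "\<And>z. z \<in> punctured_region n Q \<Longrightarrow> singular_chain 1 ?A (\<beta> z)"
    "\<And>z. z \<in> punctured_region n Q \<Longrightarrow> chain_boundary 1 (\<beta> z) = point_chain z - point_chain (p 0)"
    by blast
  \<comment> \<open>Front copy minus back copy of one route. For \<open>z\<close> on an edge this is
    a cycle, because \<open>p 0\<close> lies on an edge too.\<close>
  define \<Theta> where "\<Theta> z = ?F True (\<beta> z) - ?F False (\<beta> z)" for z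
  have \<Theta>: "homologous_rel 1 ?D {} (\<Theta> y) (\<Theta> z)"
    if i: "i < n" and yz: "y \<in> edge n Q i - vertices n Q" "z \<in> edge n Q i - vertices n Q" for i y z
  proof -
    have seg: "closed_segment y z \<subseteq> edge n Q i - vertices n Q"
      using yz edge_minus_vertices[OF ngon i] by (metis closed_segment_subset convex_open_segment)
    have sub: "edge n Q i - vertices n Q \<subseteq> punctured_region n Q"
      using edge_subset_boundary[OF i, of Q] by (auto simp: region_def)
    define \<kappa> where "\<kappa> = path_chain (linepath y z)"
    have yz': "y \<in> punctured_region n Q" "z \<in> punctured_region n Q"
      using yz sub by auto
    have \<kappa>: "singular_chain 1 ?A \<kappa>"
      unfolding \<kappa>_def using seg sub
      by (intro singular_chain_path_chain)
        (auto simp: pathin_def continuous_map_in_subtopology simp flip: linepath_image_01 intro!: continuous_intros)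
    have "homologous_rel 1 ?A {} (\<beta> y + \<kappa>) (\<beta> z)"
      using \<kappa> \<beta> yz' by (intro contractible_space_homologous[OF contr])
        (auto simp: singular_chain_add chain_boundary_add \<kappa>_def chain_boundary_path_chain[unfolded One_nat_def] linepath_0' linepath_1')
    then have F: "homologous_rel 1 ?D {} (?F b (\<beta> y) + ?F b \<kappa>) (?F b (\<beta> z))" for b
      using homologous_rel_chain_map[OF _ continuous_map_sheet] by (metis chain_map_add)
    \<comment> \<open>Within an edge the sheets are glued, so the connecting piece cancels in the
      difference.\<close>
    have "?F True \<kappa> = ?F False \<kappa>"
      unfolding \<kappa>_def chain_map_path_chain
    proof (rule path_chain_cong)
      fix x :: real assume "0 \<le> x" "x \<le> 1"
      then have "linepath y z x \<in> closed_segment y z"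
        by (simp add: linepath_in_path)
      then show "double_point n Q (linepath y z x, True) = double_point n Q (linepath y z x, False)"
        using seg edge_subset_boundary[OF i, of Q] by (auto simp: double_point_eq_iff)
    qed
    then show ?thesis
      using homologous_rel_diff[OF F[of True] F[of False]] by (simp add: \<Theta>_def)
  qed
  define rep where "rep i = (SOME z. z \<in> edge n Q i - vertices n Q)" for i
  have rep: "homologous_rel 1 ?D {} (\<Theta> (p j)) (\<Theta> (rep (e j)))" if "j \<le> m" for j
  proof -
    have "p j \<in> edge n Q (e j) - vertices n Q"
      using labels(2)[OF that] p_in_region[OF that] by blast
    moreover from this have "rep (e j) \<in> edge n Q (e j) - vertices n Q"
      unfolding rep_def by (rule someI)
    ultimately show ?thesis
      by (rule \<Theta>[OF labels(1)[OF that]])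
  qed
  \<comment> \<open>Arc and reroute have the same boundary in the contractible polygon, so they are
    homologous already before they are mapped to a sheet.\<close>
  have "homologous_rel 1 ?D {} (\<Sum>j<m. ?F (even j) (segment_chain j))
      (\<Sum>j<m. ?F (even j) (\<beta> (p (Suc j)) - \<beta> (p j)))"
  proof (rule homologous_rel_sum)
    fix j assume "j \<in> {..<m}"
    then have j: "j < m" by simp
    show "homologous_rel 1 ?D {} (?F (even j) (segment_chain j)) (?F (even j) (\<beta> (p (Suc j)) - \<beta> (p j)))"
    proof (rule homologous_rel_chain_map[OF contractible_space_homologous[OF contr] continuous_map_sheet])
      show "singular_chain 1 ?A (segment_chain j)"
        by (rule singular_chain_path_chain[OF pathin_segment[OF segment_continuous_map[OF j] mono[OF j]]])
      show "singular_chain 1 ?A (\<beta> (p (Suc j)) - \<beta> (p j))"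
        using j by (intro singular_chain_diff \<beta> p_in_region) auto
      have "chain_boundary 1 (segment_chain j) = point_chain (p (Suc j)) - point_chain (p j)"
        unfolding chain_boundary_path_chain using start[OF j] finish[OF j] by simp
      then show "chain_boundary 1 (segment_chain j) = chain_boundary 1 (\<beta> (p (Suc j)) - \<beta> (p j))"
        unfolding chain_boundary_diff
        using \<beta>(2)[OF p_in_region[of "Suc j"]] \<beta>(2)[OF p_in_region[of j]] j by simp
    qed
  qed simp_all
  \<comment> \<open>Summation by parts. The general \<open>k\<close> keeps an end term on the
    current sheet; at \<open>k = m\<close> it cancels, because \<open>m\<close> is even and
    \<open>p m = p 0\<close>.\<close>
  moreover have "(\<Sum>j<k. ?F (even j) (\<beta> (p (Suc j)) - \<beta> (p j)))
      = - (\<Sum>j = 1..k. frag_cmul ((-1) ^ j) (\<Theta> (p j))) + ?F (even k) (\<beta> (p k)) - ?F True (\<beta> (p 0))" for k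
  proof (induction k)
    case (Suc k)
    have "?F (even k) x = frag_cmul ((-1) ^ k) (?F True x - ?F False x) + ?F (odd k) x" for x
      by (cases "even k") (auto simp: frag_cmul_minus_one_power_even frag_cmul_minus_one_power_odd)
    from this[of "\<beta> (p (Suc k))"] Suc show ?case
      by (simp add: \<Theta>_def chain_map_diff)
  qed simp
  from this[of m] have "(\<Sum>j<m. ?F (even j) (\<beta> (p (Suc j)) - \<beta> (p j)))
      = - (\<Sum>j = 1..m. frag_cmul ((-1) ^ j) (\<Theta> (p j)))"
    using m closed by simp
  ultimately have "homologous_rel 1 ?D {} (path_chain h) (- (\<Sum>j = 1..m. frag_cmul ((-1) ^ j) (\<Theta> (p j))))"
    using homologous_rel_trans[OF _ path_chain_homologous_segments] by simp
  moreover have "homologous_rel 1 ?D {} (\<Sum>j = 1..m. frag_cmul ((-1) ^ j) (\<Theta> (p j)))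
      (\<Sum>j = 1..m. frag_cmul ((-1) ^ j) (\<Theta> (rep (e j))))"
  proof (rule homologous_rel_sum)
    fix j assume "j \<in> {1..m}"
    then have "homologous_rel 1 ?D {} (\<Theta> (p j)) (\<Theta> (rep (e j)))"
      by (intro rep) simp
    then show "homologous_rel 1 ?D {} (frag_cmul ((-1) ^ j) (\<Theta> (p j))) (frag_cmul ((-1) ^ j) (\<Theta> (rep (e j))))"
      unfolding homologous_rel_def frag_cmul_diff_right[symmetric]
      by (rule singular_relboundary_cmul)
  qed simp_all
  moreover have "(\<Sum>j = 1..m. frag_cmul ((-1) ^ j) (\<Theta> (rep (e j)))) = 0"
    by (rule sum_by_crossing_number[of m e n "\<lambda>i. \<Theta> (rep i)"]) (use labels zero in auto)
  ultimately show ?thesis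
    unfolding null_homologous_iff_relboundary homologous_rel_def
    using singular_relboundary_diff by fastforce
qed

end

section \<open>Unfoldings\<close>

lemma mirror_add:
  "mirror n v i (z + w) = mirror n v i z + (v (Suc i mod n) - v i) / cnj (v (Suc i mod n) - v i) * cnj w"
  by (simp add: mirror_def Let_def add_divide_distrib diff_divide_distrib algebra_simps)

lemma mirror_edge:
  assumes "z \<in> edge n v i"
  shows "mirror n v i z = z"
proof -
  obtain u where "z = (1 - u) *\<^sub>R v i + u *\<^sub>R v (Suc i mod n)"
    using assms by (auto simp: edge_eq in_segment)
  then have z: "z = v i + of_real u * (v (Suc i mod n) - v i)"
    by (simp add: scaleR_conv_of_real algebra_simps)
  show ?thesis
    by (cases "v (Suc i mod n) - v i = 0") (auto simp: z mirror_def Let_def)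
qed

lemma mirror_mirror:
  assumes "v (Suc i mod n) - v i \<noteq> 0"
  shows "mirror n v i (mirror n v i z) = z"
  using assms by (simp add: mirror_def Let_def)

text \<open>The linear part of the map of copy \<open>j\<close> is multiplication by this number,
  preceded by a conjugation if \<open>j\<close> is odd. New reflections are composed on the right,
  so their factor has to pass that conjugation.\<close>

fun fold_coeff :: "nat \<Rightarrow> (nat \<Rightarrow> nat) \<Rightarrow> (nat \<Rightarrow> complex) \<Rightarrow> nat \<Rightarrow> complex" where
  "fold_coeff n e v 0 = 1"
| "fold_coeff n e v (Suc j) = fold_coeff n e v j *
    (let \<rho> = (v (Suc (e (Suc j)) mod n) - v (e (Suc j))) / cnj (v (Suc (e (Suc j)) mod n) - v (e (Suc j)))
     in if even j then \<rho> else cnj \<rho>)"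

definition fold_linear :: "nat \<Rightarrow> (nat \<Rightarrow> nat) \<Rightarrow> (nat \<Rightarrow> complex) \<Rightarrow> nat \<Rightarrow> complex \<Rightarrow> complex" where
  "fold_linear n e v j w = fold_coeff n e v j * (if even j then w else cnj w)"

lemma fold_linear_of_real [simp]: "fold_linear n e v j (of_real x * w) = of_real x * fold_linear n e v j w"
  by (simp add: fold_linear_def)

lemma unfold_map_add:
  "unfold_map n P f Q j (z + w) = unfold_map n P f Q j z + fold_linear n (hit_edge n P f) Q j w"
proof (induction j arbitrary: z w)
  case (Suc j)
  show ?case
    by (simp only: unfold_map.simps o_apply mirror_add Suc.IH) (simp add: fold_linear_def Let_def)
qed (simp add: fold_linear_def)

lemma unfold_map_edge:
  assumes "z \<in> edge n Q (hit_edge n P f (Suc j))"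
  shows "unfold_map n P f Q (Suc j) z = unfold_map n P f Q j z"
  by (simp add: mirror_edge[OF assms])

lemma fold_coeff_norm:
  assumes "\<And>k. k \<in> {1..j} \<Longrightarrow> v (Suc (e k) mod n) - v (e k) \<noteq> 0"
  shows "cmod (fold_coeff n e v j) = 1"
  using assms
proof (induction j)
  case (Suc j)
  have "v (Suc (e (Suc j)) mod n) - v (e (Suc j)) \<noteq> 0"
    using Suc.prems[of "Suc j"] by simp
  then have "cmod (v (Suc (e (Suc j)) mod n) - v (e (Suc j))) \<noteq> 0"
    by simp
  then show ?case
    using Suc by (simp add: Let_def norm_mult norm_divide del: complex_cnj_diff)
qed simp

lemma bij_unfold_map:
  assumes "\<And>k. k \<in> {1..j} \<Longrightarrow> Q (Suc (hit_edge n P f k) mod n) - Q (hit_edge n P f k) \<noteq> 0"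
  shows "bij (unfold_map n P f Q j)"
  using assms
proof (induction j)
  case 0
  then show ?case
    by (simp add: bij_diff_right)
next
  case (Suc j)
  have "bij (mirror n Q (hit_edge n P f (Suc j)))"
    using mirror_mirror[of Q "hit_edge n P f (Suc j)" n] Suc.prems[of "Suc j"]
    by (intro o_bij[of "mirror n Q (hit_edge n P f (Suc j))"]) (auto simp: fun_eq_iff)
  moreover have "bij (unfold_map n P f Q j)"
    using Suc by simp
  ultimately show ?case
    unfolding unfold_map.simps by (rule bij_comp)
qed

text \<open>The linear part of the last copy map has to be the identity. Its value at 1 fixes the
  coefficient, and its value at \<i> excludes a conjugation.\<close>

lemma ends_translate_iff:
  "ends_translate n P f Q \<longleftrightarrow> even (num_hits n P f) \<and> fold_coeff n (hit_edge n P f) Q (num_hits n P f) = 1"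
    (is "_ \<longleftrightarrow> even ?m \<and> ?\<alpha> = 1")
proof
  let ?U = "unfold_map n P f Q"
  assume "ends_translate n P f Q"
  then obtain c where c: "\<And>z. ?U ?m z = ?U 0 z + c"
    by (auto simp: ends_translate_def)
  have lin: "fold_linear n (hit_edge n P f) Q ?m w = w" for w
    using c[of "0 + w"] c[of 0] unfolding unfold_map_add by (simp add: fold_linear_def)
  from lin[of 1] have \<alpha>: "?\<alpha> = 1"
    by (simp add: fold_linear_def split: if_splits)
  with lin[of \<i>] show "even ?m \<and> ?\<alpha> = 1"
    by (auto simp: fold_linear_def complex_eq_iff split: if_splits)
next
  let ?U = "unfold_map n P f Q"
  assume *: "even ?m \<and> ?\<alpha> = 1"
  have "?U ?m z = ?U 0 z + (?U ?m 0 - ?U 0 0)" for z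
    using unfold_map_add[of n P f Q ?m 0 z] * by (simp add: fold_linear_def)
  then show "ends_translate n P f Q"
    unfolding ends_translate_def by blast
qed

text \<open>A factor \<open>d / cnj d\<close> has modulus one, so conjugation inverts it, and strike
  \<open>j\<close> enters with exponent \<open>- (-1) ^ j\<close>.\<close>

lemma fold_coeff_eq_prod:
  assumes "\<And>i. i < n \<Longrightarrow> v (Suc i mod n) - v i \<noteq> 0" "\<And>j. j \<in> {1..m} \<Longrightarrow> e j < n"
  shows "fold_coeff n e v m = (\<Prod>i<n. ((v (Suc i mod n) - v i) / cnj (v (Suc i mod n) - v i))
      powi (- crossing_number e m i))"
  using assms(2)
proof (induction m)
  case 0
  then show ?case by (simp add: crossing_number_def)
next
  case (Suc m)
  let ?\<rho> = "\<lambda>i. (v (Suc i mod n) - v i) / cnj (v (Suc i mod n) - v i)"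
  let ?k = "e (Suc m)"
  have k: "?k < n"
    using Suc.prems[of "Suc m"] by simp
  have nz: "?\<rho> i \<noteq> 0" if "i < n" for i
    using assms(1)[OF that] by simp
  have "?\<rho> i powi (- crossing_number e (Suc m) i)
      = ?\<rho> i powi (- crossing_number e m i) * (if i = ?k then ?\<rho> i powi ((-1) ^ m) else 1)" if "i < n" for i
  proof -
    have "- crossing_number e (Suc m) i = - crossing_number e m i + (if i = ?k then (-1) ^ m else 0)"
      by (auto simp: crossing_number_def)
    moreover have "?\<rho> i powi (a + b) = ?\<rho> i powi a * ?\<rho> i powi b" for a b
      using nz[OF that] by (intro power_int_add) simp
    ultimately show ?thesis
      by (simp only:) (simp only: power_int_0_right split: if_split, blast)
  qed
  then have "(\<Prod>i<n. ?\<rho> i powi (- crossing_number e (Suc m) i))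
      = (\<Prod>i<n. ?\<rho> i powi (- crossing_number e m i)) * (\<Prod>i<n. if i = ?k then ?\<rho> i powi ((-1) ^ m) else 1)"
    by (simp add: prod.distrib)
  also have "(\<Prod>i<n. if i = ?k then ?\<rho> i powi ((-1) ^ m) else 1) = ?\<rho> ?k powi ((-1) ^ m)"
    using k by (simp add: prod.delta)
  also have "?\<rho> ?k powi ((-1) ^ m) = (if even m then ?\<rho> ?k else cnj (?\<rho> ?k))"
    by (auto simp: power_int_minus)
  finally show ?case
    using Suc by (simp add: Let_def)
qed

section \<open>Strike times, labels and positions\<close>

locale periodic_billiard =
  fixes n :: nat and P :: "nat \<Rightarrow> complex" and f :: "real \<Rightarrow> complex"
  assumes ngon: "ngon n P" and periodic: "periodic_trajectory n P f" and hits: "0 < num_hits n P f"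
begin

abbreviation "hit_set \<equiv> {t. 0 < t \<and> t \<le> 1 \<and> f t \<in> boundary n P}"

lemma trajectory: "trajectory n P f"
  and f_0: "f 0 \<in> boundary n P" and f_1: "f 1 = f 0"
  and translate_P: "ends_translate n P f P"
  using periodic by (auto simp: periodic_trajectory_def)

text \<open>An infinite set has \<open>card\<close> 0, so a positive number of strikes already says
  that there are finitely many.\<close>

lemma finite_hit_set: "finite hit_set"
  using hits card_ge_0_finite unfolding num_hits_def by blast

text \<open>The number of strikes still to come is carried through the induction: it keeps the set
  under \<open>Inf\<close> nonempty, and finiteness within the period makes the infimum a
  minimum.\<close>

lemma hit_time_step:
  assumes "j \<le> num_hits n P f"
  shows "card {t \<in> hit_set. hit_time n P f j < t} = num_hits n P f - j \<and> 0 \<le> hit_time n P f j \<and>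
    (0 < j \<longrightarrow> hit_time n P f j \<in> hit_set \<and> hit_time n P f (j - 1) < hit_time n P f j \<and>
      (\<forall>t. hit_time n P f (j - 1) < t \<and> t < hit_time n P f j \<longrightarrow> f t \<notin> boundary n P))"
  using assms
proof (induction j)
  case 0
  have "{t \<in> hit_set. hit_time n P f 0 < t} = hit_set"
    by auto
  then show ?case
    by (simp add: num_hits_def)
next
  case (Suc j)
  let ?h = "hit_time n P f j"
  let ?S = "{t \<in> hit_set. ?h < t}"
  let ?\<mu> = "Min ?S"
  have IH: "card ?S = num_hits n P f - j" "0 \<le> ?h"
    using Suc by auto
  have fin: "finite ?S"
    by (rule finite_subset[OF _ finite_hit_set]) auto
  moreover have ne: "?S \<noteq> {}"
  proof
    assume e: "?S = {}"
    have "card ?S = 0" unfolding e by simp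
    with IH(1) Suc.prems show False by linarith
  qed
  ultimately have \<mu>: "?\<mu> \<in> ?S"
    by (rule Min_in)
  \<comment> \<open>Strikes after time 1 also enter the infimum, but \<open>?\<mu>\<close> is at
    most 1.\<close>
  have least: "?\<mu> \<le> t" if "?h < t" "f t \<in> boundary n P" for t
  proof (cases "t \<le> 1")
    case True
    then have "t \<in> ?S" using that IH(2) by auto
    then show ?thesis using fin by (rule Min_le[rotated])
  next
    case False
    then show ?thesis using \<mu> by auto
  qed
  have "Inf {t. ?h < t \<and> f t \<in> boundary n P} = ?\<mu>"
    by (rule cInf_eq_minimum) (use \<mu> least in auto)
  then have eq: "hit_time n P f (Suc j) = ?\<mu>"
    by simp
  have "{t \<in> hit_set. ?\<mu> < t} = ?S - {?\<mu>}"
    using \<mu> Min_le[OF fin] by force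
  then have "card {t \<in> hit_set. ?\<mu> < t} = num_hits n P f - Suc j"
    using \<mu> IH(1) fin by simp
  moreover have "f t \<notin> boundary n P" if "?h < t" "t < ?\<mu>" for t
    using least[of t] that by auto
  ultimately show ?case
    unfolding eq using \<mu> by auto
qed

lemma hit_time_less: "j < num_hits n P f \<Longrightarrow> hit_time n P f j < hit_time n P f (Suc j)"
  using hit_time_step[of "Suc j"] by (auto simp del: hit_time.simps)

lemma no_hit_between:
  "j < num_hits n P f \<Longrightarrow> hit_time n P f j < t \<Longrightarrow> t < hit_time n P f (Suc j) \<Longrightarrow> f t \<notin> boundary n P"
  using hit_time_step[of "Suc j"] by (auto simp del: hit_time.simps)

lemma hit_in_boundary: "j \<le> num_hits n P f \<Longrightarrow> f (hit_time n P f j) \<in> boundary n P"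
  using hit_time_step[of j] f_0 by (cases j) (auto simp del: hit_time.simps(2))

text \<open>After strike number \<open>num_hits\<close> none is left in the period, while time 1 is
  a strike because \<open>f 1 = f 0\<close>.\<close>

lemma hit_time_last: "hit_time n P f (num_hits n P f) = 1"
proof -
  let ?m = "num_hits n P f"
  have "{t \<in> hit_set. hit_time n P f ?m < t} = {}"
  proof -
    have "finite {t \<in> hit_set. hit_time n P f ?m < t}"
      by (rule finite_subset[OF _ finite_hit_set]) auto
    then show ?thesis
      using hit_time_step[of ?m] by (metis card_0_eq diff_self_eq_0 le_refl)
  qed
  moreover have "1 \<in> hit_set"
    using f_0 f_1 by auto
  ultimately have "\<not> hit_time n P f ?m < 1"
    by blast
  then show ?thesis
    using hit_time_step[of ?m] hits by force
qed

lemma f_in_region: "f t \<in> region n P - vertices n P"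
  using trajectory by (simp add: trajectory_def)

lemma hit_edge:
  assumes "j \<le> num_hits n P f"
  shows "hit_edge n P f j < n" "f (hit_time n P f j) \<in> edge n P (hit_edge n P f j)"
proof -
  obtain i where i: "i < n" "f (hit_time n P f j) \<in> edge n P i"
    using hit_in_boundary[OF assms] by (auto simp: boundary_def)
  have "hit_edge n P f j = i"
    unfolding hit_edge_def
    by (rule the_equality) (use i edge_unique[OF ngon _ i(1) _ i(2)] f_in_region in blast)+
  then show "hit_edge n P f j < n" "f (hit_time n P f j) \<in> edge n P (hit_edge n P f j)"
    using i by auto
qed

lemma hit_param:
  assumes "j \<le> num_hits n P f"
  shows "0 < hit_param n P f j" "hit_param n P f j < 1"
    "f (hit_time n P f j) = edge_path n P (hit_edge n P f j) (hit_param n P f j)"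
proof -
  let ?i = "hit_edge n P f j" and ?z = "f (hit_time n P f j)"
  have i: "?i < n" "?z \<in> edge n P ?i - vertices n P"
    using hit_edge[OF assms] f_in_region by auto
  then have "?z \<in> open_segment (P ?i) (P (Suc ?i mod n))"
    using edge_minus_vertices[OF ngon i(1)] by simp
  then obtain t where t: "0 < t" "t < 1" "?z = edge_path n P ?i t"
    by (auto simp: in_segment edge_path_def linepath_def)
  have "hit_param n P f j = t"
    unfolding hit_param_def
  proof (rule the_equality)
    fix t' assume "0 \<le> t' \<and> t' \<le> 1 \<and> ?z = edge_path n P ?i t'"
    then have "edge_path n P ?i t' = edge_path n P ?i t"
      using t(3) by simp
    then have "(t' - t) *\<^sub>R (P (Suc ?i mod n) - P ?i) = 0"
      by (simp add: edge_path_def linepath_def algebra_simps)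
    then show "t' = t"
      using ngon_edge_nonzero[OF ngon i(1)] by simp
  qed (use t in auto)
  then show "0 < hit_param n P f j" "hit_param n P f j < 1"
    "?z = edge_path n P ?i (hit_param n P f j)"
    using t by auto
qed

lemma hit_edge_last: "hit_edge n P f (num_hits n P f) = hit_edge n P f 0"
  and hit_param_last: "hit_param n P f (num_hits n P f) = hit_param n P f 0"
proof -
  show *: "hit_edge n P f (num_hits n P f) = hit_edge n P f 0"
    by (simp add: hit_edge_def hit_time_last f_1)
  then show "hit_param n P f (num_hits n P f) = hit_param n P f 0"
    by (simp add: hit_param_def hit_time_last f_1)
qed

end

section \<open>Straightness of the unfolded trajectory\<close>

text \<open>Local affinity makes the derivative locally constant, hence constant on the open
  interval. At the ends, where strikes occur, only one-sided information is available; it fixes the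
  end values and both end velocities.\<close>

lemma affine_on_interval:
  fixes f :: "real \<Rightarrow> complex"
  assumes ab: "a < b"
    and loc: "\<And>t. a < t \<Longrightarrow> t < b \<Longrightarrow> \<exists>u. \<forall>\<^sub>F h in nhds 0. f (t + h) = f t + of_real h * u"
    and right: "0 < \<epsilon>" "\<And>h. 0 < h \<Longrightarrow> h < \<epsilon> \<Longrightarrow> f (a + h) = f a + of_real h * u"
    and left: "0 < \<delta>" "\<And>h. 0 < h \<Longrightarrow> h < \<delta> \<Longrightarrow> f (b - h) = f b - of_real h * w"
  shows "u = w" "t \<in> {a..b} \<Longrightarrow> f t = f a + of_real (t - a) * u"
proof -
  define D where "D t = vector_derivative f (at t)" for t
  have affine: "\<exists>u e. 0 < e \<and> (\<forall>s\<in>ball t e. (f has_vector_derivative u) (at s))"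
    if t: "t \<in> {a<..<b}" for t
  proof -
    obtain u where "\<forall>\<^sub>F h in nhds 0. f (t + h) = f t + of_real h * u"
      using loc t by auto
    then obtain e where e: "0 < e" "\<And>h. \<bar>h\<bar> < e \<Longrightarrow> f (t + h) = f t + of_real h * u"
      by (auto simp: eventually_nhds_metric dist_real_def)
    have "(f has_vector_derivative u) (at s)" if s: "s \<in> ball t e" for s
    proof (rule has_vector_derivative_transform_within_open[OF _ open_ball s])
      show "((\<lambda>s. f t + of_real (s - t) * u) has_vector_derivative u) (at s)"
        by (auto intro!: derivative_eq_intros)
      show "f t + of_real (s - t) * u = f s" if "s \<in> ball t e" for s
        using e(2)[of "s - t"] that by (simp add: dist_real_def)
    qed
    with e(1) show ?thesis by blast
  qed
  have fD: "(f has_vector_derivative D t) (at t)" if "t \<in> {a<..<b}" for t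
    using affine[OF that] unfolding D_def
    by (metis centre_in_ball vector_derivative_works differentiableI_vector)
  have "(D has_vector_derivative 0) (at t)" if t: "t \<in> {a<..<b}" for t
  proof -
    obtain u e where e: "0 < e" "\<And>s. s \<in> ball t e \<Longrightarrow> (f has_vector_derivative u) (at s)"
      using affine[OF t] by blast
    show ?thesis
      by (rule has_vector_derivative_transform_within_open[of "\<lambda>_. u" _ _ "ball t e"])
        (use e vector_derivative_at in \<open>auto simp: D_def\<close>)
  qed
  then obtain d where d: "\<And>t. t \<in> {a<..<b} \<Longrightarrow> D t = d"
    using has_vector_derivative_zero_constant[of "{a<..<b}" D] has_vector_derivative_at_within
    by (metis convex_real_interval(8))
  have "((\<lambda>t. f t - of_real t * d) has_vector_derivative 0) (at t within {a<..<b})" if "t \<in> {a<..<b}" for t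
    using fD[OF that] d[OF that] has_vector_derivative_at_within
    by (auto intro!: derivative_eq_intros)
  then obtain c where c: "\<And>t. t \<in> {a<..<b} \<Longrightarrow> f t - of_real t * d = c"
    using has_vector_derivative_zero_constant[of "{a<..<b}" "\<lambda>t. f t - of_real t * d"]
    by (metis convex_real_interval(8))
  have eq: "f t = c + of_real t * d" if "t \<in> {a<..<b}" for t
    using c[OF that] by (simp add: algebra_simps)
  \<comment> \<open>An affine function of \<open>h\<close> that vanishes at \<open>r / 2\<close> and
    \<open>r / 4\<close> is zero; this compares the motion near an end with the motion in the
    interior.\<close>
  have two_points: "x = 0 \<and> y = 0"
    if "0 < r" "\<And>h. 0 < h \<Longrightarrow> h < r \<Longrightarrow> x + of_real h * y = 0" for r :: real and x y :: complex
  proof -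
    have "of_real (r / 4) * y = (x + of_real (r / 2) * y) - (x + of_real (r / 4) * y)"
      by (simp add: algebra_simps)
    also have "\<dots> = 0"
      using that(2)[of "r / 2"] that(2)[of "r / 4"] that(1) by simp
    finally have "y = 0"
      using that(1) by simp
    then show ?thesis
      using that(2)[of "r / 2"] that(1) by simp
  qed
  have R: "c + of_real a * d - f a = 0 \<and> d - u = 0"
  proof (rule two_points[of "min \<epsilon> (b - a)"])
    fix h assume h: "0 < h" "h < min \<epsilon> (b - a)"
    then have "f a + of_real h * u = c + of_real (a + h) * d"
      using right(2)[of h] eq[of "a + h"] by auto
    then show "c + of_real a * d - f a + of_real h * (d - u) = 0"
      by (simp add: algebra_simps)
  qed (use ab right in auto)
  have L: "c + of_real b * d - f b = 0 \<and> w - d = 0"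
  proof (rule two_points[of "min \<delta> (b - a)"])
    fix h assume h: "0 < h" "h < min \<delta> (b - a)"
    then have "f b - of_real h * w = c + of_real (b - h) * d"
      using left(2)[of h] eq[of "b - h"] by auto
    then show "c + of_real b * d - f b + of_real h * (w - d) = 0"
      by (simp add: algebra_simps)
  qed (use ab left in auto)
  show "u = w"
    using R L by simp
  show "f t = f a + of_real (t - a) * u" if t: "t \<in> {a..b}"
  proof -
    have u: "u = d" using R by simp
    have fa: "f a = c + of_real a * d" and fb: "f b = c + of_real b * d"
      using R L by (auto simp: algebra_simps)
    show ?thesis
    proof (cases "t \<in> {a<..<b}")
      case True
      then show ?thesis by (simp add: eq fa u algebra_simps)
    next
      case False
      then have "t = a \<or> t = b" using t by auto
      then show ?thesis by (auto simp: fa fb u algebra_simps)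
    qed
  qed
qed

lemma small_shift_in_unit_interval:
  fixes p r X :: real
  assumes "0 < p" "p < 1" "0 < X"
  shows "\<exists>x. 0 < x \<and> x < X \<and> 0 \<le> p + x * r \<and> p + x * r \<le> 1"
proof -
  \<comment> \<open>The summand 1 keeps the denominator positive when \<open>r = 0\<close>.\<close>
  define x where "x = min (X / 2) (min p (1 - p) / (\<bar>r\<bar> + 1))"
  have "0 < min p (1 - p) / (\<bar>r\<bar> + 1)"
    using assms by (intro divide_pos_pos) auto
  then have x: "0 < x" "x < X"
    using assms unfolding x_def by linarith+
  have "x * (\<bar>r\<bar> + 1) \<le> min p (1 - p)"
  proof -
    have "x \<le> min p (1 - p) / (\<bar>r\<bar> + 1)"
      by (simp add: x_def)
    then show ?thesis
      by (simp add: pos_le_divide_eq)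
  qed
  moreover have "\<bar>x * r\<bar> \<le> x * (\<bar>r\<bar> + 1)"
    using x by (simp add: abs_mult)
  ultimately show ?thesis
    using x by (intro exI[of _ x]) linarith
qed

context periodic_billiard
begin

abbreviation "dir i \<equiv> P (Suc i mod n) - P i"
abbreviation "hit \<equiv> hit_time n P f"
abbreviation "lab \<equiv> hit_edge n P f"
abbreviation "hits \<equiv> num_hits n P f"

lemma impact:
  assumes "j \<le> hits"
  obtains u \<epsilon> where "u \<noteq> 0" "0 < \<epsilon>"
    "\<And>h. 0 < h \<Longrightarrow> h < \<epsilon> \<Longrightarrow> f (hit j - h) = f (hit j) - of_real h * u"
    "\<And>h. 0 < h \<Longrightarrow> h < \<epsilon> \<Longrightarrow>
      f (hit j + h) = f (hit j) + of_real h * (dir (lab j) / cnj (dir (lab j)) * cnj u)"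
proof -
  let ?i = "lab j"
  have i: "?i < n" "f (hit j) \<in> edge n P ?i"
    using hit_edge[OF assms] by auto
  then obtain u where u: "u \<noteq> 0"
    "\<forall>\<^sub>F h in at_left 0. f (hit j + h) = f (hit j) + of_real h * u"
    "\<forall>\<^sub>F h in at_right 0. f (hit j + h) = mirror n P ?i (f (hit j) + of_real h * u)"
    using trajectory unfolding trajectory_def by blast
  obtain a where a: "a < 0" "\<And>h. a < h \<Longrightarrow> h < 0 \<Longrightarrow> f (hit j + h) = f (hit j) + of_real h * u"
    using u(2) by (auto simp: eventually_at_left[of "-1"])
  obtain b where b: "0 < b" "\<And>h. 0 < h \<Longrightarrow> h < b \<Longrightarrow> f (hit j + h) = mirror n P ?i (f (hit j) + of_real h * u)"
    using u(3) by (auto simp: eventually_at_right[of _ 1])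
  show ?thesis
  proof
    show "0 < min (- a) b" using a b by auto
    show "f (hit j - h) = f (hit j) - of_real h * u" if "0 < h" "h < min (- a) b" for h
      using a(2)[of "- h"] that by simp
    show "f (hit j + h) = f (hit j) + of_real h * (dir ?i / cnj (dir ?i) * cnj u)"
      if "0 < h" "h < min (- a) b" for h
      using b(2)[of h] that by (simp add: mirror_add mirror_edge[OF i(2)])
  qed fact
qed

text \<open>The velocity between strikes \<open>j\<close> and \<open>j + 1\<close>, written as a
  difference quotient so that no velocity has to be chosen.\<close>

definition slope :: "nat \<Rightarrow> complex" where
  "slope j = (f (hit (Suc j)) - f (hit j)) / of_real (hit (Suc j) - hit j)"

lemma piece_aux:
  assumes j: "j < hits"
    and r: "0 < \<epsilon>" "\<And>h. 0 < h \<Longrightarrow> h < \<epsilon> \<Longrightarrow> f (hit j + h) = f (hit j) + of_real h * u"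
    and l: "0 < \<delta>" "\<And>h. 0 < h \<Longrightarrow> h < \<delta> \<Longrightarrow> f (hit (Suc j) - h) = f (hit (Suc j)) - of_real h * w"
  shows "slope j = u" "slope j = w" "t \<in> {hit j..hit (Suc j)} \<Longrightarrow> f t = f (hit j) + of_real (t - hit j) * slope j"
proof -
  have lt: "hit j < hit (Suc j)"
    by (rule hit_time_less[OF j])
  have loc: "\<exists>u. \<forall>\<^sub>F h in nhds 0. f (t + h) = f t + of_real h * u" if "hit j < t" "t < hit (Suc j)" for t
    using trajectory no_hit_between[OF j that] unfolding trajectory_def by blast
  note aff = affine_on_interval[OF lt loc r l]
  have "slope j = u"
    using aff(2)[of "hit (Suc j)"] lt by (simp add: slope_def del: hit_time.simps)
  then show "slope j = u" "slope j = w"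
    using aff(1) by simp_all
  show "f t = f (hit j) + of_real (t - hit j) * slope j" if "t \<in> {hit j..hit (Suc j)}"
    unfolding \<open>slope j = u\<close> by (rule aff(2)) (assumption | rule that)+
qed

lemma piece:
  assumes "j < hits" "t \<in> {hit j..hit (Suc j)}"
  shows "f t = f (hit j) + of_real (t - hit j) * slope j"
proof -
  have j: "j \<le> hits" "Suc j \<le> hits" using assms by auto
  obtain u \<epsilon> where u: "0 < \<epsilon>" "\<And>h. 0 < h \<Longrightarrow> h < \<epsilon> \<Longrightarrow>
      f (hit j + h) = f (hit j) + of_real h * (dir (lab j) / cnj (dir (lab j)) * cnj u)"
    using impact[OF j(1)] by metis
  obtain w \<delta> where w: "0 < \<delta>" "\<And>h. 0 < h \<Longrightarrow> h < \<delta> \<Longrightarrow> f (hit (Suc j) - h) = f (hit (Suc j)) - of_real h * w"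
    using impact[OF j(2)] by metis
  show ?thesis
    by (rule piece_aux(3)[OF assms(1) u w assms(2)])
qed

lemma slope_nonzero: "j < hits \<Longrightarrow> slope j \<noteq> 0"
proof -
  assume "j < hits"
  then have j: "j < hits" "j \<le> hits" "Suc j \<le> hits" by auto
  obtain u \<epsilon> where u: "0 < \<epsilon>" "\<And>h. 0 < h \<Longrightarrow> h < \<epsilon> \<Longrightarrow>
      f (hit j + h) = f (hit j) + of_real h * (dir (lab j) / cnj (dir (lab j)) * cnj u)"
    using impact[OF j(2)] by metis
  obtain w \<delta> where w: "w \<noteq> 0" "0 < \<delta>"
    "\<And>h. 0 < h \<Longrightarrow> h < \<delta> \<Longrightarrow> f (hit (Suc j) - h) = f (hit (Suc j)) - of_real h * w"
    using impact[OF j(3)] by metis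
  show ?thesis
    using piece_aux(2)[OF j(1) u w(2,3)] w(1) by simp
qed

lemma slope_reflect:
  assumes "Suc j < hits"
  shows "slope (Suc j) = dir (lab (Suc j)) / cnj (dir (lab (Suc j))) * cnj (slope j)"
proof -
  have j: "j < hits" "j \<le> hits" "Suc j \<le> hits" "Suc (Suc j) \<le> hits" using assms by auto
  obtain u \<epsilon> where u: "0 < \<epsilon>" "\<And>h. 0 < h \<Longrightarrow> h < \<epsilon> \<Longrightarrow>
      f (hit j + h) = f (hit j) + of_real h * (dir (lab j) / cnj (dir (lab j)) * cnj u)"
    using impact[OF j(2)] by metis
  obtain w \<delta> where w: "0 < \<delta>"
    "\<And>h. 0 < h \<Longrightarrow> h < \<delta> \<Longrightarrow> f (hit (Suc j) - h) = f (hit (Suc j)) - of_real h * w"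
    "\<And>h. 0 < h \<Longrightarrow> h < \<delta> \<Longrightarrow>
      f (hit (Suc j) + h) = f (hit (Suc j)) + of_real h * (dir (lab (Suc j)) / cnj (dir (lab (Suc j))) * cnj w)"
    using impact[OF j(3)] by metis
  obtain w' \<delta>' where w': "0 < \<delta>'"
    "\<And>h. 0 < h \<Longrightarrow> h < \<delta>' \<Longrightarrow> f (hit (Suc (Suc j)) - h) = f (hit (Suc (Suc j))) - of_real h * w'"
    using impact[OF j(4)] by metis
  show ?thesis
    using piece_aux(2)[OF j(1) u w(1,2)] piece_aux(1)[OF assms w(1,3) w'] by simp
qed

text \<open>A strike happens at an interior point of its edge, so motion parallel to the edge stays
  on it for a while. Hence tangential strikes are impossible: no strike occurs between consecutive
  ones.\<close>

lemma parallel_in_edge: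
  assumes i: "j \<le> hits" and par: "Im (u / dir (lab j)) = 0" and "0 < X"
  shows "\<exists>x. 0 < x \<and> x < X \<and> f (hit j) + of_real x * u \<in> boundary n P"
proof -
  let ?i = "lab j" and ?p = "hit_param n P f j"
  have d: "dir ?i \<noteq> 0"
    by (rule ngon_edge_nonzero[OF ngon hit_edge(1)[OF i]])
  define r where "r = Re (u / dir ?i)"
  have "u / dir ?i = of_real r"
    using par by (simp add: r_def complex_eq_iff)
  then have u: "u = of_real r * dir ?i"
    using d by (simp add: field_simps)
  obtain x where x: "0 < x" "x < X" "0 \<le> ?p + x * r" "?p + x * r \<le> 1"
    using small_shift_in_unit_interval[OF hit_param(1,2)[OF i] assms(3)] by blast
  have "f (hit j) + of_real x * u = edge_path n P ?i (?p + x * r)"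
    unfolding hit_param(3)[OF i] u
    by (simp add: edge_path_def linepath_def scaleR_conv_of_real algebra_simps)
  also have "\<dots> \<in> edge n P ?i"
    unfolding edge_def path_image_def using x by auto
  finally show ?thesis
    using x edge_subset_boundary[OF hit_edge(1)[OF i]] by blast
qed

lemma transversal_start: "j < hits \<Longrightarrow> Im (slope j / dir (lab j)) \<noteq> 0"
proof
  assume j: "j < hits" "Im (slope j / dir (lab j)) = 0"
  have lt: "hit j < hit (Suc j)"
    by (rule hit_time_less[OF j(1)])
  obtain x where x: "0 < x" "x < hit (Suc j) - hit j" "f (hit j) + of_real x * slope j \<in> boundary n P"
    using parallel_in_edge[OF _ j(2), of "hit (Suc j) - hit j"] j(1) lt by auto
  then show False
    using no_hit_between[OF j(1), of "hit j + x"] piece[OF j(1), of "hit j + x"] by auto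
qed

lemma transversal_end: "j < hits \<Longrightarrow> Im (slope j / dir (lab (Suc j))) \<noteq> 0"
proof
  assume j: "j < hits" "Im (slope j / dir (lab (Suc j))) = 0"
  have lt: "hit j < hit (Suc j)"
    by (rule hit_time_less[OF j(1)])
  have "Im (- slope j / dir (lab (Suc j))) = 0"
    using j(2) by (simp only: minus_divide_left[symmetric] uminus_complex.sel neg_equal_0_iff_equal)
  then obtain x where x: "0 < x" "x < hit (Suc j) - hit j" "f (hit (Suc j)) + of_real x * (- slope j) \<in> boundary n P"
    using parallel_in_edge[of "Suc j" "- slope j" "hit (Suc j) - hit j"] j(1) lt by auto
  have "f (hit (Suc j)) + of_real x * (- slope j) = f (hit (Suc j) - x)"
  proof -
    have "f (hit (Suc j) - x) = f (hit j) + of_real (hit (Suc j) - x - hit j) * slope j"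
      by (rule piece[OF j(1)]) (use x in auto)
    moreover have "f (hit (Suc j)) = f (hit j) + of_real (hit (Suc j) - hit j) * slope j"
      by (rule piece[OF j(1)]) (use lt in auto)
    ultimately show ?thesis
      by (simp only:) (simp add: algebra_simps del: hit_time.simps)
  qed
  then show False
    using no_hit_between[OF j(1), of "hit (Suc j) - x"] x by auto
qed

text \<open>The reflection law says that velocity does not change in the unfolding, and adjacent
  copies agree on their common edge. The position at the next strike needs the velocity, so both are
  carried along.\<close>

lemma unfolded_start:
  "j < hits \<Longrightarrow> unfold_map n P f P j (f (hit j)) = of_real (hit j) * slope 0 \<and>
     fold_linear n lab P j (slope j) = slope 0"
proof (induction j)
  case 0
  then show ?case
    using hit_param(3)[of 0] by (simp add: fold_linear_def)
next
  case (Suc j)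
  let ?d = "dir (lab (Suc j))"
  have j: "j < hits" "Suc j \<le> hits" using Suc.prems by auto
  have d: "?d \<noteq> 0"
    by (rule ngon_edge_nonzero[OF ngon hit_edge(1)[OF j(2)]])
  have "unfold_map n P f P (Suc j) (f (hit (Suc j))) = unfold_map n P f P j (f (hit (Suc j)))"
    by (rule unfold_map_edge[OF hit_edge(2)[OF j(2)]])
  also have "\<dots> = of_real (hit (Suc j)) * slope 0"
  proof -
    have eq: "f (hit (Suc j)) = f (hit j) + of_real (hit (Suc j) - hit j) * slope j"
      using hit_time_less[OF j(1)] by (intro piece[OF j(1)]) auto
    show ?thesis
      unfolding eq unfold_map_add fold_linear_of_real using Suc.IH[OF j(1)]
      by (simp add: algebra_simps del: hit_time.simps)
  qed
  finally have "unfold_map n P f P (Suc j) (f (hit (Suc j))) = of_real (hit (Suc j)) * slope 0" .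
  moreover have "fold_linear n lab P (Suc j) (slope (Suc j)) = fold_linear n lab P j (slope j)"
    unfolding slope_reflect[OF Suc.prems] fold_linear_def using d by (simp add: Let_def)
  ultimately show ?case
    using Suc.IH[OF j(1)] by (simp del: hit_time.simps unfold_map.simps)
qed

lemma transfer_end_self: "transfer_end n P f P = slope 0"
  and unfolded_end: "j \<le> hits \<Longrightarrow> unfold_map n P f P j (f (hit j)) = of_real (hit j) * slope 0"
proof -
  show *: "unfold_map n P f P j (f (hit j)) = of_real (hit j) * slope 0" if j: "j \<le> hits" for j
  proof (cases "j < hits")
    case True
    then show ?thesis using unfolded_start by blast
  next
    case False
    \<comment> \<open>The last strike has no slope of its own in this period, so it is reached
      through the preceding copy.\<close>
    then obtain k where k: "j = Suc k" "k < hits"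
      using j hits by (cases j) auto
    have "unfold_map n P f P (Suc k) (f (hit (Suc k))) = unfold_map n P f P k (f (hit (Suc k)))"
      using j k by (intro unfold_map_edge hit_edge(2)) auto
    also have "\<dots> = of_real (hit (Suc k)) * slope 0"
    proof -
      have eq: "f (hit (Suc k)) = f (hit k) + of_real (hit (Suc k) - hit k) * slope k"
        using hit_time_less[OF k(2)] by (intro piece[OF k(2)]) auto
      show ?thesis
        unfolding eq unfold_map_add fold_linear_of_real using unfolded_start[OF k(2)]
        by (simp add: algebra_simps del: hit_time.simps)
    qed
    finally show ?thesis
      using k by simp
  qed
  show "transfer_end n P f P = slope 0"
    using *[of hits] hit_param(3)[of hits] by (simp add: transfer_end_def Let_def hit_time_last)
qed

lemma open_segment_inside:
  assumes "j < hits"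
  shows "open_segment (f (hit j)) (f (hit (Suc j))) \<subseteq> inside (boundary n P)"
proof
  fix z assume "z \<in> open_segment (f (hit j)) (f (hit (Suc j)))"
  then obtain t where t: "0 < t" "t < 1" "z = (1 - t) *\<^sub>R f (hit j) + t *\<^sub>R f (hit (Suc j))"
    by (auto simp: in_segment)
  have lt: "hit j < hit (Suc j)"
    by (rule hit_time_less[OF assms])
  let ?s = "hit j + t * (hit (Suc j) - hit j)"
  have s: "hit j < ?s" "?s < hit (Suc j)"
  proof -
    have "0 < t * (hit (Suc j) - hit j)" "t * (hit (Suc j) - hit j) < 1 * (hit (Suc j) - hit j)"
      using t lt by (intro mult_pos_pos mult_strict_right_mono; simp)+
    then show "hit j < ?s" "?s < hit (Suc j)"
      by (simp_all del: hit_time.simps)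
  qed
  have "z = f ?s"
  proof -
    have eq1: "f ?s = f (hit j) + of_real (?s - hit j) * slope j"
      by (rule piece[OF assms]) (use s in auto)
    have eq2: "f (hit (Suc j)) = f (hit j) + of_real (hit (Suc j) - hit j) * slope j"
      by (rule piece[OF assms]) (use lt in auto)
    show ?thesis
      unfolding t(3) eq1 eq2 by (simp add: scaleR_conv_of_real algebra_simps del: hit_time.simps)
  qed
  then show "z \<in> inside (boundary n P)"
    using no_hit_between[OF assms s] f_in_region[of ?s] by (auto simp: region_def)
qed

end

section \<open>Polygons near a given polygon\<close>

text \<open>The neighbourhood filter of \<open>P\<close> in its first \<open>n\<close> coordinates:
  finitely many conditions, each valid near \<open>P\<close>, are then valid together.\<close>

definition near :: "nat \<Rightarrow> (nat \<Rightarrow> complex) \<Rightarrow> (nat \<Rightarrow> complex) filter" where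
  "near n P = (INF \<delta>\<in>{0<..}. principal {Q. \<forall>i<n. dist (Q i) (P i) < \<delta>})"

lemma eventually_near:
  "eventually \<Phi> (near n P) \<longleftrightarrow> (\<exists>\<delta>>0. \<forall>Q. (\<forall>i<n. dist (Q i) (P i) < \<delta>) \<longrightarrow> \<Phi> Q)"
proof -
  have "eventually \<Phi> (near n P) \<longleftrightarrow>
      (\<exists>\<delta>\<in>{0<..}. eventually \<Phi> (principal {Q. \<forall>i<n. dist (Q i) (P i) < \<delta>}))"
    unfolding near_def
  proof (rule eventually_INF_base)
    fix a b :: real assume "a \<in> {0<..}" "b \<in> {0<..}"
    then show "\<exists>x\<in>{0<..}. principal {Q. \<forall>i<n. dist (Q i) (P i) < x}
        \<le> inf (principal {Q. \<forall>i<n. dist (Q i) (P i) < a}) (principal {Q. \<forall>i<n. dist (Q i) (P i) < b})"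
      by (intro bexI[of _ "min a b"]) auto
  qed auto
  then show ?thesis
    by (auto simp: eventually_principal)
qed

lemma tendsto_near [tendsto_intros]: "i < n \<Longrightarrow> ((\<lambda>Q. Q i) \<longlongrightarrow> P i) (near n P)"
  unfolding tendsto_iff eventually_near by blast

lemma dist_linepath_le:
  assumes "0 \<le> t" "t \<le> 1" "dist a a' \<le> r" "dist b b' \<le> r"
  shows "dist (linepath a b t) (linepath a' b' t) \<le> r"
proof -
  have "linepath a b t - linepath a' b' t = (1 - t) *\<^sub>R (a - a') + t *\<^sub>R (b - b')"
    by (simp add: linepath_def algebra_simps)
  then have "dist (linepath a b t) (linepath a' b' t) \<le> (1 - t) * dist a a' + t * dist b b'"
    using assms(1,2) norm_triangle_ineq[of "(1 - t) *\<^sub>R (a - a')" "t *\<^sub>R (b - b')"]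
    by (simp add: dist_norm)
  also have "\<dots> \<le> (1 - t) * r + t * r"
    using assms by (intro add_mono mult_left_mono) auto
  finally show ?thesis by (simp add: algebra_simps)
qed

text \<open>Disjoint segments have a positive distance \<open>r\<close>. If all ends move by less
  than \<open>r / 2\<close>, corresponding points do too, and the segments cannot come to
  meet.\<close>

lemma eventually_segments_disjoint:
  fixes a b c d :: "'q \<Rightarrow> complex"
  assumes lim: "(a \<longlongrightarrow> A) F" "(b \<longlongrightarrow> B) F" "(c \<longlongrightarrow> C) F" "(d \<longlongrightarrow> D) F"
    and disj: "closed_segment A B \<inter> closed_segment C D = {}"
  shows "\<forall>\<^sub>F Q in F. closed_segment (a Q) (b Q) \<inter> closed_segment (c Q) (d Q) = {}"
proof -
  obtain r where r: "r > 0" "\<And>x y. x \<in> closed_segment A B \<Longrightarrow> y \<in> closed_segment C D \<Longrightarrow> r \<le> dist x y"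
    using separate_compact_closed[of "closed_segment A B" "closed_segment C D"] disj by auto
  have "\<forall>\<^sub>F Q in F. dist (a Q) A < r / 2 \<and> dist (b Q) B < r / 2 \<and> dist (c Q) C < r / 2 \<and> dist (d Q) D < r / 2"
    using r(1) lim by (intro eventually_conj tendstoD) auto
  then show ?thesis
  proof eventually_elim
    case (elim Q)
    show ?case
    proof (rule ccontr)
      assume "\<not> ?thesis"
      then obtain z where z: "z \<in> closed_segment (a Q) (b Q)" "z \<in> closed_segment (c Q) (d Q)" by blast
      obtain s t where st: "s \<in> {0..1}" "t \<in> {0..1}" "z = linepath (a Q) (b Q) s" "z = linepath (c Q) (d Q) t"
        using z unfolding linepath_image_01[symmetric] by blast
      have "linepath A B s \<in> closed_segment A B" "linepath C D t \<in> closed_segment C D"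
        using st by (auto simp: linepath_in_path)
      then have "r \<le> dist (linepath A B s) (linepath C D t)"
        by (rule r(2))
      \<comment> \<open>\<open>dist_linepath_le\<close> gives weak bounds; taking the largest of the
        four displacements keeps the strict inequality.\<close>
      moreover obtain q where q: "q < r / 2" "dist (a Q) A \<le> q" "dist (b Q) B \<le> q" "dist (c Q) C \<le> q" "dist (d Q) D \<le> q"
      proof
        let ?q = "max (max (dist (a Q) A) (dist (b Q) B)) (max (dist (c Q) C) (dist (d Q) D))"
        show "?q < r / 2" using elim by auto
      qed auto
      have "dist z (linepath A B s) \<le> q" "dist z (linepath C D t) \<le> q"
        unfolding st(3) by (rule dist_linepath_le; use st q in auto) (unfold st(3)[symmetric] st(4), rule dist_linepath_le; use st q in auto)
      ultimately show False
        using dist_triangle2[of "linepath A B s" "linepath C D t" z] q(1) by (simp add: dist_commute)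
    qed
  qed
qed

text \<open>If the two edges at a vertex pointed in the same direction from it, they would overlap
  there.\<close>

lemma ngon_turn:
  assumes "ngon n P" "i < n" "k = Suc i mod n"
  shows "(P (Suc k mod n) - P k) / (P i - P k) \<notin> \<real>\<^sub>\<ge>\<^sub>0"
proof
  let ?a = "P i - P k" and ?b = "P (Suc k mod n) - P k"
  have k: "k < n" "k \<noteq> i"
    using assms Suc_mod_neq[of n i] ngon_ge3[OF assms(1)] by auto
  have a: "?a \<noteq> 0" and b: "?b \<noteq> 0"
    using ngon_edge_nonzero[OF assms(1,2)] ngon_edge_nonzero[OF assms(1) k(1)] assms(3) by auto
  assume "?b / ?a \<in> \<real>\<^sub>\<ge>\<^sub>0"
  then obtain r where r: "0 \<le> r" "?b / ?a = of_real r"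
    by (metis nonneg_Reals_cases)
  then have br: "?b = of_real r * ?a"
    using a by (simp add: field_simps)
  then have rpos: "0 < r"
    using b r(1) by (cases "r = 0") auto
  \<comment> \<open>The point at fraction \<open>s\<close> of one edge, measured from the common
    vertex, is at fraction \<open>s / r\<close> of the other; this choice makes both at most
    1/2.\<close>
  define s where "s = min r 1 / 2"
  have s: "0 < s" "s < 1" "s / r \<le> 1" "0 < s / r"
    using rpos by (auto simp: s_def min_def field_simps)
  let ?z = "P k + of_real s * ?a"
  have "?z = (1 - (1 - s)) *\<^sub>R P i + (1 - s) *\<^sub>R P k"
    by (simp add: scaleR_conv_of_real algebra_simps)
  then have "?z \<in> edge n P i"
    unfolding edge_eq assms(3)[symmetric] in_segment using s
    by (intro exI[of _ "1 - s"] conjI; (assumption | simp))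
  moreover have "?z \<in> edge n P k"
  proof -
    have "?z = (1 - s / r) *\<^sub>R P k + (s / r) *\<^sub>R P (Suc k mod n)"
    proof -
      have "of_real (s / r) * ?b = of_real s * ?a"
        unfolding br using rpos by simp
      then show ?thesis
        by (simp add: scaleR_conv_of_real algebra_simps)
    qed
    then show ?thesis
      unfolding edge_eq in_segment using s by (intro exI[of _ "s / r"] conjI; (assumption | simp))
  qed
  ultimately have "?z \<in> {P i, P k}"
    using ngon_edge_Int(1)[OF assms(1,2) k(1), of ?z] k(2) assms(3) by auto
  moreover have "?z \<noteq> P k"
    using s a by simp
  moreover have "?z \<noteq> P i"
  proof
    assume "?z = P i"
    then have "(of_real s - 1) * ?a = 0"
      by (simp add: algebra_simps)
    then show False
      using s a by simp
  qed
  ultimately show False by blast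
qed

text \<open>Nonadjacent edges have a positive distance, but adjacent ones share a vertex. For these
  the quotient of directions avoids a closed half-line, which is an open condition and prevents
  overlap.\<close>

lemma eventually_ngon:
  assumes P: "ngon n P"
  shows "\<forall>\<^sub>F Q in near n P. ngon n Q"
proof -
  have n: "3 \<le> n" by (rule ngon_ge3[OF P])
  have "\<forall>\<^sub>F Q in near n P. Q i \<noteq> Q j" if "i < n" "j < n" "i \<noteq> j" for i j
  proof -
    have "((\<lambda>Q. Q i - Q j) \<longlongrightarrow> P i - P j) (near n P)"
      using that by (intro tendsto_intros)
    moreover have "P i - P j \<noteq> 0"
      using ngon_vertex_eq[OF P] that by auto
    ultimately show ?thesis
      by (rule eventually_mono[OF tendsto_imp_eventually_ne]) auto
  qed
  then have ev1: "\<forall>\<^sub>F Q in near n P. \<forall>i\<in>{..<n}. \<forall>j\<in>{..<n} - {i}. Q i \<noteq> Q j"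
    by (intro eventually_ball_finite ballI) auto
  have "\<forall>\<^sub>F Q in near n P. (Q (Suc (Suc i mod n) mod n) - Q (Suc i mod n)) / (Q i - Q (Suc i mod n)) \<in> - \<real>\<^sub>\<ge>\<^sub>0"
    if i: "i < n" for i
  proof (rule topological_tendstoD[OF _ _ _])
    let ?k = "Suc i mod n"
    have "P i - P ?k \<noteq> 0"
      using ngon_edge_nonzero[OF P i] by auto
    then show "((\<lambda>Q. (Q (Suc ?k mod n) - Q ?k) / (Q i - Q ?k)) \<longlongrightarrow> (P (Suc ?k mod n) - P ?k) / (P i - P ?k)) (near n P)"
      using i n by (intro tendsto_intros) auto
    show "(P (Suc ?k mod n) - P ?k) / (P i - P ?k) \<in> - \<real>\<^sub>\<ge>\<^sub>0"
      using ngon_turn[OF P i refl] by simp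
  qed auto
  then have ev2: "\<forall>\<^sub>F Q in near n P. \<forall>i\<in>{..<n}.
      (Q (Suc (Suc i mod n) mod n) - Q (Suc i mod n)) / (Q i - Q (Suc i mod n)) \<in> - \<real>\<^sub>\<ge>\<^sub>0"
    by (intro eventually_ball_finite ballI) auto
  have "\<forall>\<^sub>F Q in near n P. edge n Q i \<inter> edge n Q j = {}"
    if "i < n" "j < n" "i \<noteq> j" "j \<noteq> Suc i mod n" "i \<noteq> Suc j mod n" for i j
  proof -
    have "Suc i mod n = Suc j mod n \<longleftrightarrow> i = j"
      using that n by (auto simp: mod_Suc split: if_splits)
    then have "edge n P i \<inter> edge n P j = {}"
      using ngon_edge_Int[OF P that(1-3)] that ngon_vertex_eq[OF P, of i j] n
        ngon_vertex_eq[OF P, of i "Suc j mod n"] ngon_vertex_eq[OF P, of "Suc i mod n" j]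
        ngon_vertex_eq[OF P, of "Suc i mod n" "Suc j mod n"] by fastforce
    then show ?thesis
      unfolding edge_eq using that n
      by (intro eventually_segments_disjoint[OF tendsto_near tendsto_near tendsto_near tendsto_near]) auto
  qed
  note nonadjacent = this
  have ev3: "\<forall>\<^sub>F Q in near n P. \<forall>i\<in>{..<n}. \<forall>j\<in>{..<n} - {i, Suc i mod n}.
      i \<noteq> Suc j mod n \<longrightarrow> edge n Q i \<inter> edge n Q j = {}"
  proof (intro eventually_ball_finite ballI)
    fix i j assume "i \<in> {..<n}" "j \<in> {..<n} - {i, Suc i mod n}"
    then show "\<forall>\<^sub>F Q in near n P. i \<noteq> Suc j mod n \<longrightarrow> edge n Q i \<inter> edge n Q j = {}"
      using nonadjacent[of i j] by (cases "i = Suc j mod n") auto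
  qed auto
  from ev1 ev2 ev3 show ?thesis
  proof eventually_elim
    case (elim Q)
    have adjacent: "z = Q (Suc i mod n)"
      if i: "i < n" and z: "z \<in> edge n Q i" "z \<in> edge n Q (Suc i mod n)" for i z
    proof (rule ccontr)
      let ?k = "Suc i mod n"
      assume ne: "z \<noteq> Q ?k"
      obtain s where s: "0 \<le> s" "s \<le> 1" "z = (1 - s) *\<^sub>R Q ?k + s *\<^sub>R Q i"
        using z(1) unfolding edge_eq closed_segment_commute[of "Q i"] by (auto simp: in_segment)
      obtain t where t: "0 \<le> t" "t \<le> 1" "z = (1 - t) *\<^sub>R Q ?k + t *\<^sub>R Q (Suc ?k mod n)"
        using z(2) unfolding edge_eq by (auto simp: in_segment)
      have eq: "of_real s * (Q i - Q ?k) = z - Q ?k" "of_real t * (Q (Suc ?k mod n) - Q ?k) = z - Q ?k"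
        unfolding s(3) by (simp add: scaleR_conv_of_real algebra_simps)
          (unfold s(3)[symmetric] t(3), simp add: scaleR_conv_of_real algebra_simps)
      have pos: "s \<noteq> 0" "t \<noteq> 0" "Q i - Q ?k \<noteq> 0"
        using eq ne by auto
      have "of_real t * (Q (Suc ?k mod n) - Q ?k) = of_real s * (Q i - Q ?k)"
        by (simp only: eq)
      then have "(Q (Suc ?k mod n) - Q ?k) * of_real t = of_real s * (Q i - Q ?k)"
        by (simp only: mult.commute)
      moreover have "complex_of_real t \<noteq> 0"
        using pos(2) by simp
      ultimately have "(Q (Suc ?k mod n) - Q ?k) / (Q i - Q ?k) = of_real s / of_real t"
        using frac_eq_eq[OF pos(3)] by blast
      then have "(Q (Suc ?k mod n) - Q ?k) / (Q i - Q ?k) = of_real (s / t)"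
        by simp
      moreover have "complex_of_real (s / t) \<in> \<real>\<^sub>\<ge>\<^sub>0"
        using s t by simp
      ultimately have "(Q (Suc ?k mod n) - Q ?k) / (Q i - Q ?k) \<in> \<real>\<^sub>\<ge>\<^sub>0"
        by (simp only:)
      then show False
        using bspec[OF elim(2), of i] i by simp
    qed
    have "edge n Q i \<inter> edge n Q j \<subseteq> {Q i, Q (Suc i mod n)} \<inter> {Q j, Q (Suc j mod n)}"
      if "i < n" "j < n" "i \<noteq> j" for i j
    proof -
      consider "j = Suc i mod n" | "i = Suc j mod n" | "j \<noteq> Suc i mod n" "i \<noteq> Suc j mod n" by blast
      then show ?thesis
      proof cases
        case 1 then show ?thesis using adjacent[OF that(1)] by blast
      next
        case 2 then show ?thesis using adjacent[OF that(2)] by blast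
      next
        case 3
        then have "edge n Q i \<inter> edge n Q j = {}"
          using elim(3) that by simp
        then show ?thesis by simp
      qed
    qed
    moreover have "inj_on Q {..<n}"
      using elim(1) by (auto simp: inj_on_def)
    ultimately show ?case
      using n by (simp add: ngon_def)
  qed
qed

lemma dist_polygon_arc_le:
  assumes "\<And>i. i \<le> Suc k \<Longrightarrow> dist (Q i) (P i) \<le> r" "t \<in> {0..1}"
  shows "dist (polygon_arc Q k t) (polygon_arc P k t) \<le> r"
  using assms
proof (induction k arbitrary: t)
  case 0
  then show ?case by (auto intro!: dist_linepath_le)
next
  case (Suc k)
  show ?case
  proof (cases "t \<le> 1 / 2")
    case True
    then show ?thesis
      using Suc.IH[of "2 * t"] Suc.prems by (auto simp: joinpaths_def)
  next
    case False
    then show ?thesis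
      using Suc.prems by (auto simp: joinpaths_def intro!: dist_linepath_le)
  qed
qed

lemma dist_polygon_loop_le:
  assumes "3 \<le> n" "\<And>i. i < n \<Longrightarrow> dist (Q i) (P i) \<le> r" "t \<in> {0..1}"
  shows "dist (polygon_loop n Q t) (polygon_loop n P t) \<le> r"
proof (cases "t \<le> 1 / 2")
  case True
  then show ?thesis
    using dist_polygon_arc_le[of "n - 2" Q P r "2 * t"] assms by (auto simp: polygon_loop_def joinpaths_def)
next
  case False
  then show ?thesis
    using assms by (auto simp: polygon_loop_def joinpaths_def intro!: dist_linepath_le)
qed

text \<open>Inside points are those with nonzero winding number, and the winding number is unchanged
  under small perturbations of the loop and of the point.\<close>

lemma eventually_inside:
  assumes P: "ngon n P" and w: "(w \<longlongrightarrow> z) (near n P)" and z: "z \<in> inside (boundary n P)"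
  shows "\<forall>\<^sub>F Q in near n P. w Q \<in> inside (boundary n Q)"
proof -
  have n: "3 \<le> n" by (rule ngon_ge3[OF P])
  let ?g = "polygon_loop n P"
  have img: "path_image ?g = boundary n P"
    by (rule path_image_polygon_loop[OF n])
  have z': "z \<notin> path_image ?g"
    using z inside_no_overlap[of "boundary n P"] img by blast
  have nz: "winding_number ?g z \<noteq> 0"
  proof -
    have in_z: "z \<in> inside (path_image ?g)"
      using z img by simp
    show ?thesis
      by (rule simple_closed_path_winding_number_inside[OF simple_path_polygon_loop[OF P]])
        (use in_z in auto)
  qed
  have "compact (path_image ?g)" "path_image ?g \<noteq> {}"
    using path_polygon_loop[OF n] by (auto simp: compact_path_image)
  then have inf: "0 < infdist z (path_image ?g)"
    using z' infdist_pos_not_in_closed compact_imp_closed by blast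
  \<comment> \<open>Half of the distance: moving the vertices and moving the point each use up one
    half.\<close>
  define r where "r = infdist z (path_image ?g) / 2"
  have r: "0 < r" using inf by (simp add: r_def)
  have far: "2 * r \<le> cmod (?g t - z)" if "t \<in> {0..1}" for t
    using that infdist_le[of "?g t" "path_image ?g" z]
    by (simp add: r_def dist_norm norm_minus_commute path_image_def)
  have "\<forall>\<^sub>F Q in near n P. dist (w Q) z < r \<and> (\<forall>i\<in>{..<n}. dist (Q i) (P i) < r)"
    using r w by (intro eventually_conj eventually_ball_finite ballI tendstoD) (auto intro: tendsto_near)
  then show ?thesis
  proof eventually_elim
    case (elim Q)
    \<comment> \<open>The loop of \<open>Q\<close>, translated so that \<open>w Q\<close> goes to
      \<open>z\<close>; both loops can then be compared around the same point.\<close>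
    define h where "h t = polygon_loop n Q t + (z - w Q)" for t
    have h: "cmod (h t - ?g t) < 2 * r" if "t \<in> {0..1}" for t
    proof -
      have "dist (polygon_loop n Q t) (?g t) \<le> r"
        using elim by (intro dist_polygon_loop_le[OF n _ that]) (auto intro: less_imp_le)
      moreover have eq: "h t - ?g t = (polygon_loop n Q t - ?g t) + (z - w Q)"
        by (simp add: h_def)
      moreover have "cmod (h t - ?g t) \<le> cmod (polygon_loop n Q t - ?g t) + cmod (z - w Q)"
        unfolding eq by (rule norm_triangle_ineq)
      moreover have "cmod (z - w Q) < r"
        using elim by (simp add: dist_norm norm_minus_commute)
      ultimately show ?thesis
        unfolding dist_norm by linarith
    qed
    have "winding_number h z = winding_number ?g z"
    proof (rule winding_number_nearby_loops_eq)
      show "path ?g" by (rule path_polygon_loop[OF n])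
      show "path h"
        using path_polygon_loop[OF n, of Q] unfolding h_def path_def by (intro continuous_intros)
      show "pathfinish h = pathstart h"
        using pathfinish_polygon_loop[of n Q] pathstart_polygon_loop[of n Q]
        by (simp add: h_def pathfinish_def pathstart_def)
      show "cmod (h t - ?g t) < cmod (?g t - z)" if "t \<in> {0..1}" for t
        using h[OF that] far[OF that] by simp
    qed simp
    moreover have "winding_number h z = winding_number (polygon_loop n Q) (w Q)"
      using winding_number_offset[of h z] winding_number_offset[of "polygon_loop n Q" "w Q"]
      by (simp add: h_def algebra_simps)
    ultimately have "winding_number (polygon_loop n Q) (w Q) \<noteq> 0"
      using nz by simp
    moreover have "w Q \<notin> path_image (polygon_loop n Q)"
    proof
      assume "w Q \<in> path_image (polygon_loop n Q)"
      then obtain t where t: "t \<in> {0..1}" "w Q = polygon_loop n Q t"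
        by (auto simp: path_image_def)
      then have "cmod (z - ?g t) < 2 * r"
        using h[OF t(1)] by (simp add: h_def)
      then show False
        using far[OF t(1)] by (simp add: norm_minus_commute)
    qed
    ultimately have "w Q \<notin> outside (path_image (polygon_loop n Q))"
      using winding_number_zero_in_outside[of "polygon_loop n Q"] path_polygon_loop[OF n] by auto
    then show ?case
      using \<open>w Q \<notin> path_image (polygon_loop n Q)\<close> path_image_polygon_loop[OF n, of Q]
        inside_Un_outside[of "boundary n Q"] by (metis ComplI UnE)
  qed
qed

section \<open>Stability forces vanishing crossing numbers\<close>

text \<open>The derivative of the imaginary part in direction \<open>h\<close> is
  \<open>Im (D * h)\<close>; the directions 1 and \<i> recover both parts of
  \<open>D\<close>.\<close>

lemma real_valued_derivative_eq_0:
  assumes "(F has_field_derivative D) (at z)" "\<forall>\<^sub>F w in nhds z. Im (F w) = 0"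
  shows "D = (0 :: complex)"
proof -
  have "((\<lambda>w. Im (F w)) has_derivative (\<lambda>h. Im (D * h))) (at z)"
    using assms(1) unfolding has_field_derivative_def by (rule has_derivative_Im)
  moreover have "((\<lambda>w. Im (F w)) has_derivative (\<lambda>h. 0)) (at z)"
  proof (rule has_derivative_transform_eventually[of "\<lambda>_. 0"])
    show "\<forall>\<^sub>F w in at z. 0 = Im (F w)"
      using eventually_nhds_x_imp_x[OF assms(2)] assms(2)
      by (auto simp: eventually_at_filter elim: eventually_mono)
    show "0 = Im (F z)"
      using eventually_nhds_x_imp_x[OF assms(2)] by simp
  qed auto
  ultimately have "(\<lambda>h. Im (D * h)) = (\<lambda>h. 0)"
    by (rule has_derivative_unique)
  then have "Im (D * 1) = 0" "Im (D * \<i>) = 0"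
    by metis+
  then show ?thesis
    by (simp add: complex_eq_iff)
qed

text \<open>
  If the common ratio is nonzero, all vertices lie on one line, and the two edges at an
  extreme vertex overlap.
\<close>

lemma balanced_edges_trivial:
  fixes N :: "nat \<Rightarrow> int"
  assumes ngon: "ngon n P"
    and bal: "\<And>i. i < n \<Longrightarrow> of_int (N (Suc i mod n)) / (P (Suc (Suc i mod n) mod n) - P (Suc i mod n))
      = of_int (N i) / (P (Suc i mod n) - P i)"
    and i: "i < n"
  shows "N i = 0"
proof (rule ccontr)
  assume Ni: "N i \<noteq> 0"
  let ?d = "\<lambda>i. P (Suc i mod n) - P i"
  define c where "c = of_int (N 0) / ?d 0"
  have n: "3 \<le> n" by (rule ngon_ge3[OF ngon])
  have c: "of_int (N j) / ?d j = c" if "j < n" for j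
    using that
  proof (induction j)
    case (Suc j)
    then show ?case using bal[of j] by simp
  qed (simp add: c_def)
  have nz: "?d j \<noteq> 0" if "j < n" for j
    by (rule ngon_edge_nonzero[OF ngon that])
  have c0: "c \<noteq> 0"
    using c[OF i] nz[OF i] Ni by auto
  have d: "?d j = of_int (N j) / c" if "j < n" for j
    using c[OF that] nz[OF that] c0 by (auto simp: field_simps)
  \<comment> \<open>Every edge is an integer multiple of \<open>1 / c\<close>, so the partial sums
    are integer coordinates of the vertices along one line.\<close>
  define X where "X j = (\<Sum>l<j. N l)" for j
  have X: "P j = P 0 + of_int (X j) / c" if "j < n" for j
    using that
  proof (induction j)
    case (Suc j)
    then show ?case
      using d[of j] by (simp add: X_def add_divide_distrib algebra_simps)
  qed (simp add: X_def)
  have "Max (X ` {..<n}) \<in> X ` {..<n}"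
    using n by (intro Max_in) (auto simp: lessThan_empty_iff)
  then obtain k where k: "k < n" "X k = Max (X ` {..<n})"
    by auto
  have max: "X j \<le> X k" if "j < n" for j
    unfolding k(2) using that by (intro Max_ge) auto
  obtain p where p: "p < n" "Suc p mod n = k"
    using that[of "n - 1"] that[of "k - 1"] k n by (cases "k = 0") auto
  let ?q = "Suc k mod n"
  have q: "?q < n" using n by simp
  have diff: "P a - P k = of_real (of_int (X a - X k)) / c" if "a < n" for a
    using X[OF that] X[OF k(1)] by (simp add: diff_divide_distrib)
  have "(P ?q - P k) / (P p - P k) = of_real (of_int (X ?q - X k)) / of_real (of_int (X p - X k))"
    unfolding diff[OF q] diff[OF p(1)] using c0 by simp
  also have "\<dots> = of_real (of_int (X k - X ?q) / of_int (X k - X p))"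
  proof -
    have "(of_int (X ?q - X k) :: real) / of_int (X p - X k) = of_int (X k - X ?q) / of_int (X k - X p)"
      using minus_divide_divide[of "of_int (X k - X ?q) :: real" "of_int (X k - X p)"] by simp
    then show ?thesis
      by (simp only: of_real_divide[symmetric])
  qed
  also have "\<dots> \<in> \<real>\<^sub>\<ge>\<^sub>0"
    unfolding nonneg_Reals_of_real_iff using max[OF q] max[OF p(1)]
    by (intro divide_nonneg_nonneg) simp_all
  finally have "(P ?q - P k) / (P p - P k) \<in> \<real>\<^sub>\<ge>\<^sub>0" .
  with ngon_turn[OF ngon p(1) p(2)[symmetric]] show False
    by (rule notE)
qed

lemma has_field_derivative_powi_product:
  fixes a b z :: complex and M N :: int
  assumes "z - a \<noteq> 0" "b - z \<noteq> 0"
  shows "((\<lambda>z. C * ((z - a) powi M * (b - z) powi N)) has_field_derivative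
    C * ((z - a) powi M * (b - z) powi N) * (of_int M / (z - a) - of_int N / (b - z))) (at z)"
  using assms
  by (auto intro!: derivative_eq_intros simp: power_int_diff field_simps)

context periodic_billiard
begin

lemma stable_imp_translate: "stable n P f \<Longrightarrow> \<forall>\<^sub>F Q in near n P. ends_translate n P f Q"
proof -
  assume "stable n P f"
  then have "\<forall>\<^sub>F Q in near n P. ngon n Q \<longrightarrow> ends_translate n P f Q"
    unfolding stable_def eventually_near transferred_trajectory_def transferred_path_def by meson
  with eventually_ngon[OF ngon] show ?thesis
    by eventually_elim simp
qed

text \<open>A quotient \<open>w / cnj w\<close> equals 1 exactly if \<open>w\<close> is real. This
  removes the conjugates and leaves an expression that is holomorphic in each vertex.\<close>

lemma translate_real_product:
  assumes "ngon n Q" "ends_translate n P f Q"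
  shows "Im (\<Prod>i<n. (Q (Suc i mod n) - Q i) powi (- crossing_number lab hits i)) = 0"
proof -
  let ?W = "\<Prod>i<n. (Q (Suc i mod n) - Q i) powi (- crossing_number lab hits i)"
  have nz: "Q (Suc i mod n) - Q i \<noteq> 0" if "i < n" for i
    by (rule ngon_edge_nonzero[OF assms(1) that])
  then have W: "?W \<noteq> 0"
    by simp
  have "1 = fold_coeff n lab Q hits"
    using assms(2) by (simp add: ends_translate_iff)
  also have "\<dots> = (\<Prod>i<n. ((Q (Suc i mod n) - Q i) / cnj (Q (Suc i mod n) - Q i)) powi (- crossing_number lab hits i))"
    using nz hit_edge(1) by (intro fold_coeff_eq_prod) auto
  also have "\<dots> = ?W / cnj ?W"
    by (simp only: power_int_divide_distrib prod_dividef cnj_prod complex_cnj_power_int)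
  finally have "?W = cnj ?W"
    using W by (simp add: field_simps)
  then show ?thesis
    by (metis Im_complex_of_real complex_cnj_cancel_iff Reals_cnj_iff complex_is_Real_iff)
qed

text \<open>Only the vertex \<open>k\<close> is moved. It occurs in the two edges \<open>p\<close>
  and \<open>k\<close> alone, so the logarithmic derivative of the product has just two terms, and
  these must cancel.\<close>

lemma stable_imp_balanced:
  assumes "stable n P f" and p: "p < n" "k = Suc p mod n"
  shows "of_int (- crossing_number lab hits k) / dir k = of_int (- crossing_number lab hits p) / dir p"
proof -
  let ?N = "\<lambda>i. - crossing_number lab hits i"
  let ?q = "Suc k mod n"
  let ?W = "\<lambda>Q. \<Prod>i<n. (Q (Suc i mod n) - Q i) powi ?N i"
  have n: "3 \<le> n" by (rule ngon_ge3[OF ngon])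
  have k: "k < n" "k \<noteq> p" "?q \<noteq> k" "?q < n"
    using p n Suc_mod_neq[of n p] Suc_mod_neq[of n k] by auto
  define C where "C = (\<Prod>i\<in>{..<n} - {p, k}. dir i powi ?N i)"
  have W: "?W (P(k := z)) = C * ((z - P p) powi ?N p * (P ?q - z) powi ?N k)" for z
  proof -
    have "?W (P(k := z)) = (\<Prod>i\<in>{..<n} - {p, k}. ((P(k := z)) (Suc i mod n) - (P(k := z)) i) powi ?N i) *
        (\<Prod>i\<in>{p, k}. ((P(k := z)) (Suc i mod n) - (P(k := z)) i) powi ?N i)"
      using p k by (intro prod.subset_diff) auto
    also have "(\<Prod>i\<in>{..<n} - {p, k}. ((P(k := z)) (Suc i mod n) - (P(k := z)) i) powi ?N i) = C"
      unfolding C_def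
    proof (intro prod.cong refl)
      fix i assume i: "i \<in> {..<n} - {p, k}"
      then have "Suc i mod n \<noteq> k"
        using p n by (auto simp: mod_Suc split: if_splits)
      then show "((P(k := z)) (Suc i mod n) - (P(k := z)) i) powi ?N i = dir i powi ?N i"
        using i by simp
    qed
    also have "(\<Prod>i\<in>{p, k}. ((P(k := z)) (Suc i mod n) - (P(k := z)) i) powi ?N i)
        = (z - P p) powi ?N p * (P ?q - z) powi ?N k"
      using k p by simp
    finally show ?thesis .
  qed
  have "\<forall>\<^sub>F Q in near n P. Im (?W Q) = 0"
    using eventually_ngon[OF ngon] stable_imp_translate[OF assms(1)]
    by eventually_elim (rule translate_real_product)
  then obtain \<delta> where \<delta>: "0 < \<delta>" "\<And>Q. (\<And>i. i < n \<Longrightarrow> dist (Q i) (P i) < \<delta>) \<Longrightarrow> Im (?W Q) = 0"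
    unfolding eventually_near by blast
  have "Im (?W (P(k := z))) = 0" if "dist z (P k) < \<delta>" for z
    by (rule \<delta>(2)) (use that \<delta>(1) in auto)
  then have real: "\<forall>\<^sub>F z in nhds (P k). Im (C * ((z - P p) powi ?N p * (P ?q - z) powi ?N k)) = 0"
    unfolding W[symmetric] eventually_nhds_metric using \<delta>(1) by blast
  have nz: "P k - P p \<noteq> 0" "P ?q - P k \<noteq> 0"
    using ngon_edge_nonzero[OF ngon p(1)] ngon_edge_nonzero[OF ngon k(1)] p(2) by auto
  have C0: "C \<noteq> 0"
    unfolding C_def using ngon_edge_nonzero[OF ngon] by (simp add: power_int_eq_0_iff)
  have "C * ((P k - P p) powi ?N p * (P ?q - P k) powi ?N k)
      * (of_int (?N p) / (P k - P p) - of_int (?N k) / (P ?q - P k)) = 0"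
    by (rule real_valued_derivative_eq_0[OF has_field_derivative_powi_product[OF nz] real])
  then have "of_int (?N p) / (P k - P p) - of_int (?N k) / (P ?q - P k) = 0"
    using C0 nz by (simp add: power_int_eq_0_iff del: of_int_minus)
  then show ?thesis
    unfolding p(2)[symmetric] by simp
qed

lemma stable_imp_crossing_number:
  assumes "stable n P f" "i < n"
  shows "crossing_number lab hits i = 0"
proof -
  have "- crossing_number lab hits i = 0"
    by (rule balanced_edges_trivial[OF ngon _ assms(2)]) (rule stable_imp_balanced[OF assms(1) _ refl])
  then show ?thesis by simp
qed

end

section \<open>Persistence of chords under small perturbations\<close>

lemma edge_path_interior:
  assumes "ngon n v" "i < n" "0 < t" "t < 1"
  shows "edge_path n v i t \<in> edge n v i - vertices n v"
  unfolding edge_minus_vertices[OF assms(1,2)]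
  using assms ngon_edge_nonzero[OF assms(1,2)]
  by (auto simp: in_segment edge_path_def linepath_def intro!: exI[of _ t])

lemma tendsto_edge_path:
  assumes "i < n" "(r \<longlongrightarrow> a) (near n P)"
  shows "((\<lambda>Q. edge_path n Q i (r Q)) \<longlongrightarrow> edge_path n P i a) (near n P)"
  unfolding edge_path_def linepath_def
  by (intro tendsto_intros assms) (use assms in auto)

text \<open>A segment transversal to the edges at its ends meets their lines only there. With the
  other edges excluded, the open segment misses the boundary, and its midpoint decides on which side
  it lies.\<close>

lemma closed_segment_in_region:
  assumes ngon: "ngon n v" and i: "i < n" and k: "k < n"
    and x: "x \<in> edge n v i - vertices n v" and y: "y \<in> edge n v k - vertices n v"
    and trans: "Im ((y - x) / (v (Suc i mod n) - v i)) \<noteq> 0" "Im ((y - x) / (v (Suc k mod n) - v k)) \<noteq> 0"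
    and disj: "\<And>l. l < n \<Longrightarrow> l \<noteq> i \<Longrightarrow> l \<noteq> k \<Longrightarrow> closed_segment x y \<inter> edge n v l = {}"
    and mid: "midpoint x y \<in> inside (boundary n v)"
  shows "closed_segment x y \<subseteq> region n v - vertices n v"
proof -
  have side: "edge_side n v l z - edge_side n v l w = Im ((z - w) / (v (Suc l mod n) - v l))" for l z w
    by (simp add: edge_side_def diff_divide_distrib)
  have "open_segment x y \<inter> edge n v l = {}" if l: "l < n" for l
  proof (rule ccontr)
    assume "\<not> ?thesis"
    then obtain z where z: "z \<in> open_segment x y" "z \<in> edge n v l" by blast
    then obtain t where t: "0 < t" "t < 1" "z = (1 - t) *\<^sub>R x + t *\<^sub>R y"
      by (auto simp: in_segment)
    have zx: "z - x = of_real t * (y - x)" and zy: "z - y = of_real (t - 1) * (y - x)"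
      by (simp_all add: t(3) scaleR_conv_of_real algebra_simps)
    consider "l = i" | "l = k" | "l \<noteq> i" "l \<noteq> k" by blast
    then show False
    proof cases
      case 1
      then have "Im ((z - x) / (v (Suc i mod n) - v i)) = 0"
        using side[of i z x] z(2) x by (simp add: edge_side_edge)
      then have "t * Im ((y - x) / (v (Suc i mod n) - v i)) = 0"
        unfolding zx times_divide_eq_right[symmetric] by (simp del: times_divide_eq_right)
      then show False using t trans(1) by simp
    next
      case 2
      then have "Im ((z - y) / (v (Suc k mod n) - v k)) = 0"
        using side[of k z y] z(2) y by (simp add: edge_side_edge)
      then have "(t - 1) * Im ((y - x) / (v (Suc k mod n) - v k)) = 0"
        unfolding zy times_divide_eq_right[symmetric] by (simp del: times_divide_eq_right of_real_diff)
      then show False using t trans(2) by simp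
    next
      case 3
      then show False
        using disj[OF l] z open_closed_segment by blast
    qed
  qed
  then have "open_segment x y \<inter> boundary n v = {}"
    by (auto simp: boundary_def)
  then have "open_segment x y \<subseteq> inside (boundary n v) \<or> open_segment x y \<subseteq> outside (boundary n v)"
    by (intro connected_inside_or_outside convex_connected) (auto simp: compact_imp_closed compact_boundary)
  moreover have "midpoint x y \<in> open_segment x y"
    using trans by auto
  ultimately have "open_segment x y \<subseteq> inside (boundary n v)"
    using mid inside_Int_outside[of "boundary n v"] by blast
  moreover have "inside (boundary n v) \<subseteq> region n v - vertices n v"
    using vertices_subset_boundary[of n v] inside_no_overlap[of "boundary n v"]
    unfolding region_def by blast
  moreover have "x \<in> region n v - vertices n v" "y \<in> region n v - vertices n v"
    using x y edge_subset_boundary[OF i, of v] edge_subset_boundary[OF k, of v] unfolding region_def by blast+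
  ultimately show ?thesis
    unfolding closed_segment_eq_open by blast
qed

text \<open>Every hypothesis of \<open>closed_segment_in_region\<close> is an open condition that
  holds for the chord of \<open>P\<close>.\<close>

lemma eventually_segment_in_region:
  assumes ngon: "ngon n P" and i: "i < n" and k: "k < n"
    and a: "0 < a" "a < 1" and b: "0 < b" "b < 1"
    and seg: "open_segment (edge_path n P i a) (edge_path n P k b) \<subseteq> inside (boundary n P)"
    and trans: "Im ((edge_path n P k b - edge_path n P i a) / (P (Suc i mod n) - P i)) \<noteq> 0"
      "Im ((edge_path n P k b - edge_path n P i a) / (P (Suc k mod n) - P k)) \<noteq> 0"
    and r: "(r \<longlongrightarrow> a) (near n P)" and r': "(r' \<longlongrightarrow> b) (near n P)"
  shows "\<forall>\<^sub>F Q in near n P. closed_segment (edge_path n Q i (r Q)) (edge_path n Q k (r' Q))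
    \<subseteq> region n Q - vertices n Q"
proof -
  let ?x = "edge_path n P i a" and ?y = "edge_path n P k b"
  let ?X = "\<lambda>Q. edge_path n Q i (r Q)" and ?Y = "\<lambda>Q. edge_path n Q k (r' Q)"
  have n: "3 \<le> n" by (rule ngon_ge3[OF ngon])
  have X: "(?X \<longlongrightarrow> ?x) (near n P)" and Y: "(?Y \<longlongrightarrow> ?y) (near n P)"
    using tendsto_edge_path[OF i r] tendsto_edge_path[OF k r'] by auto
  have x: "?x \<in> edge n P i - vertices n P" and y: "?y \<in> edge n P k - vertices n P"
    using edge_path_interior[OF ngon i a] edge_path_interior[OF ngon k b] by auto
  have "\<forall>\<^sub>F Q in near n P. closed_segment (?X Q) (?Y Q) \<inter> edge n Q l = {}"
    if l: "l < n" "l \<noteq> i" "l \<noteq> k" for l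
  proof -
    have "?x \<notin> edge n P l" "?y \<notin> edge n P l"
      using edge_unique[OF ngon l(1) i] edge_unique[OF ngon l(1) k] x y l by blast+
    moreover have "open_segment ?x ?y \<inter> edge n P l = {}"
      using seg edge_subset_boundary[OF l(1), of P] inside_no_overlap[of "boundary n P"] by blast
    ultimately have "closed_segment ?x ?y \<inter> edge n P l = {}"
      unfolding closed_segment_eq_open by blast
    then show ?thesis
      unfolding edge_eq
      using n l by (intro eventually_segments_disjoint[OF X Y tendsto_near tendsto_near]) auto
  qed
  then have disj: "\<forall>\<^sub>F Q in near n P. \<forall>l\<in>{..<n} - {i, k}. closed_segment (?X Q) (?Y Q) \<inter> edge n Q l = {}"
    by (intro eventually_ball_finite ballI) auto
  have "\<forall>\<^sub>F Q in near n P. Im ((?Y Q - ?X Q) / (Q (Suc l mod n) - Q l)) \<noteq> 0"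
    if l: "l < n" "Im ((?y - ?x) / (P (Suc l mod n) - P l)) \<noteq> 0" for l
  proof (rule tendsto_imp_eventually_ne[OF _ l(2)])
    show "((\<lambda>Q. Im ((?Y Q - ?X Q) / (Q (Suc l mod n) - Q l))) \<longlongrightarrow> Im ((?y - ?x) / (P (Suc l mod n) - P l))) (near n P)"
      using n l by (intro tendsto_intros X Y ngon_edge_nonzero[OF ngon]) auto
  qed
  note T = this[OF i trans(1)] this[OF k trans(2)]
  have "midpoint ?x ?y \<in> open_segment ?x ?y"
    using trans by auto
  then have mid: "\<forall>\<^sub>F Q in near n P. midpoint (?X Q) (?Y Q) \<in> inside (boundary n Q)"
    using seg by (intro eventually_inside[OF ngon, of _ "midpoint ?x ?y"])
      (auto simp: midpoint_def intro!: tendsto_intros X Y)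
  have R: "\<forall>\<^sub>F Q in near n P. 0 < r Q \<and> r Q < 1 \<and> 0 < r' Q \<and> r' Q < 1"
    using order_tendstoD[OF r] order_tendstoD[OF r'] a b by (intro eventually_conj) auto
  from disj T mid R eventually_ngon[OF ngon] show ?thesis
  proof eventually_elim
    case (elim Q)
    show ?case
    proof (rule closed_segment_in_region[OF _ i k])
      show "?X Q \<in> edge n Q i - vertices n Q"
        by (rule edge_path_interior) (use elim i in auto)
      show "?Y Q \<in> edge n Q k - vertices n Q"
        by (rule edge_path_interior) (use elim k in auto)
    qed (use elim in auto)
  qed
qed

section \<open>Vanishing crossing numbers give stability\<close>

text \<open>\<open>Im (x * cnj y)\<close> is an oriented area, which an isometry preserves up to
  sign; so transversality may be tested in any copy.\<close>

lemma Im_fold_linear_mult: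
  "Im (fold_linear n e v j x * cnj (fold_linear n e v j y))
    = (cmod (fold_coeff n e v j))\<^sup>2 * (if even j then 1 else -1) * Im (x * cnj y)"
  unfolding fold_linear_def cmod_power2 by (auto simp: power2_eq_square algebra_simps)

lemma Im_mult_cnj_eq_0_iff: "Im (x * cnj y) = 0 \<longleftrightarrow> Im (x / y) = 0"
  by (cases "y = 0") (auto simp: Im_divide complex_eq_iff)

lemma fold_linear_edge:
  assumes "v (Suc (e (Suc j)) mod n) - v (e (Suc j)) \<noteq> 0"
  shows "fold_linear n e v (Suc j) (v (Suc (e (Suc j)) mod n) - v (e (Suc j)))
    = fold_linear n e v j (v (Suc (e (Suc j)) mod n) - v (e (Suc j)))"
  using assms by (simp add: fold_linear_def Let_def)

lemma unfold_map_edge_path: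
  "unfold_map n P f Q j (edge_path n Q i r) = unfold_map n P f Q j (Q i)
    + of_real r * fold_linear n (hit_edge n P f) Q j (Q (Suc i mod n) - Q i)"
proof -
  have "edge_path n Q i r = Q i + of_real r * (Q (Suc i mod n) - Q i)"
    by (simp add: edge_path_def linepath_def scaleR_conv_of_real algebra_simps)
  then show ?thesis
    by (simp add: unfold_map_add del: unfold_map.simps)
qed

context periodic_billiard
begin

text \<open>The argument varies with \<open>Q\<close> because the recursion applies the newest
  mirror, which depends on \<open>Q\<close>, first.\<close>

lemma tendsto_unfold_map:
  assumes "j \<le> hits" "(z \<longlongrightarrow> \<zeta>) (near n P)"
  shows "((\<lambda>Q. unfold_map n P f Q j (z Q)) \<longlongrightarrow> unfold_map n P f P j \<zeta>) (near n P)"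
  using assms
proof (induction j arbitrary: z \<zeta>)
  case 0
  then show ?case
    using hit_edge(1)[of 0] by (auto intro!: tendsto_intros tendsto_edge_path)
next
  case (Suc j)
  have i: "lab (Suc j) < n" "Suc (lab (Suc j)) mod n < n"
    using hit_edge(1)[OF Suc.prems(1)] by auto
  have "((\<lambda>Q. mirror n Q (lab (Suc j)) (z Q)) \<longlongrightarrow> mirror n P (lab (Suc j)) \<zeta>) (near n P)"
    unfolding mirror_def Let_def
    by (intro tendsto_intros Suc.prems i ngon_edge_nonzero[OF ngon])
  then show ?case
    unfolding unfold_map.simps o_apply using Suc.prems(1) by (intro Suc.IH) auto
qed

lemma tendsto_fold_linear:
  assumes "j \<le> hits" "(z \<longlongrightarrow> \<zeta>) (near n P)"
  shows "((\<lambda>Q. fold_linear n lab Q j (z Q)) \<longlongrightarrow> fold_linear n lab P j \<zeta>) (near n P)"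
proof -
  have eq: "fold_linear n lab Q j w = unfold_map n P f Q j w - unfold_map n P f Q j 0" for Q w
    using unfold_map_add[of n P f Q j 0 w] by simp
  show ?thesis
    unfolding eq by (intro tendsto_intros tendsto_unfold_map assms)
qed

lemma tendsto_transfer_end: "(transfer_end n P f \<longlongrightarrow> slope 0) (near n P)"
  unfolding transfer_end_self[symmetric] transfer_end_def Let_def
  using hit_edge(1)[of hits] by (intro tendsto_unfold_map tendsto_edge_path) auto

lemma crossing_transversal:
  assumes "j \<le> hits"
  shows "Im (slope 0 * cnj (fold_linear n lab P j (dir (lab j)))) \<noteq> 0"
proof -
  have norm: "cmod (fold_coeff n lab P k) = 1" if "k \<le> hits" for k
    using that by (intro fold_coeff_norm ngon_edge_nonzero[OF ngon] hit_edge(1)) auto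
  have *: "Im (slope 0 * cnj (fold_linear n lab P k d)) \<noteq> 0" if "k < hits" "Im (slope k / d) \<noteq> 0" for k d
    using unfolded_start[OF that(1)] Im_fold_linear_mult[of n lab P k "slope k" d] norm[of k] that
      Im_mult_cnj_eq_0_iff[of "slope k" d] by (auto split: if_splits)
  show ?thesis
  proof (cases "j < hits")
    case True
    then show ?thesis by (intro * transversal_start)
  next
    case False
    \<comment> \<open>The last edge is shared with the preceding copy, where the incoming slope is
      available.\<close>
    then obtain k where k: "j = Suc k" "k < hits"
      using assms hits by (cases j) auto
    have d: "dir (lab (Suc k)) \<noteq> 0"
      using k by (intro ngon_edge_nonzero[OF ngon] hit_edge(1)) auto
    show ?thesis
      unfolding k(1) fold_linear_edge[where v = P and e = lab and j = k and n = n, OF d]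
      by (intro * transversal_end k(2))
  qed
qed

definition cross_dir :: "nat \<Rightarrow> (nat \<Rightarrow> complex) \<Rightarrow> complex" where
  "cross_dir j Q = fold_linear n lab Q j (Q (Suc (lab j) mod n) - Q (lab j))"

definition cross_base :: "nat \<Rightarrow> (nat \<Rightarrow> complex) \<Rightarrow> complex" where
  "cross_base j Q = unfold_map n P f Q j (Q (lab j))"

text \<open>
  Cramer's rule for the intersection of the transferred line with the line of edge number \<open>j\<close>.
\<close>

definition cross_time :: "nat \<Rightarrow> (nat \<Rightarrow> complex) \<Rightarrow> real" where
  "cross_time j Q = Im (cross_base j Q * cnj (cross_dir j Q)) / Im (transfer_end n P f Q * cnj (cross_dir j Q))"

definition cross_param :: "nat \<Rightarrow> (nat \<Rightarrow> complex) \<Rightarrow> real" where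
  "cross_param j Q = Re ((of_real (cross_time j Q) * transfer_end n P f Q - cross_base j Q) / cross_dir j Q)"

lemma cross_time_unique:
  assumes "Im (transfer_end n P f Q * cnj (cross_dir j Q)) \<noteq> 0"
    "of_real s * transfer_end n P f Q = cross_base j Q + of_real r * cross_dir j Q"
  shows "cross_time j Q = s" "cross_param j Q = r"
proof -
  \<comment> \<open>Multiplying by the conjugate of the edge direction and taking imaginary parts
    eliminates the unknown \<open>r\<close>.\<close>
  have "Im (of_real s * transfer_end n P f Q * cnj (cross_dir j Q))
      = Im (cross_base j Q * cnj (cross_dir j Q)) + Im (of_real r * (cross_dir j Q * cnj (cross_dir j Q)))"
    unfolding assms(2) by (simp add: algebra_simps)
  also have "Im (of_real r * (cross_dir j Q * cnj (cross_dir j Q))) = 0"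
    by (simp only: Im_complex_of_real complex_mult_cnj of_real_mult[symmetric])
  finally have "s * Im (transfer_end n P f Q * cnj (cross_dir j Q)) = Im (cross_base j Q * cnj (cross_dir j Q))"
    by (simp add: algebra_simps)
  then show s: "cross_time j Q = s"
    unfolding cross_time_def using assms(1) by (simp add: field_simps)
  have "cross_dir j Q \<noteq> 0"
    using assms(1) by auto
  then show "cross_param j Q = r"
    unfolding cross_param_def s assms(2) by simp
qed

lemma cross_point:
  assumes "Im (transfer_end n P f Q * cnj (cross_dir j Q)) \<noteq> 0"
  shows "unfold_map n P f Q j (edge_path n Q (lab j) (cross_param j Q))
    = of_real (cross_time j Q) * transfer_end n P f Q"
proof -
  let ?T = "transfer_end n P f Q" and ?d = "cross_dir j Q" and ?a = "cross_base j Q"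
  let ?q = "(of_real (cross_time j Q) * ?T - ?a) / ?d"
  have d: "?d \<noteq> 0" using assms by auto
  have "Im ((of_real (cross_time j Q) * ?T - ?a) * cnj ?d)
      = cross_time j Q * Im (?T * cnj ?d) - Im (?a * cnj ?d)"
    by (simp add: algebra_simps)
  also have "\<dots> = 0"
    using assms by (simp add: cross_time_def)
  finally have "Im ?q = 0"
    using Im_mult_cnj_eq_0_iff by blast
  then have "of_real (cross_param j Q) = ?q"
    by (simp add: cross_param_def complex_eq_iff)
  then have "of_real (cross_param j Q) * ?d = of_real (cross_time j Q) * ?T - ?a"
    using d by simp
  then show ?thesis
    unfolding unfold_map_edge_path cross_dir_def[symmetric] cross_base_def[symmetric] by simp
qed

text \<open>Identifies the limits of crossing times and parameters as \<open>Q\<close> tends to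
  \<open>P\<close>.\<close>

lemma cross_at_P:
  assumes "j \<le> hits"
  shows "cross_time j P = hit j" "cross_param j P = hit_param n P f j"
proof -
  have "of_real (hit j) * transfer_end n P f P = cross_base j P + of_real (hit_param n P f j) * cross_dir j P"
    unfolding cross_base_def cross_dir_def unfold_map_edge_path[symmetric] hit_param(3)[OF assms, symmetric]
    by (simp add: unfolded_end[OF assms] transfer_end_self)
  moreover have "Im (transfer_end n P f P * cnj (cross_dir j P)) \<noteq> 0"
    using crossing_transversal[OF assms] by (simp add: cross_dir_def transfer_end_self)
  ultimately show "cross_time j P = hit j" "cross_param j P = hit_param n P f j"
    by (blast intro: cross_time_unique)+
qed

lemma cross_limits:
  assumes "j \<le> hits"
  shows "((\<lambda>Q. Im (transfer_end n P f Q * cnj (cross_dir j Q))) \<longlongrightarrow>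
      Im (transfer_end n P f P * cnj (cross_dir j P))) (near n P)"
    "Im (transfer_end n P f P * cnj (cross_dir j P)) \<noteq> 0"
    "(cross_time j \<longlongrightarrow> hit j) (near n P)" "(cross_param j \<longlongrightarrow> hit_param n P f j) (near n P)"
proof -
  have i: "lab j < n" "Suc (lab j) mod n < n"
    using hit_edge(1)[OF assms] by auto
  have T: "(transfer_end n P f \<longlongrightarrow> transfer_end n P f P) (near n P)"
    using tendsto_transfer_end by (simp add: transfer_end_self)
  have d: "(cross_dir j \<longlongrightarrow> cross_dir j P) (near n P)"
    unfolding cross_dir_def by (intro tendsto_fold_linear assms tendsto_intros i)
  have b: "(cross_base j \<longlongrightarrow> cross_base j P) (near n P)"
    unfolding cross_base_def by (intro tendsto_unfold_map assms tendsto_intros i)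
  show 1: "((\<lambda>Q. Im (transfer_end n P f Q * cnj (cross_dir j Q))) \<longlongrightarrow>
      Im (transfer_end n P f P * cnj (cross_dir j P))) (near n P)"
    by (intro tendsto_intros T d)
  show nz: "Im (transfer_end n P f P * cnj (cross_dir j P)) \<noteq> 0"
    using crossing_transversal[OF assms] by (simp add: cross_dir_def transfer_end_self)
  have "((\<lambda>Q. cross_time j Q) \<longlongrightarrow> cross_time j P) (near n P)"
    unfolding cross_time_def by (intro tendsto_intros T d b nz)
  then show ct: "(cross_time j \<longlongrightarrow> hit j) (near n P)"
    by (simp add: cross_at_P[OF assms])
  have "cross_dir j P \<noteq> 0"
    using nz by auto
  then have "((\<lambda>Q. cross_param j Q) \<longlongrightarrow> cross_param j P) (near n P)"
    unfolding cross_param_def cross_at_P(1)[OF assms] by (intro tendsto_intros T d b ct)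
  then show "(cross_param j \<longlongrightarrow> hit_param n P f j) (near n P)"
    by (simp add: cross_at_P[OF assms])
qed

text \<open>These times are exact for each \<open>Q\<close>, not just limits: the transfer places
  its two ends at the edge parameters of the first and the last strike on \<open>P\<close>.\<close>

lemma cross_time_ends:
  assumes "0 < hits" "ends_translate n P f Q"
    "\<And>j. j \<le> hits \<Longrightarrow> Im (transfer_end n P f Q * cnj (cross_dir j Q)) \<noteq> 0"
  shows "cross_time 0 Q = 0" "cross_time hits Q = 1"
proof -
  have "of_real 0 * transfer_end n P f Q = cross_base 0 Q + of_real (hit_param n P f 0) * cross_dir 0 Q"
    unfolding cross_base_def cross_dir_def unfold_map_edge_path[symmetric] by simp
  from cross_time_unique(1)[OF assms(3) this] show "cross_time 0 Q = 0"
    by simp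
  have "of_real 1 * transfer_end n P f Q
      = cross_base hits Q + of_real (hit_param n P f hits) * cross_dir hits Q"
    unfolding cross_base_def cross_dir_def unfold_map_edge_path[symmetric]
    by (simp add: transfer_end_def Let_def)
  from cross_time_unique(1)[OF assms(3) this] show "cross_time hits Q = 1"
    by simp
qed

lemma crossing_number_imp_translate:
  assumes "\<And>i. i < n \<Longrightarrow> crossing_number lab hits i = 0" "ngon n Q"
  shows "ends_translate n P f Q"
proof -
  have "fold_coeff n lab Q hits = (\<Prod>i<n. ((Q (Suc i mod n) - Q i) / cnj (Q (Suc i mod n) - Q i))
      powi (- crossing_number lab hits i))"
    using hit_edge(1) ngon_edge_nonzero[OF assms(2)] by (intro fold_coeff_eq_prod) auto
  also have "\<dots> = 1"
    using assms(1) by simp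
  finally show ?thesis
    using translate_P by (simp add: ends_translate_iff)
qed

text \<open>Copies \<open>j\<close> and \<open>j + 1\<close> agree on their common edge, so between
  these crossings the line is the image in copy \<open>j\<close> of the chord joining the crossing
  points. \<open>seg\<close> then yields containment and, by injectivity of the copy map, avoidance
  of the vertices.\<close>

lemma transferred_trajectoryI:
  assumes ngon_Q: "ngon n Q" and trans: "ends_translate n P f Q" and T: "transfer_end n P f Q \<noteq> 0"
    and den: "\<And>j. j \<le> hits \<Longrightarrow> Im (transfer_end n P f Q * cnj (cross_dir j Q)) \<noteq> 0"
    and param: "\<And>j. j \<le> hits \<Longrightarrow> 0 < cross_param j Q \<and> cross_param j Q < 1"
    and time: "\<And>j. j < hits \<Longrightarrow> cross_time j Q < cross_time (Suc j) Q"
    and seg: "\<And>j. j < hits \<Longrightarrow> closed_segment (edge_path n Q (lab j) (cross_param j Q))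
      (edge_path n Q (lab (Suc j)) (cross_param (Suc j) Q)) \<subseteq> region n Q - vertices n Q"
  shows "transferred_trajectory n P f Q (\<lambda>t. of_real t * transfer_end n P f Q) (\<lambda>j. cross_time j Q)"
proof -
  let ?T = "transfer_end n P f Q" and ?s = "\<lambda>j. cross_time j Q"
  let ?x = "\<lambda>j. edge_path n Q (lab j) (cross_param j Q)"
  have in_edge: "?x j \<in> edge n Q (lab j)" if "j \<le> hits" for j
    using edge_path_interior[OF ngon_Q hit_edge(1)[OF that]] param[OF that] by blast
  have copy: "\<exists>z\<in>closed_segment (?x j) (?x (Suc j)). of_real t * ?T = unfold_map n P f Q j z"
    if j: "j < hits" and t: "?s j \<le> t" "t \<le> ?s (Suc j)" for j t
  proof
    let ?l = "(t - ?s j) / (?s (Suc j) - ?s j)"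
    let ?z = "?x j + of_real ?l * (?x (Suc j) - ?x j)"
    have l: "0 \<le> ?l" "?l \<le> 1"
      using t time[OF j] by auto
    have "?z = (1 - ?l) *\<^sub>R ?x j + ?l *\<^sub>R ?x (Suc j)"
      by (simp add: scaleR_conv_of_real algebra_simps)
    then show "?z \<in> closed_segment (?x j) (?x (Suc j))"
      unfolding in_segment using l by blast
    have "unfold_map n P f Q j (?x (Suc j)) = unfold_map n P f Q (Suc j) (?x (Suc j))"
      using j by (intro unfold_map_edge[symmetric] in_edge) simp
    also have "\<dots> = of_real (?s (Suc j)) * ?T"
      using j by (intro cross_point den) simp
    finally have x1: "unfold_map n P f Q j (?x (Suc j)) = of_real (?s (Suc j)) * ?T" .
    have x0: "unfold_map n P f Q j (?x j) = of_real (?s j) * ?T"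
      using j by (intro cross_point den) simp
    have "fold_linear n lab Q j (?x (Suc j) - ?x j) = of_real (?s (Suc j) - ?s j) * ?T"
      using unfold_map_add[of n P f Q j "?x j" "?x (Suc j) - ?x j"] x0 x1 by (simp add: algebra_simps)
    then have "unfold_map n P f Q j ?z = of_real (?s j) * ?T + of_real ?l * (of_real (?s (Suc j) - ?s j) * ?T)"
      unfolding unfold_map_add x0 fold_linear_of_real by simp
    also have "\<dots> = of_real (?s j + ?l * (?s (Suc j) - ?s j)) * ?T"
      by (simp only: of_real_add of_real_mult distrib_right mult.assoc)
    also have "?s j + ?l * (?s (Suc j) - ?s j) = t"
      using time[OF j] by simp
    finally show "of_real t * ?T = unfold_map n P f Q j ?z" ..
  qed
  have bij: "bij (unfold_map n P f Q j)" if "j \<le> hits" for j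
    using that by (intro bij_unfold_map ngon_edge_nonzero[OF ngon_Q] hit_edge(1)) auto
  have "traverses n P f Q (\<lambda>t. of_real t * ?T) ?s"
    unfolding traverses_def Let_def
  proof (intro conjI allI impI)
    show "?s hits = ?s 0 + 1"
      using cross_time_ends[OF hits trans den] by simp
    show "of_real (?s j) * ?T \<in> unfold_map n P f Q j ` edge n Q (lab j)" if "j \<le> hits" for j
      using cross_point[OF den[OF that]] in_edge[OF that] by (metis imageI)
    show "?s j \<le> ?s (Suc j)" if "j < hits" for j
      using time[OF that] by simp
    show "(\<lambda>t. of_real t * ?T) ` {?s j..?s (Suc j)} \<subseteq> unfold_map n P f Q j ` region n Q" if "j < hits" for j
      using copy[OF that] seg[OF that] by fastforce
  qed
  moreover have "\<not> strikes n P f Q (\<lambda>t. of_real t * ?T) ?s t j k" for t j k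
  proof
    assume "strikes n P f Q (\<lambda>t. of_real t * ?T) ?s t j k"
    then have j: "j < hits" "k < n" "?s j \<le> t" "t \<le> ?s (Suc j)" "of_real t * ?T = unfold_map n P f Q j (Q k)"
      by (auto simp: strikes_def)
    obtain z where z: "z \<in> closed_segment (?x j) (?x (Suc j))" "of_real t * ?T = unfold_map n P f Q j z"
      using copy[OF j(1,3,4)] by blast
    then have "z = Q k"
      using j(5) bij_is_inj[OF bij[of j]] j(1) by (auto dest: injD)
    then show False
      using z(1) seg[OF j(1)] j(2) by (auto simp: vertices_def)
  qed
  ultimately show ?thesis
    using trans T unfolding transferred_trajectory_def transferred_path_def
    by (auto intro!: exI[of _ 0])
qed

text \<open>The translation condition comes from the crossing numbers; everything else that
  \<open>transferred_trajectoryI\<close> asks is open and holds at \<open>P\<close>, by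
  transversality of the strikes.\<close>

lemma crossing_number_imp_stable:
  assumes "\<And>i. i < n \<Longrightarrow> crossing_number lab hits i = 0"
  shows "stable n P f"
proof -
  let ?x = "\<lambda>Q j. edge_path n Q (lab j) (cross_param j Q)"
  have T: "\<forall>\<^sub>F Q in near n P. transfer_end n P f Q \<noteq> 0"
    by (rule tendsto_imp_eventually_ne[OF tendsto_transfer_end slope_nonzero[OF hits]])
  have den: "\<forall>\<^sub>F Q in near n P. \<forall>j\<in>{..hits}. Im (transfer_end n P f Q * cnj (cross_dir j Q)) \<noteq> 0"
    by (intro eventually_ball_finite ballI tendsto_imp_eventually_ne[OF cross_limits(1,2)]) auto
  have param: "\<forall>\<^sub>F Q in near n P. \<forall>j\<in>{..hits}. 0 < cross_param j Q \<and> cross_param j Q < 1"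
    by (intro eventually_ball_finite ballI eventually_conj
        order_tendstoD[OF cross_limits(4)] hit_param) auto
  have "\<forall>\<^sub>F Q in near n P. cross_time j Q < cross_time (Suc j) Q" if j: "j < hits" for j
  proof -
    obtain c where c: "hit j < c" "c < hit (Suc j)"
      using dense[OF hit_time_less[OF j]] by blast
    have "\<forall>\<^sub>F Q in near n P. cross_time j Q < c" "\<forall>\<^sub>F Q in near n P. c < cross_time (Suc j) Q"
      using order_tendstoD(2)[OF cross_limits(3)[of j] c(1)]
        order_tendstoD(1)[OF cross_limits(3)[of "Suc j"] c(2)] j by auto
    then show ?thesis
      by eventually_elim simp
  qed
  then have time: "\<forall>\<^sub>F Q in near n P. \<forall>j\<in>{..<hits}. cross_time j Q < cross_time (Suc j) Q"
    by (intro eventually_ball_finite ballI) auto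
  have "\<forall>\<^sub>F Q in near n P. closed_segment (?x Q j) (?x Q (Suc j)) \<subseteq> region n Q - vertices n Q"
    if j: "j < hits" for j
  proof -
    have j': "j \<le> hits" "Suc j \<le> hits" using j by auto
    have lt: "hit j < hit (Suc j)"
      by (rule hit_time_less[OF j])
    have diff: "f (hit (Suc j)) - f (hit j) = of_real (hit (Suc j) - hit j) * slope j"
      using lt by (simp add: slope_def del: hit_time.simps)
    have Im: "Im (of_real r * w / d) = r * Im (w / d)" for r w d
      unfolding times_divide_eq_right[symmetric] by (simp del: times_divide_eq_right)
    have "Im ((f (hit (Suc j)) - f (hit j)) / dir (lab j)) \<noteq> 0"
      unfolding diff Im using transversal_start[OF j] lt by (simp del: hit_time.simps)
    moreover have "Im ((f (hit (Suc j)) - f (hit j)) / dir (lab (Suc j))) \<noteq> 0"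
      unfolding diff Im using transversal_end[OF j] lt by (simp del: hit_time.simps)
    ultimately show ?thesis
      using open_segment_inside[OF j] unfolding hit_param(3)[OF j'(1)] hit_param(3)[OF j'(2)]
      by (intro eventually_segment_in_region[OF ngon hit_edge(1)[OF j'(1)] hit_edge(1)[OF j'(2)]
          hit_param(1,2)[OF j'(1)] hit_param(1,2)[OF j'(2)]] cross_limits(4) j')
  qed
  then have seg: "\<forall>\<^sub>F Q in near n P. \<forall>j\<in>{..<hits}.
      closed_segment (?x Q j) (?x Q (Suc j)) \<subseteq> region n Q - vertices n Q"
    by (intro eventually_ball_finite ballI) auto
  from T den param time seg
  have "\<forall>\<^sub>F Q in near n P. ngon n Q \<longrightarrow> (\<exists>g s. transferred_trajectory n P f Q g s)"
  proof eventually_elim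
    case (elim Q)
    show ?case
    proof
      assume Q: "ngon n Q"
      have "transferred_trajectory n P f Q (\<lambda>t. of_real t * transfer_end n P f Q) (\<lambda>j. cross_time j Q)"
        by (rule transferred_trajectoryI[OF Q crossing_number_imp_translate[OF assms Q]]) (use elim in auto)
      then show "\<exists>g s. transferred_trajectory n P f Q g s" by blast
    qed
  qed
  then show ?thesis
    unfolding stable_def eventually_near by blast
qed

end

section \<open>The curve with detours\<close>

text \<open>A straight line passes each of the finitely many vertex positions at most once.\<close>

lemma finite_strike_times:
  assumes "\<And>t. g t = c + of_real t * T" "T \<noteq> 0"
  shows "finite {t. \<exists>j k. strikes n P f Q g s t j k}"
proof (rule finite_imageD)
  show "inj_on g {t. \<exists>j k. strikes n P f Q g s t j k}"
    using assms by (auto simp: inj_on_def)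
  have "g ` {t. \<exists>j k. strikes n P f Q g s t j k}
      \<subseteq> (\<lambda>(j, k). unfold_map n P f Q j (Q k)) ` ({..<num_hits n P f} \<times> {..<n})"
    by (force simp: strikes_def)
  then show "finite (g ` {t. \<exists>j k. strikes n P f Q g s t j k})"
    by (rule finite_subset) auto
qed

lemma finite_integer_translates:
  fixes S :: "real set"
  assumes "finite S"
  shows "finite ({t + of_int l | t l. t \<in> S} \<inter> {a..b})"
proof (rule finite_subset)
  show "{t + of_int l | t l. t \<in> S} \<inter> {a..b} \<subseteq> (\<Union>t\<in>S. (\<lambda>l. t + of_int l) ` {\<lfloor>a - t\<rfloor>..\<lceil>b - t\<rceil>})"
  proof clarsimp
    fix t :: real and l :: int assume t: "t \<in> S" "a \<le> t + of_int l" "t + of_int l \<le> b"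
    then have "\<lfloor>a - t\<rfloor> \<le> l" "l \<le> \<lceil>b - t\<rceil>"
      by (auto simp: floor_le_iff le_ceiling_iff)
    then show "\<exists>x\<in>S. t + of_int l \<in> (\<lambda>l. x + of_int l) ` {\<lfloor>a - x\<rfloor>..\<lceil>b - x\<rceil>}"
      using t(1) by (intro bexI[of _ t]) auto
  qed
  show "finite (\<Union>t\<in>S. (\<lambda>l. t + of_int l) ` {\<lfloor>a - t\<rfloor>..\<lceil>b - t\<rceil>})"
    using assms by simp
qed

text \<open>Each semicircle begins and ends on the line, so arcs and line agree where these closed
  pieces meet.\<close>

lemma continuous_arcs:
  fixes g \<gamma> :: "real \<Rightarrow> complex" and C :: "real set"
  assumes \<epsilon>: "0 < \<epsilon>" and fin: "\<And>a b. finite (C \<inter> {a..b})"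
    and g: "\<And>t. g t = c0 + of_real t * T"
    and arc: "\<And>c. c \<in> C \<Longrightarrow> \<exists>\<sigma>\<in>{1, -1}. \<forall>x\<in>{c - \<epsilon>..c + \<epsilon>}.
      \<gamma> x = g c + (g (c - \<epsilon>) - g c) * cis (\<sigma> * pi * (x - (c - \<epsilon>)) / (2 * \<epsilon>))"
    and line: "\<And>x. (\<And>c. c \<in> C \<Longrightarrow> \<epsilon> < \<bar>x - c\<bar>) \<Longrightarrow> \<gamma> x = g x"
  shows "continuous_on UNIV \<gamma>"
proof -
  have ends: "\<gamma> (c - \<epsilon>) = g (c - \<epsilon>)" "\<gamma> (c + \<epsilon>) = g (c + \<epsilon>)" if c: "c \<in> C" for c
  proof -
    obtain \<sigma> where \<sigma>: "\<sigma> \<in> {1, -1::real}" "\<And>x. x \<in> {c - \<epsilon>..c + \<epsilon>} \<Longrightarrow>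
      \<gamma> x = g c + (g (c - \<epsilon>) - g c) * cis (\<sigma> * pi * (x - (c - \<epsilon>)) / (2 * \<epsilon>))"
      using arc[OF c] by blast
    show "\<gamma> (c - \<epsilon>) = g (c - \<epsilon>)"
      using \<sigma>(2)[of "c - \<epsilon>"] \<epsilon> by simp
    have "\<sigma> * pi * (c + \<epsilon> - (c - \<epsilon>)) / (2 * \<epsilon>) = \<sigma> * pi"
      using \<epsilon> by (simp add: field_simps)
    moreover have "cis (\<sigma> * pi) = -1"
      using \<sigma>(1) by (auto simp: complex_eq_iff)
    ultimately have "\<gamma> (c + \<epsilon>) = g c - (g (c - \<epsilon>) - g c)"
      using \<sigma>(2)[of "c + \<epsilon>"] \<epsilon> by simp
    also have "\<dots> = g (c + \<epsilon>)"
      by (simp add: g algebra_simps)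
    finally show "\<gamma> (c + \<epsilon>) = g (c + \<epsilon>)" .
  qed
  have "continuous_on {x - 1..x + 1} \<gamma>" for x
  proof -
    \<comment> \<open>Only these finitely many centres have an arc that meets the interval;
      finiteness makes the union of arcs closed.\<close>
    define C' where "C' = C \<inter> {x - 1 - \<epsilon>..x + 1 + \<epsilon>}"
    define R where "R = (\<Inter>c\<in>C'. {y. \<epsilon> \<le> \<bar>y - c\<bar>})"
    have "finite C'"
      unfolding C'_def by (rule fin)
    have "{x - 1..x + 1} \<subseteq> (\<Union>c\<in>C'. {c - \<epsilon>..c + \<epsilon>}) \<union> ({x - 1..x + 1} \<inter> R)"
      by (force simp: R_def)
    moreover have "continuous_on ((\<Union>c\<in>C'. {c - \<epsilon>..c + \<epsilon>}) \<union> ({x - 1..x + 1} \<inter> R)) \<gamma>"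
    proof (rule continuous_on_closed_Un)
      show "closed (\<Union>c\<in>C'. {c - \<epsilon>..c + \<epsilon>})"
        using \<open>finite C'\<close> by auto
      show "closed ({x - 1..x + 1} \<inter> R)"
        unfolding R_def by (intro closed_Int closed_INT ballI closed_Collect_le continuous_intros)
      show "continuous_on (\<Union>c\<in>C'. {c - \<epsilon>..c + \<epsilon>}) \<gamma>"
      proof (rule continuous_on_closed_Union[OF \<open>finite C'\<close>])
        fix c assume "c \<in> C'"
        then have "c \<in> C" by (simp add: C'_def)
        then obtain \<sigma> where "\<forall>x\<in>{c - \<epsilon>..c + \<epsilon>}.
            \<gamma> x = g c + (g (c - \<epsilon>) - g c) * cis (\<sigma> * pi * (x - (c - \<epsilon>)) / (2 * \<epsilon>))"
          using arc by blast
        then show "continuous_on {c - \<epsilon>..c + \<epsilon>} \<gamma>"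
          by (subst continuous_on_cong[OF refl, where g =
              "\<lambda>x. g c + (g (c - \<epsilon>) - g c) * cis (\<sigma> * pi * (x - (c - \<epsilon>)) / (2 * \<epsilon>))"])
            (use \<epsilon> in \<open>auto intro!: continuous_intros\<close>)
      qed auto
      have "\<gamma> y = g y" if y: "y \<in> {x - 1..x + 1} \<inter> R" for y
      proof (cases "\<exists>c\<in>C. \<bar>y - c\<bar> = \<epsilon>")
        case True
        then obtain c where "c \<in> C" "y = c - \<epsilon> \<or> y = c + \<epsilon>"
          by (auto simp: abs_if split: if_splits)
        then show ?thesis using ends by auto
      next
        case False
        have "\<epsilon> < \<bar>y - c\<bar>" if c: "c \<in> C" for c
        proof (cases "c \<in> C'")
          case True
          then have "\<epsilon> \<le> \<bar>y - c\<bar>" using y by (auto simp: R_def)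
          moreover have "\<bar>y - c\<bar> \<noteq> \<epsilon>" using False c by blast
          ultimately show ?thesis by linarith
        next
          case False
          then have "c < x - 1 - \<epsilon> \<or> x + 1 + \<epsilon> < c" using c by (auto simp: C'_def)
          then show ?thesis using y by auto
        qed
        then show ?thesis by (rule line)
      qed
      then show "continuous_on ({x - 1..x + 1} \<inter> R) \<gamma>"
        by (subst continuous_on_cong[OF refl, where g = g]) (auto simp: g intro!: continuous_intros)
    qed
    ultimately show ?thesis
      by (rule continuous_on_subset[rotated])
  qed
  moreover have "x \<in> interior {x - 1..x + 1}" for x :: real
    by simp
  ultimately have "isCont \<gamma> x" for x
    by (blast intro: continuous_on_interior)
  then show ?thesis
    by (simp add: continuous_on_eq_continuous_at)
qed

text \<open>The detours are repeated around all integer translates of the strike times, so arcs go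
  to arcs and line to line when the parameter grows by 1.\<close>

lemma detour_properties:
  assumes det: "detour n P f Q g s \<epsilon> \<gamma>" and g: "\<And>t. g t = c0 + of_real t * T" and T: "T \<noteq> 0"
  shows "continuous_on UNIV \<gamma>" "\<gamma> (x + 1) = \<gamma> x + T"
proof -
  let ?S = "{t. \<exists>j k. strikes n P f Q g s t j k}"
  let ?C = "{t + of_int l | t l. t \<in> ?S}"
  have \<epsilon>: "0 < \<epsilon>"
    using det by (simp add: detour_def)
  have arc: "\<gamma> x = g (t + of_int l) + (g (t + of_int l - \<epsilon>) - g (t + of_int l)) *
      cis ((if left_of_trajectory n P f j k then 1 else - 1) * pi * (x - (t + of_int l - \<epsilon>)) / (2 * \<epsilon>))"
    if "strikes n P f Q g s t j k" "x \<in> {t + of_int l - \<epsilon>..t + of_int l + \<epsilon>}" for t j k l x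
    using det that unfolding detour_def Let_def by blast
  have line: "\<gamma> x = g x" if "\<And>c. c \<in> ?C \<Longrightarrow> \<epsilon> < \<bar>x - c\<bar>" for x
    using det that unfolding detour_def by blast
  show "continuous_on UNIV \<gamma>"
  proof (rule continuous_arcs[OF \<epsilon> _ g _ line])
    show "finite (?C \<inter> {a..b})" for a b
      by (rule finite_integer_translates[OF finite_strike_times[OF g T]])
    show "\<exists>\<sigma>\<in>{1, -1}. \<forall>x\<in>{c - \<epsilon>..c + \<epsilon>}.
      \<gamma> x = g c + (g (c - \<epsilon>) - g c) * cis (\<sigma> * pi * (x - (c - \<epsilon>)) / (2 * \<epsilon>))" if c: "c \<in> ?C" for c
    proof -
      obtain t l j k where t: "c = t + of_int l" "strikes n P f Q g s t j k"
        using c by blast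
      show ?thesis
        by (rule bexI[of _ "if left_of_trajectory n P f j k then 1 else - 1"])
          (use arc[OF t(2)] in \<open>simp_all add: t(1)\<close>)
    qed
  qed
  have step: "g (t + 1) = g t + T" for t
    by (simp add: g algebra_simps)
  show "\<gamma> (x + 1) = \<gamma> x + T"
  proof (cases "\<exists>c\<in>?C. \<bar>x - c\<bar> \<le> \<epsilon>")
    case True
    then obtain t l j k where t: "strikes n P f Q g s t j k" "\<bar>x - (t + of_int l)\<bar> \<le> \<epsilon>"
      by blast
    have "\<gamma> x = g (t + of_int l) + (g (t + of_int l - \<epsilon>) - g (t + of_int l)) *
      cis ((if left_of_trajectory n P f j k then 1 else - 1) * pi * (x - (t + of_int l - \<epsilon>)) / (2 * \<epsilon>))"
      using t(2) by (intro arc[OF t(1)]) (auto simp: abs_le_iff)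
    moreover have "\<gamma> (x + 1) = g (t + of_int (l + 1)) + (g (t + of_int (l + 1) - \<epsilon>) - g (t + of_int (l + 1))) *
      cis ((if left_of_trajectory n P f j k then 1 else - 1) * pi * (x + 1 - (t + of_int (l + 1) - \<epsilon>)) / (2 * \<epsilon>))"
      using t(2) by (intro arc[OF t(1)]) (auto simp: abs_le_iff)
    moreover have "g (t + of_int (l + 1)) = g (t + of_int l) + T"
      "g (t + of_int (l + 1) - \<epsilon>) = g (t + of_int l - \<epsilon>) + T"
      using step[of "t + of_int l"] step[of "t + of_int l - \<epsilon>"] by (simp_all add: algebra_simps)
    moreover have "x + 1 - (t + of_int (l + 1) - \<epsilon>) = x - (t + of_int l - \<epsilon>)"
      by simp
    ultimately show ?thesis
      by (simp only: add_diff_cancel_right) (simp add: algebra_simps)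
  next
    case False
    then have far: "\<epsilon> < \<bar>x - c\<bar>" if "c \<in> ?C" for c
      using that by force
    have "\<epsilon> < \<bar>x + 1 - c\<bar>" if "c \<in> ?C" for c
    proof -
      obtain t l where "c = t + of_int l" "t \<in> ?S"
        using \<open>c \<in> ?C\<close> by blast
      \<comment> \<open>The centres are invariant under integer shifts, so a point far from all of
        them stays far after a period.\<close>
      then have "c - 1 \<in> ?C"
        by (intro CollectI exI[of _ t] exI[of _ "l - 1"]) auto
      from far[OF this] show ?thesis
        by (simp add: algebra_simps)
    qed
    then show ?thesis
      using line[of x] line[of "x + 1"] far step by simp
  qed
qed

section \<open>Projecting the detoured curve to the double\<close>

lemma continuous_inv_unfold_map:
  assumes "bij (unfold_map n P f Q j)"
    "\<And>k. k \<in> {1..j} \<Longrightarrow> Q (Suc (hit_edge n P f k) mod n) - Q (hit_edge n P f k) \<noteq> 0"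
  shows "continuous_on X (inv_into UNIV (unfold_map n P f Q j))"
proof -
  let ?U = "unfold_map n P f Q j" and ?\<alpha> = "fold_coeff n (hit_edge n P f) Q j"
  have "cmod ?\<alpha> = 1"
    by (rule fold_coeff_norm[OF assms(2)])
  then have \<alpha>: "?\<alpha> \<noteq> 0" by auto
  define I where "I w = (if even j then (w - ?U 0) / ?\<alpha> else cnj ((w - ?U 0) / ?\<alpha>))" for w
  have "?U (I w) = w" for w
    using unfold_map_add[of n P f Q j 0 "I w"] \<alpha>
    by (simp add: fold_linear_def I_def del: complex_cnj_divide complex_cnj_diff unfold_map.simps)
  then have "inv_into UNIV ?U = I"
    using bij_is_inj[OF assms(1)] by (metis inv_f_f ext)
  then show ?thesis
    unfolding I_def using \<alpha> by (cases "even j") (auto intro!: continuous_intros)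
qed

text \<open>The end point lies over the same point of \<open>Q\<close> as the start, and copy 0
  places that point at 0; so the end point is the translation vector.\<close>

lemma transfer_period:
  assumes "periodic_billiard n P f" "ends_translate n P f Q"
  shows "unfold_map n P f Q (num_hits n P f) z = unfold_map n P f Q 0 z + transfer_end n P f Q"
proof -
  interpret periodic_billiard n P f by fact
  obtain c where c: "\<And>z. unfold_map n P f Q hits z = unfold_map n P f Q 0 z + c"
    using assms(2) by (auto simp: ends_translate_def)
  have "transfer_end n P f Q = c"
    by (simp add: transfer_end_def Let_def c hit_edge_last hit_param_last)
  then show ?thesis by (simp add: c)
qed

text \<open>Reading the curve back through the inverse copy maps gives arcs in \<open>Q\<close>.
  They fit together at crossings because adjacent copies share an edge.\<close>

lemma projected_path_curve:
  assumes billiard: "periodic_billiard n P f" and ngon_Q: "ngon n Q"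
    and trans: "ends_translate n P f Q"
    and off: "traverses_off_vertices n P f Q \<gamma> s"
    and cont: "continuous_on UNIV \<gamma>" and per: "\<And>x. \<gamma> (x + 1) = \<gamma> x + transfer_end n P f Q"
  shows "double_curve n (num_hits n P f) Q (\<lambda>j. inv_into UNIV (unfold_map n P f Q j) (\<gamma> (s j))) s
    (\<lambda>j t. inv_into UNIV (unfold_map n P f Q j) (\<gamma> t)) (hit_edge n P f) (projected_path n P f Q \<gamma> s)"
proof -
  interpret periodic_billiard n P f by fact
  let ?U = "unfold_map n P f Q"
  let ?q = "\<lambda>j t. inv_into UNIV (?U j) (\<gamma> t)"
  have trav: "s hits = s 0 + 1"
    and on_edge: "\<And>j. j \<le> hits \<Longrightarrow> \<gamma> (s j) \<in> ?U j ` edge n Q (lab j)"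
    and mono: "\<And>j. j < hits \<Longrightarrow> s j \<le> s (Suc j)"
    and in_copy: "\<And>j. j < hits \<Longrightarrow> \<gamma> ` {s j..s (Suc j)} \<subseteq> ?U j ` region n Q"
    using off by (auto simp: traverses_off_vertices_def traverses_def Let_def)
  have no_strike: "\<not> strikes n P f Q \<gamma> s t j k" for t j k
    using off by (auto simp: traverses_off_vertices_def)
  have nz: "Q (Suc (lab k) mod n) - Q (lab k) \<noteq> 0" if "k \<le> hits" for k
    by (rule ngon_edge_nonzero[OF ngon_Q hit_edge(1)[OF that]])
  have bij: "bij (?U j)" if "j \<le> hits" for j
    using that by (intro bij_unfold_map nz) auto
  have inv: "inv_into UNIV (?U j) (?U j z) = z" if "j \<le> hits" for j z
    by (rule inv_f_f[OF bij_is_inj[OF bij[OF that]]])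
  have edge: "?q j (s j) \<in> edge n Q (lab j)" if "j \<le> hits" for j
    using on_edge[OF that] inv[OF that] by auto
  have next_copy: "?q j (s (Suc j)) = ?q (Suc j) (s (Suc j))" if j: "j < hits" for j
  proof -
    obtain z where z: "z \<in> edge n Q (lab (Suc j))" "\<gamma> (s (Suc j)) = ?U (Suc j) z"
      using on_edge[of "Suc j"] j by auto
    have "?U (Suc j) z = ?U j z"
      by (rule unfold_map_edge[OF z(1)])
    then show ?thesis
      using z(2) inv[of j z] inv[of "Suc j" z] j by simp
  qed
  have s_le: "s i \<le> s j" if "i \<le> j" "j \<le> hits" for i j
    using that
  proof (induction rule: dec_induct)
    case (step k)
    then show ?case using mono[of k] by simp
  qed simp
  show ?thesis
  proof
    show "ngon n Q" by fact
    show "even hits"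
      using trans by (simp add: ends_translate_iff)
    show "s hits = s 0 + 1" by fact
    show "s j \<le> s (Suc j)" if "j < hits" for j
      by (rule mono[OF that])
    show "continuous_on {s j..s (Suc j)} (?q j)" if "j < hits" for j
      using that continuous_inv_unfold_map[OF bij[of j] nz, of UNIV]
      by (intro continuous_on_compose2[OF _ continuous_on_subset[OF cont]]) auto
    show "?q j t \<in> region n Q - vertices n Q" if j: "j < hits" and t: "t \<in> {s j..s (Suc j)}" for j t
    proof -
      obtain z where z: "z \<in> region n Q" "\<gamma> t = ?U j z"
        using in_copy[OF j] t by blast
      have "z \<notin> vertices n Q"
        using no_strike[of t j] j t z(2) by (auto simp: strikes_def vertices_def)
      then show ?thesis
        using z inv[of j z] j by simp
    qed
    show "?q j (s (Suc j)) = ?q (Suc j) (s (Suc j))" if "j < hits" for j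
      by (rule next_copy[OF that])
    \<comment> \<open>Over a period the curve and the copies move by the same translation.\<close>
    show "?q hits (s hits) = ?q 0 (s 0)"
    proof -
      obtain z where z: "\<gamma> (s hits) = ?U hits z"
        using on_edge[of hits] by auto
      then have "?U 0 z = \<gamma> (s 0)"
        using transfer_period[OF billiard trans, of z] per[of "s 0"] trav by simp
      then show ?thesis
        using z inv[of hits z] inv[of 0 z] by (metis le0 order_refl)
    qed
    show "lab j < n" "?q j (s j) \<in> edge n Q (lab j)" if "j \<le> hits" for j
      using hit_edge(1)[OF that] edge[OF that] by auto
    show "projected_path n P f Q \<gamma> s (t - s 0) = double_point n Q (?q j t, even j)"
      if j: "j < hits" and t: "t \<in> {s j..s (Suc j)}" for j t
    proof -
      \<comment> \<open>The least index may be smaller than \<open>j\<close>, but only if all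
        crossing times in between equal \<open>t\<close>. The point is then on the boundary at each
        of these crossings, where the sheets are identified.\<close>
      define i where "i = (LEAST i. t \<le> s (Suc i))"
      have i: "t \<le> s (Suc i)" "i \<le> j"
        unfolding i_def using t by (auto intro: LeastI Least_le)
      have "double_point n Q (?q i t, even i) = double_point n Q (?q k t, even k)" if "i \<le> k" "k \<le> j" for k
        using that
      proof (induction rule: dec_induct)
        case (step k)
        have "t = s (Suc k)"
          using i(1) s_le[of "Suc i" "Suc k"] s_le[of "Suc k" j] step j t by auto
        moreover have "?q (Suc k) (s (Suc k)) \<in> boundary n Q"
          using edge[of "Suc k"] hit_edge(1)[of "Suc k"] edge_subset_boundary step j by fastforce
        ultimately show ?case
          using step next_copy[of k] j by (simp add: double_point_eq_iff del: unfold_map.simps)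
      qed simp
      from this[OF i(2) order_refl] show ?thesis
        by (simp add: projected_path_def Let_def i_def)
    qed
  qed simp
qed

theorem lemma3p3:
  fixes n :: nat and P Q :: "nat \<Rightarrow> complex" and f g g_ring :: "real \<Rightarrow> complex"
    and s s_ring :: "nat \<Rightarrow> real" and \<epsilon> :: real
  assumes "ngon n P" and "ngon n Q"
    and "periodic_trajectory n P f"
    and "transferred_saddle_connection n P f Q g s"
    and "detour n P f Q g s \<epsilon> g_ring"
    and "traverses_off_vertices n P f Q g_ring s_ring"
  shows "stable n P f \<longleftrightarrow>
    null_homologous (double n Q) (projected_path n P f Q g_ring s_ring)"
proof -
  have "s (num_hits n P f) = s 0 + 1"
    using assms(4) by (simp add: transferred_saddle_connection_def transferred_path_def traverses_def Let_def)
  \<comment> \<open>Without strikes the period condition would read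
    \<open>s 0 = s 0 + 1\<close>.\<close>
  then have "num_hits n P f \<noteq> 0"
    by (intro notI) simp
  then interpret periodic_billiard n P f
    using assms by unfold_locales auto
  let ?T = "transfer_end n P f Q"
  obtain c where g: "\<And>t. g t = c + of_real t * ?T" and T: "?T \<noteq> 0" and trans: "ends_translate n P f Q"
    using assms(4) by (auto simp: transferred_saddle_connection_def transferred_path_def)
  note detour = detour_properties[OF assms(5) g T]
  interpret double_curve n hits Q "\<lambda>j. inv_into UNIV (unfold_map n P f Q j) (g_ring (s_ring j))" s_ring
    "\<lambda>j t. inv_into UNIV (unfold_map n P f Q j) (g_ring t)" lab "projected_path n P f Q g_ring s_ring"
    by (rule projected_path_curve[OF periodic_billiard_axioms assms(2) trans assms(6) detour])
  show ?thesis
    using stable_imp_crossing_number crossing_number_imp_stable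
      null_homologous_imp_crossing_number crossing_number_imp_null_homologous by blast
qed

end
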